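(* (i) Let $0 < s \leq 1$ and $1 < t \leq 2$. Then every $(s,t)$-Furstenberg set $K \subset \mathbb{R}^{2}$ satisfies $$ \dim_{\mathrm{H}} K \geq 2s + (1 - s)(t - 1). $$ (ii) More generally, let $d \geq 2$ be an integer, $1 < t \leq d$ and $0 < s \leq d - 1$. Then every $(d - 1,s,t)$-Furstenberg set $K \subset \mathbb{R}^{d}$ satisfies $$ \dim_{\mathrm{H}} K \geq (2s + 2 - d) + \frac{(t - 1)(d - 1 - s)}{d - 1}. $$
   Context: $\dim_{\mathrm{H}}$ denotes Hausdorff dimension. For integers $0 < n < d$, $\mathcal{A}(d,n)$ is the set of all affine $n$-planes in $\mathbb{R}^{d}$, equipped with the following metric. Given $V,W \in \mathcal{A}(d,n)$, write $V = V_{0} + a$ and $W = W_{0} + b$ with unique $n$-dimensional linear subspaces $V_{0},W_{0}$ and unique vectors $a \in V_{0}^{\perp}$, $b \in W_{0}^{\perp}$; then $d_{\mathcal{A}}(V,W) := \|\pi_{V_{0}} - \pi_{W_{0}}\|_{op} + |a - b|$, where $\pi_{V_0}$ is the orthogonal projection onto $V_0$ and $\|\cdot\|_{op}$ is the operator norm. A set $K \subset \mathbb{R}^{d}$ is called an $(n,s,t)$-Furstenberg set if there exists a family $\mathcal{V} \subset \mathcal{A}(d,n)$ with $\dim_{\mathrm{H}} \mathcal{V} = t$ (Hausdorff dimension with respect to $d_{\mathcal{A}}$) such that $\dim_{\mathrm{H}}(K \cap V) \geq s$ for all $V \in \mathcal{V}$. An $(s,t)$-Furstenberg set in $\mathbb{R}^{2}$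 is a $(1,s,t)$-Furstenberg set in $\mathbb{R}^{2}$. *)

theory Defs
  imports "HOL-Analysis.Analysis"
begin

context Metric_space
begin

definition mdiameter :: "'a set \<Rightarrow> real" where
  "mdiameter U = (if U = {} then 0 else SUP (x, y)\<in>U \<times> U. d x y)"

text \<open>Only exponents \<open>s > 0\<close> are used below, so that \<open>0 powr s = 0\<close>: empty sets and
  singletons contribute nothing, and sequences cover the case of finite covers as well.\<close>

definition hausdorff_premeasure :: "real \<Rightarrow> real \<Rightarrow> 'a set \<Rightarrow> ennreal" where
  "hausdorff_premeasure s \<delta> E =
     (INF U \<in> {U :: nat \<Rightarrow> 'a set. E \<subseteq> (\<Union>i. U i) \<and>
                   (\<forall>i. mbounded (U i) \<and> mdiameter (U i) \<le> \<delta>)}.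
        \<Sum>i. ennreal (mdiameter (U i) powr s))"

definition hausdorff_measure :: "real \<Rightarrow> 'a set \<Rightarrow> ennreal" where
  "hausdorff_measure s E = (SUP \<delta>\<in>{0<..}. hausdorff_premeasure s \<delta> E)"

text \<open>The value is \<open>\<infinity>\<close> if no exponent gives measure zero. The empty set has dimension \<open>0\<close>.\<close>

definition hausdorff_dim :: "'a set \<Rightarrow> ereal" where
  "hausdorff_dim E = Inf {ereal s | s. 0 < s \<and> hausdorff_measure s E = 0}"

end

definition affine_planes :: "nat \<Rightarrow> 'a::euclidean_space set set" where
  "affine_planes n = {V. affine V \<and> aff_dim V = int n}"

definition plane_direction :: "'a::euclidean_space set \<Rightarrow> 'a set" where
  "plane_direction V = (THE V0. subspace V0 \<and> affine_parallel V0 V)"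

definition plane_offset :: "'a::euclidean_space set \<Rightarrow> 'a" where
  "plane_offset V =
     (THE a. a \<in> (plane_direction V)\<^sup>\<bottom> \<and> V = (\<lambda>x. a + x) ` plane_direction V)"

text \<open>The span makes this the orthogonal projection onto a subspace for every argument \<open>S\<close>,
  hence always linear; for a subspace \<open>S\<close> it is the projection onto \<open>S\<close> itself.\<close>

definition orth_proj :: "'a::euclidean_space set \<Rightarrow> 'a \<Rightarrow> 'a" where
  "orth_proj S x = (THE y. y \<in> span S \<and> x - y \<in> (span S)\<^sup>\<bottom>)"

definition plane_dist :: "'a::euclidean_space set \<Rightarrow> 'a set \<Rightarrow> real" where
  "plane_dist V W =
     onorm (\<lambda>x. orth_proj (plane_direction V) x - orth_proj (plane_direction W) x)
     + norm (plane_offset V - plane_offset W)"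

lemma orth_proj_unique:
  assumes "y \<in> span S" "x - y \<in> (span S)\<^sup>\<bottom>"
  shows "orth_proj S x = y"
  unfolding orth_proj_def
proof (rule the_equality)
  fix z assume z: "z \<in> span S \<and> x - z \<in> (span S)\<^sup>\<bottom>"
  then have "z - y \<in> span S" using assms by (simp add: span_diff)
  moreover have "(x - y) - (x - z) \<in> (span S)\<^sup>\<bottom>"
    using z assms subspace_orthogonal_comp subspace_diff by blast
  ultimately have "orthogonal (z - y) (z - y)"
    by (simp add: orthogonal_comp_def)
  then show "z = y" by (simp add: orthogonal_def)
qed (use assms in auto)

lemma orth_proj_span: "orth_proj S x \<in> span S"
  and orth_proj_orth: "x - orth_proj S x \<in> (span S)\<^sup>\<bottom>"
proof -
  obtain y z where yz: "y \<in> span S" "\<And>w. w \<in> span S \<Longrightarrow> orthogonal z w" "x = y + z"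
    using orthogonal_subspace_decomp_exists[of S x] by blast
  then have "x - y \<in> (span S)\<^sup>\<bottom>" by (auto simp: orthogonal_comp_def orthogonal_commute)
  with yz have "orth_proj S x = y" "y \<in> span S" "x - y \<in> (span S)\<^sup>\<bottom>"
    using orth_proj_unique by blast+
  then show "orth_proj S x \<in> span S" "x - orth_proj S x \<in> (span S)\<^sup>\<bottom>" by auto
qed

lemma bounded_linear_orth_proj: "bounded_linear (orth_proj S)"
proof -
  have "linear (orth_proj S)"
  proof (rule linearI)
    fix x y
    have "(x - orth_proj S x) + (y - orth_proj S y) \<in> (span S)\<^sup>\<bottom>"
      using orth_proj_orth subspace_orthogonal_comp subspace_add by blast
    then show "orth_proj S (x + y) = orth_proj S x + orth_proj S y"
      by (intro orth_proj_unique span_add orth_proj_span) (simp add: algebra_simps)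
  next
    fix c x
    have "c *\<^sub>R (x - orth_proj S x) \<in> (span S)\<^sup>\<bottom>"
      using orth_proj_orth subspace_orthogonal_comp subspace_scale by blast
    then show "orth_proj S (c *\<^sub>R x) = c *\<^sub>R orth_proj S x"
      by (intro orth_proj_unique span_scale orth_proj_span) (simp add: algebra_simps)
  qed
  then show ?thesis by (simp add: linear_conv_bounded_linear)
qed

lemma plane_direction:
  assumes "V \<in> affine_planes n"
  shows "subspace (plane_direction V)" "affine_parallel (plane_direction V) V"
    and "dim (plane_direction V) = n"
proof -
  have "affine V" "aff_dim V = int n" using assms by (auto simp: affine_planes_def)
  moreover from this have "V \<noteq> {}" by auto
  ultimately have "\<exists>!L. subspace L \<and> affine_parallel L V"
    using affine_parallel_subspace[of V] by (metis affine_parallel_commute)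
  then have *: "subspace (plane_direction V) \<and> affine_parallel (plane_direction V) V"
    unfolding plane_direction_def by (rule theI')
  then show "subspace (plane_direction V)" "affine_parallel (plane_direction V) V" by auto
  have "aff_dim V = aff_dim (plane_direction V)"
    using * by (metis affine_parallel_def aff_dim_translation_eq)
  then show "dim (plane_direction V) = n"
    using * \<open>aff_dim V = int n\<close> by (simp add: aff_dim_subspace)
qed

lemma plane_offset_ex1:
  assumes "V \<in> affine_planes n"
  shows "\<exists>!a. a \<in> (plane_direction V)\<^sup>\<bottom> \<and> V = (\<lambda>x. a + x) ` plane_direction V"
proof -
  define L where "L = plane_direction V"
  have L: "subspace L" using plane_direction(1)[OF assms] L_def by simp
  then have sp: "span L = L" by (simp add: span_eq_iff)
  obtain b where b: "V = (\<lambda>x. b + x) ` L"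
    using plane_direction(2)[OF assms] L_def by (auto simp: affine_parallel_def)
  define p where "p = orth_proj L b"
  have p: "p \<in> L" "b - p \<in> L\<^sup>\<bottom>"
    using orth_proj_span[of L b] orth_proj_orth[of b L] by (auto simp: p_def sp)
  have V: "V = (\<lambda>x. (b - p) + x) ` L"
  proof (intro set_eqI iffI)
    fix v assume "v \<in> V"
    then obtain x where "x \<in> L" "v = b + x" using b by auto
    then have "p + x \<in> L" "v = (b - p) + (p + x)" using p L subspace_add by auto
    then show "v \<in> (\<lambda>x. (b - p) + x) ` L" by blast
  next
    fix v assume "v \<in> (\<lambda>x. (b - p) + x) ` L"
    then obtain x where "x \<in> L" "v = (b - p) + x" by auto
    then have "x - p \<in> L" "v = b + (x - p)" using p L subspace_diff by auto
    then show "v \<in> V" using b by blast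
  qed
  have "a = b - p" if a: "a \<in> L\<^sup>\<bottom>" "V = (\<lambda>x. a + x) ` L" for a
  proof -
    have "a + 0 \<in> V" using a L subspace_0 by blast
    then obtain x where x: "x \<in> L" "a = (b - p) + x" using V by auto
    have "a - (b - p) \<in> L\<^sup>\<bottom>" using a p subspace_orthogonal_comp subspace_diff by blast
    then have "orthogonal x x" using x by (auto simp: orthogonal_comp_def)
    then show ?thesis using x by (simp add: orthogonal_def)
  qed
  then show ?thesis using p V unfolding L_def[symmetric] by blast
qed

lemma plane_offset:
  assumes "V \<in> affine_planes n"
  shows "plane_offset V \<in> (plane_direction V)\<^sup>\<bottom>"
    and "V = (\<lambda>x. plane_offset V + x) ` plane_direction V"
  using theI'[OF plane_offset_ex1[OF assms]] unfolding plane_offset_def by auto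

lemma Metric_space_affine_planes: "Metric_space (affine_planes n) plane_dist"
proof
  have bl: "bounded_linear (\<lambda>x. orth_proj S x - orth_proj T x)" for S T :: "'a set"
    by (intro bounded_linear_sub bounded_linear_orth_proj)
  fix V W :: "'a set"
  show "0 \<le> plane_dist V W"
    unfolding plane_dist_def by (intro add_nonneg_nonneg onorm_pos_le bl norm_ge_zero)
  show "plane_dist V W = plane_dist W V"
    unfolding plane_dist_def
    using onorm_neg[of "\<lambda>x. orth_proj (plane_direction V) x - orth_proj (plane_direction W) x"]
    by (simp add: norm_minus_commute)
  show "plane_dist V X \<le> plane_dist V W + plane_dist W X" for X
    unfolding plane_dist_def
    using onorm_triangle[OF bl bl, of "plane_direction V" "plane_direction W"
        "plane_direction W" "plane_direction X"]
      norm_triangle_ineq[of "plane_offset V - plane_offset W" "plane_offset W - plane_offset X"]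
    by simp
  assume V: "V \<in> affine_planes n" and W: "W \<in> affine_planes n"
  show "plane_dist V W = 0 \<longleftrightarrow> V = W"
  proof
    assume "plane_dist V W = 0"
    then have "onorm (\<lambda>x. orth_proj (plane_direction V) x - orth_proj (plane_direction W) x) = 0"
      and a: "plane_offset V = plane_offset W"
      using onorm_pos_le[OF bl, of "plane_direction V" "plane_direction W"]
      unfolding plane_dist_def by (auto simp: add_nonneg_eq_0_iff)
    then have eq: "orth_proj (plane_direction V) x = orth_proj (plane_direction W) x" for x
      using onorm_eq_0[OF bl] by force
    have rng: "range (orth_proj U) = U" if "subspace U" for U :: "'a set"
    proof -
      have sp: "span U = U" using that by (simp add: span_eq_iff)
      have "orth_proj U x = x" if "x \<in> U" for x
        using that \<open>subspace U\<close>
        by (intro orth_proj_unique) (auto simp: sp subspace_0 subspace_orthogonal_comp)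
      then show ?thesis using orth_proj_span[of U] sp by (auto simp: image_iff) metis
    qed
    have "plane_direction V = plane_direction W"
      using rng plane_direction(1) V W eq by (metis (no_types, lifting) image_cong)
    then show "V = W" using plane_offset(2) V W a by metis
  next
    assume "V = W"
    then show "plane_dist V W = 0" by (simp add: plane_dist_def onorm_zero)
  qed
qed

definition furstenberg_set :: "nat \<Rightarrow> real \<Rightarrow> real \<Rightarrow> 'a::euclidean_space set \<Rightarrow> bool" where
  "furstenberg_set n s t K \<longleftrightarrow>
     (\<exists>\<V> \<subseteq> affine_planes n.
        Metric_space.hausdorff_dim (affine_planes n) plane_dist \<V> = ereal t \<and>
        (\<forall>V\<in>\<V>. Met_TC.hausdorff_dim (K \<inter> V) \<ge> ereal s))"

end

(*
  Write d for the dimension. A hyperplane that is a graph over the complement of a coordinate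
  vector u is encoded by a point w of the same space, so a t-dimensional family of hyperplanes
  becomes a t-dimensional set of points. At scale 2^-k choose a finitely supported Frostman weight
  m on it and let E be the union of the covering balls of K of that scale. The claim reduces to an
  upper bound for the integral over E of F(x), the normalised m-mass of the hyperplanes passing
  within 2^-k of x.

  F is split into dyadic pieces F_r whose one-dimensional kernels have d-fold cancellation. Each
  piece is bounded by r^(t-d), because a slab of width r consists of about r^(1-d) balls of radius
  r. Its L2 norm squared is bounded by r^(t-1): the pairing of two hyperplanes at parameter
  distance D > r is at most r^d / D^(d+1), since the cancellation can be transferred to a smooth
  cut-off by translating along a vector that is transversal to one hyperplane and parallel to the
  other. Interpolating between the two bounds makes every scale contribute at most a constant times
  |E|^((d-1)/(2d-t-1)).

  On the other side each hyperplane meets E in about 2^(ks) balls, so comparing the two bounds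
  gives a lower bound for the number of covering balls, hence for the dimension of K. Pigeonholing
  over the scales costs only factors 2^(-eta k).
*)

theory Submission
  imports Defs
begin

section \<open>Iterated shift differences and a smooth cut-off\<close>


text \<open>Without cancellation the pairing of two slabs of width r at parameter distance D is of
  order 1 / D. Summed against a t-dimensional weight with t > 1 this is bounded but does not get
  smaller with r, so nothing is gained at small scales. A kernel with d-fold cancellation turns 1 /
  D into r^d / D^(d+1), and since t \<le> d the dyadic sum is dominated by D close to r, which
  produces r^(t-1). Cancellation is created by finite averages over translates: they telescope
  exactly, they can be moved to the other factor by translation invariance, and only finitely many
  derivatives of the cut-off enter.

  Neither K nor the family of planes is assumed measurable. Hence sizes are measured by Hausdorff
  content, which is countably subadditive on all sets, and Frostman measures are replaced by weights
  on finite nets, one for each scale.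

  The threshold appears as d - (d-1-s)/\<gamma> with \<gamma> = (d-1)/(2d-t-1), the exponent of |E|
  in the incidence bound; since 2d-t-1 = 2(d-1) - (t-1), this is the claimed number.\<close>

definition shift_avg :: "nat \<Rightarrow> 'b::real_vector \<Rightarrow> ('b \<Rightarrow> real) \<Rightarrow> 'b \<Rightarrow> real" where
  "shift_avg n z f x = (\<Sum>i<n. f (x + real i *\<^sub>R z)) / real n"

text \<open>Annihilates constants and lowers the degree of polynomials, so the \<open>M\<close>-th
  power has \<open>M\<close>-fold cancellation. An average over \<open>n\<close> shifts is removed
  because a pulse whose width equals the step is thereby spread evenly over \<open>n\<close>
  steps.\<close>

definition shift_diff :: "nat \<Rightarrow> 'b::real_vector \<Rightarrow> ('b \<Rightarrow> real) \<Rightarrow> 'b \<Rightarrow> real" where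
  "shift_diff n z f x = f x - shift_avg n z f x"

lemma shift_diff_power_Suc:
  "(shift_diff n z ^^ Suc M) f x
    = (shift_diff n z ^^ M) f x - (\<Sum>i<n. (shift_diff n z ^^ M) f (x + real i *\<^sub>R z)) / real n"
  by (simp add: shift_diff_def shift_avg_def)

text \<open>Used in both directions: with \<open>e\<close> a line in space, to reduce to functions
  of one variable, and with \<open>e\<close> a height function, to turn differences of a profile
  into differences on the space.\<close>

lemma shift_diff_pullback:
  assumes "\<And>t i. e (t + real i *\<^sub>R c) = e t + real i *\<^sub>R z"
  shows "(shift_diff n z ^^ M) w (e t) = (shift_diff n c ^^ M) (\<lambda>t. w (e t)) t"
proof (induction M arbitrary: t)
  case (Suc M)
  show ?case
    by (simp only: shift_diff_power_Suc Suc.IH assms [symmetric])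
qed simp

lemma abs_shift_avg_le:
  assumes "\<And>x. \<bar>f x\<bar> \<le> C" "0 < n"
  shows "\<bar>shift_avg n z f x\<bar> \<le> C"
proof -
  have "\<bar>\<Sum>i<n. f (x + real i *\<^sub>R z)\<bar> \<le> (\<Sum>i<n. C)"
    by (rule order_trans[OF sum_abs]) (intro sum_mono assms)
  then show ?thesis using assms(2) by (simp add: shift_avg_def divide_simps mult.commute)
qed

lemma abs_shift_diff_le:
  assumes "\<And>x. \<bar>f x\<bar> \<le> C" "0 < n"
  shows "\<bar>shift_diff n z f x\<bar> \<le> 2 * C"
  using abs_shift_avg_le[of f C n z x, OF assms] assms(1)[of x] by (simp add: shift_diff_def)

lemma abs_shift_diff_power_le:
  assumes "\<And>x. \<bar>f x\<bar> \<le> C" "0 < n"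
  shows "\<bar>(shift_diff n z ^^ M) f x\<bar> \<le> 2 ^ M * C"
proof (induction M arbitrary: x)
  case (Suc M)
  then show ?case using abs_shift_diff_le[of "(shift_diff n z ^^ M) f" "2 ^ M * C" n z x] assms(2)
    by simp
qed (use assms in simp)

lemma shift_avg_diff_commute:
  "shift_avg n z (shift_diff n z f) = shift_diff n z (shift_avg n z f)"
  by (auto simp: fun_eq_iff shift_avg_def shift_diff_def sum_subtractf diff_divide_distrib
      sum_divide_distrib add_ac intro: sum.swap)

lemma shift_avg_diff_power_commute:
  "shift_avg n z ((shift_diff n z ^^ M) f) = (shift_diff n z ^^ M) (shift_avg n z f)"
  by (induction M) (simp_all add: shift_avg_diff_commute)

text \<open>With \<open>A\<close> the averaging operator, \<open>1 - (1 - A)^M\<close> is the sum of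
  \<open>(1 - A)^j A\<close> over \<open>j < M\<close>. Only the size of the average enters, which
  for a pulse is much smaller than that of \<open>f\<close>.\<close>

lemma abs_minus_shift_diff_power_le:
  assumes "\<And>x. \<bar>shift_avg n z f x\<bar> \<le> C" "0 < n"
  shows "\<bar>f x - (shift_diff n z ^^ M) f x\<bar> \<le> 2 ^ M * C"
proof (induction M)
  case 0
  have "0 \<le> C" using assms(1)[of x] by linarith
  then show ?case by simp
next
  case (Suc M)
  have "\<bar>shift_avg n z ((shift_diff n z ^^ M) f) x\<bar> \<le> 2 ^ M * C"
    unfolding shift_avg_diff_power_commute by (rule abs_shift_diff_power_le) (use assms in auto)
  moreover have "(shift_diff n z ^^ Suc M) f x
      = (shift_diff n z ^^ M) f x - shift_avg n z ((shift_diff n z ^^ M) f) x"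
    by (simp add: shift_diff_def)
  ultimately show ?case using Suc by simp
qed

lemma shift_diff_power_supported:
  fixes f :: "'b::real_normed_vector \<Rightarrow> real"
  assumes "\<And>x. \<rho> < norm x \<Longrightarrow> f x = 0" "\<rho> + real M * (real n * norm z) < norm x"
  shows "(shift_diff n z ^^ M) f x = 0"
  using assms(2)
proof (induction M arbitrary: x)
  case (Suc M)
  have *: "(shift_diff n z ^^ M) f (x + real i *\<^sub>R z) = 0" if "i < n" for i
  proof (rule Suc.IH)
    have "norm (real i *\<^sub>R z) \<le> real n * norm z" using that by (simp add: mult_right_mono)
    moreover have "norm x \<le> norm (x + real i *\<^sub>R z) + norm (real i *\<^sub>R z)"
      by (metis add_diff_cancel norm_triangle_ineq4)
    ultimately show "\<rho> + real M * (real n * norm z) < norm (x + real i *\<^sub>R z)"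
      using Suc.prems by (simp add: distrib_right)
  qed
  have "0 \<le> real n * norm z" by simp
  moreover have "\<rho> + (real M * (real n * norm z) + real n * norm z) < norm x"
    using Suc.prems by (simp add: distrib_right add_ac)
  ultimately have "(shift_diff n z ^^ M) f x = 0"
    using Suc.prems by (intro Suc.IH) linarith
  then show ?case using * by (simp only: shift_diff_power_Suc) simp
qed (use assms(1) in auto)

lemma measurable_shift_diff_power [measurable]:
  fixes f :: "'b::euclidean_space \<Rightarrow> real"
  assumes [measurable]: "f \<in> borel_measurable borel"
  shows "(shift_diff n z ^^ M) f \<in> borel_measurable borel"
proof (induction M)
  case (Suc M)
  note Suc[measurable]
  show ?case
    unfolding shift_diff_power_Suc[abs_def] by measurable
qed (use assms in simp)

text \<open>By the mean value theorem each application trades one derivative for a factor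
  \<open>n * c\<close>. The induction replaces the tower of derivatives by the tower of their
  differences, which is one step shorter.\<close>

lemma abs_shift_diff_deriv_le:
  fixes \<phi> :: "nat \<Rightarrow> real \<Rightarrow> real"
  assumes "\<And>k t. k < M \<Longrightarrow> (\<phi> k has_real_derivative \<phi> (Suc k) t) (at t)"
    and "\<And>t. \<bar>\<phi> M t\<bar> \<le> C" "0 < n" "0 \<le> c"
  shows "\<bar>(shift_diff n c ^^ M) (\<phi> 0) t\<bar> \<le> C * (real n * c) ^ M"
  using assms(1,2)
proof (induction M arbitrary: \<phi> C t)
  case (Suc M)
  have "0 \<le> C" using Suc.prems(2)[of 0] by linarith
  define \<psi> where "\<psi> k = shift_diff n c (\<phi> k)" for k
  have incr: "\<bar>\<phi> M (t + real i *\<^sub>R c) - \<phi> M t\<bar> \<le> C * (real n * c)" if "i < n" for i t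
  proof -
    have "norm (\<phi> M (t + real i *\<^sub>R c) - \<phi> M t) \<le> C * norm ((t + real i *\<^sub>R c) - t)"
      by (rule field_differentiable_bound[of UNIV "\<phi> M" "\<phi> (Suc M)"])
        (use Suc.prems in \<open>auto intro: has_field_derivative_at_within\<close>)
    also have "\<dots> \<le> C * (real n * c)"
      using \<open>0 \<le> C\<close> that assms(4) by (intro mult_left_mono) (auto intro: mult_right_mono)
    finally show ?thesis by simp
  qed
  have "\<bar>\<psi> M t\<bar> \<le> C * (real n * c)" for t
  proof -
    have "\<psi> M t = (\<Sum>i<n. \<phi> M t - \<phi> M (t + real i *\<^sub>R c)) / real n"
      using assms(3) by (simp add: \<psi>_def shift_diff_def shift_avg_def sum_subtractf diff_divide_distrib)
    moreover have "\<bar>\<Sum>i<n. \<phi> M t - \<phi> M (t + real i *\<^sub>R c)\<bar> \<le> (\<Sum>i<n. C * (real n * c))"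
      by (rule order_trans[OF sum_abs], rule sum_mono)
        (use incr in \<open>auto simp: abs_minus_commute\<close>)
    ultimately show ?thesis using assms(3) by (simp only: abs_divide) (simp add: pos_divide_le_eq mult_ac)
  qed
  moreover have "(\<psi> k has_real_derivative \<psi> (Suc k) t) (at t)" if "k < M" for k t
  proof -
    have "((\<lambda>t. \<phi> k (t + real i *\<^sub>R c)) has_real_derivative \<phi> (Suc k) (t + real i *\<^sub>R c)) (at t)" for i
      using Suc.prems(1)[of k] that by (simp flip: DERIV_shift)
    moreover have "(\<phi> k has_real_derivative \<phi> (Suc k) t) (at t)" using Suc.prems(1) that by simp
    ultimately show ?thesis
      unfolding \<psi>_def shift_diff_def[abs_def] shift_avg_def divide_inverse
      by (intro DERIV_diff DERIV_cmult_right DERIV_sum)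
  qed
  ultimately have "\<bar>(shift_diff n c ^^ M) (\<psi> 0) t\<bar> \<le> C * (real n * c) * (real n * c) ^ M"
    by (intro Suc.IH) auto
  then show ?case by (simp add: \<psi>_def funpow_swap1 mult.assoc)
qed simp

section \<open>A cut-off of finite smoothness and its iterated differences\<close>

lemma truncated_power_derivatives:
  obtains g :: "nat \<Rightarrow> real \<Rightarrow> real" and C where
    "g 0 = (\<lambda>s. max 0 (1 - s\<^sup>2) ^ Suc M)"
    "\<And>k t. k < M \<Longrightarrow> (g k has_real_derivative g (Suc k) t) (at t)"
    "\<And>t. \<bar>g M t\<bar> \<le> C"
proof -
  \<comment> \<open>The polynomial factor left after \<open>k\<close> derivatives, by the product
    rule; each derivative uses up one power of the truncation. Starting from exponent
    \<open>Suc M\<close> leaves one power after \<open>M\<close> derivatives, so the last function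
    is still continuous and hence bounded.\<close>
  define p :: "nat \<Rightarrow> real poly" where
    "p = rec_nat 1 (\<lambda>k q. pderiv q * [:1, 0, -1:] - smult (2 * real (Suc M - k)) (q * [:0, 1:]))"
  have p0: "p 0 = 1" by (simp add: p_def)
  have pS: "p (Suc k) = pderiv (p k) * [:1, 0, -1:] - smult (2 * real (Suc M - k)) (p k * [:0, 1:])" for k
    by (simp add: p_def)
  define g where "g k s = poly (p k) s * max 0 (1 - s\<^sup>2) ^ (Suc M - k)" for k and s :: real
  \<comment> \<open>From exponent two on, the truncated power is differentiable also at its kink,
    where the difference quotient is dominated by a positive power of the increment.\<close>
  have trunc: "((\<lambda>s. max 0 (1 - s\<^sup>2) ^ Suc (Suc m)) has_real_derivative
      real (Suc (Suc m)) * max 0 (1 - t\<^sup>2) ^ Suc m * (- 2 * t)) (at t)" for m and t :: real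
  proof -
    have D: "((\<lambda>y::real. max 0 y ^ Suc (Suc m)) has_real_derivative real (Suc (Suc m)) * max 0 y ^ Suc m) (at y)" for y
    proof (cases y "0::real" rule: linorder_cases)
      case less
      have "((\<lambda>y::real. 0) has_real_derivative 0) (at y)" by simp
      then have "((\<lambda>y::real. max 0 y ^ Suc (Suc m)) has_real_derivative 0) (at y)"
        by (rule has_field_derivative_transform_within[where d = "- y"])
          (use less in \<open>auto simp: dist_real_def max_def\<close>)
      then show ?thesis using less by simp
    next
      case equal
      have "((\<lambda>h::real. (max 0 (0 + h) ^ Suc (Suc m) - max 0 0 ^ Suc (Suc m)) / h) \<longlongrightarrow> 0) (at 0)"
      proof (rule Lim_null_comparison)
        show "\<forall>\<^sub>F h::real in at 0. norm ((max 0 (0 + h) ^ Suc (Suc m) - max 0 0 ^ Suc (Suc m)) / h) \<le> \<bar>h\<bar> ^ Suc m"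
          by (rule always_eventually) (auto simp: max_def mult_nonpos_nonneg)
        show "((\<lambda>h::real. \<bar>h\<bar> ^ Suc m) \<longlongrightarrow> 0) (at 0)"
          by (auto intro!: tendsto_eq_intros)
      qed
      then show ?thesis using equal by (simp add: DERIV_def)
    next
      case greater
      have "((\<lambda>y::real. y ^ Suc (Suc m)) has_real_derivative real (Suc (Suc m)) * y ^ Suc m) (at y)"
        by (rule derivative_eq_intros refl)+ simp
      then have "((\<lambda>y::real. max 0 y ^ Suc (Suc m)) has_real_derivative real (Suc (Suc m)) * y ^ Suc m) (at y)"
        by (rule has_field_derivative_transform_within[where d = y])
          (use greater in \<open>auto simp: dist_real_def max_def\<close>)
      then show ?thesis using greater by simp
    qed
    have "((\<lambda>s. 1 - s\<^sup>2) has_real_derivative - 2 * t) (at t)"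
      by (auto intro!: derivative_eq_intros)
    from DERIV_chain2[OF D this] show ?thesis by simp
  qed
  show thesis
  proof
    show "g 0 = (\<lambda>s. max 0 (1 - s\<^sup>2) ^ Suc M)" by (simp add: g_def p0 fun_eq_iff)
    show "(g k has_real_derivative g (Suc k) t) (at t)" if "k < M" for k t
    proof -
      define m where "m = M - Suc k"
      have m: "M = Suc (k + m)" using that by (simp add: m_def)
      have eq: "Suc M - k = Suc (Suc m)" "Suc M - Suc k = Suc m" unfolding m by simp_all
      define Q where "Q = max 0 (1 - t\<^sup>2) ^ Suc m"
      have Q: "max 0 (1 - t\<^sup>2) ^ Suc (Suc m) = (1 - t\<^sup>2) * Q"
        by (auto simp: Q_def max_def)
      have "((\<lambda>s. poly (p k) s * max 0 (1 - s\<^sup>2) ^ Suc (Suc m)) has_real_derivative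
          poly (p k) t * (real (Suc (Suc m)) * Q * (- 2 * t)) + poly (pderiv (p k)) t * ((1 - t\<^sup>2) * Q)) (at t)"
        using DERIV_mult'[OF poly_DERIV trunc, of "p k" m t] unfolding Q Q_def by (simp only: add.commute mult.commute)
      moreover have "poly (p (Suc k)) t * Q
          = poly (p k) t * (real (Suc (Suc m)) * Q * (- 2 * t)) + poly (pderiv (p k)) t * ((1 - t\<^sup>2) * Q)"
        unfolding pS eq by (simp add: algebra_simps power2_eq_square)
      ultimately show ?thesis unfolding g_def[abs_def] eq Q_def by simp
    qed
    define C where "C = (SUP s\<in>{-1..1}. \<bar>g M s\<bar>)"
    have "compact ((\<lambda>s. \<bar>g M s\<bar>) ` {-1..1})"
      unfolding g_def by (intro compact_continuous_image continuous_intros) auto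
    then have bdd: "bdd_above ((\<lambda>s. \<bar>g M s\<bar>) ` {-1..1})"
      by (simp add: bounded_imp_bdd_above compact_imp_bounded)
    show "\<bar>g M t\<bar> \<le> \<bar>C\<bar>" for t
    proof (cases "t \<in> {-1..1}")
      case True
      then have "\<bar>g M t\<bar> \<le> C" unfolding C_def using bdd by (rule cSUP_upper)
      then show ?thesis by linarith
    next
      case False
      then have "1 < \<bar>t\<bar>" by auto
      then have "1 < \<bar>t\<bar>\<^sup>2" by (simp only: one_less_power pos2)
      then have "max 0 (1 - t\<^sup>2) = 0" by simp
      then show ?thesis by (simp add: g_def)
    qed
  qed
qed

text \<open>Restricted to a line that enters the ball, this is an affinely rescaled copy of
  \<open>max 0 (1 - s\<^sup>2) ^ Suc M\<close>, so all its directional differences reduce to one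
  variable.\<close>

definition bump :: "real \<Rightarrow> nat \<Rightarrow> 'a::euclidean_space \<Rightarrow> real" where
  "bump R M x = max 0 (R\<^sup>2 - (norm x)\<^sup>2) ^ Suc M"

lemma bump_nonneg: "0 \<le> bump R M x"
  and bump_ge_1: "1 \<le> R \<Longrightarrow> norm x \<le> R \<Longrightarrow> 1 \<le> bump (2 * R) M x"
  and bump_eq_0: "0 \<le> R \<Longrightarrow> R < norm x \<Longrightarrow> bump R M x = 0"
  and bump_le: "bump R M x \<le> (R\<^sup>2) ^ Suc M"
proof -
  show "0 \<le> bump R M x" by (simp add: bump_def)
  show "1 \<le> bump (2 * R) M x" if "1 \<le> R" "norm x \<le> R"
  proof -
    have "(norm x)\<^sup>2 \<le> R\<^sup>2" "1 \<le> R\<^sup>2" using that by (auto intro: power_mono)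
    then have "1 \<le> max 0 ((2 * R)\<^sup>2 - (norm x)\<^sup>2)" by (simp add: power_mult_distrib)
    then show ?thesis unfolding bump_def by (rule one_le_power)
  qed
  show "bump R M x = 0" if "0 \<le> R" "R < norm x"
  proof -
    have "R\<^sup>2 < (norm x)\<^sup>2" using that by (intro power_strict_mono) auto
    then show ?thesis by (simp add: bump_def)
  qed
  show "bump R M x \<le> (R\<^sup>2) ^ Suc M" unfolding bump_def by (intro power_mono) auto
qed

lemma continuous_bump: "continuous_on UNIV (bump R M)"
  unfolding bump_def[abs_def] by (intro continuous_intros)

text \<open>The constant has to be uniform over all lines. On a chord of half-length \<alpha> the
  derivatives cost \<open>(H / \<alpha>) ^ M\<close>, which blows up as the line becomes tangent,
  but the bump itself scales like \<open>\<alpha> ^ (2 * Suc M)\<close>; what remains is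
  \<open>\<alpha> ^ (M + 2) * H ^ M\<close>, and \<alpha> is at most the radius.\<close>

lemma bump_shift_diff_le:
  obtains C where "0 \<le> C"
    "\<And>n \<delta> (h :: 'a::euclidean_space) x. 0 < n \<Longrightarrow> 0 \<le> \<delta> \<Longrightarrow>
       \<bar>(shift_diff n (\<delta> *\<^sub>R h) ^^ M) (bump R M) x\<bar> \<le> C * (real n * \<delta> * norm h) ^ M"
proof -
  obtain g :: "nat \<Rightarrow> real \<Rightarrow> real" and C where g: "g 0 = (\<lambda>s. max 0 (1 - s\<^sup>2) ^ Suc M)"
    "\<And>k t. k < M \<Longrightarrow> (g k has_real_derivative g (Suc k) t) (at t)"
    "\<And>t. \<bar>g M t\<bar> \<le> C"
    using truncated_power_derivatives[of M] by blast
  have "0 \<le> C" using g(3)[of 0] by linarith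
  show thesis
  proof
    show "0 \<le> \<bar>R\<bar> ^ (M + 2) * C" using \<open>0 \<le> C\<close> by simp
    fix n :: nat and \<delta> :: real and h x :: 'a
    assume n: "0 < n" and \<delta>: "0 \<le> \<delta>"
    have rhs: "0 \<le> \<bar>R\<bar> ^ (M + 2) * C * (real n * \<delta> * norm h) ^ M" using \<open>0 \<le> C\<close> \<delta> by simp
    have pb: "(shift_diff n (\<delta> *\<^sub>R h) ^^ M) (bump R M) x
        = (shift_diff n \<delta> ^^ M) (\<lambda>t. bump R M (x + t *\<^sub>R h)) 0"
      using shift_diff_pullback[where c = \<delta> and e = "\<lambda>t. x + t *\<^sub>R h" and z = "\<delta> *\<^sub>R h" and t = 0]
      by (simp add: algebra_simps)
    show "\<bar>(shift_diff n (\<delta> *\<^sub>R h) ^^ M) (bump R M) x\<bar>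
        \<le> \<bar>R\<bar> ^ (M + 2) * C * (real n * \<delta> * norm h) ^ M"
    proof (cases "h = 0")
      case True
      show ?thesis
      proof (cases M)
        case 0
        have "\<bar>bump R 0 x\<bar> \<le> R\<^sup>2" using bump_le[of R 0 x] bump_nonneg[of R 0 x] by simp
        moreover have "1 \<le> C" using g(3)[of 0] 0 by (simp add: g(1))
        then have "R\<^sup>2 * 1 \<le> R\<^sup>2 * C" by (intro mult_left_mono) auto
        ultimately have "\<bar>bump R 0 x\<bar> \<le> R\<^sup>2 * C" by linarith
        then show ?thesis unfolding 0 funpow_0 by (simp only: power_0 mult_1_right add_0_left power2_abs)
      next
        case (Suc m)
        have "shift_diff n (\<delta> *\<^sub>R h) f = (\<lambda>_. 0)" for f :: "'a \<Rightarrow> real"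
          using n True by (simp add: shift_diff_def shift_avg_def fun_eq_iff)
        then show ?thesis using Suc True by simp
      qed
    next
      case False
      define H where "H = norm h"
      have H: "0 < H" using False by (simp add: H_def)
      \<comment> \<open>Completing the square along the line: the point nearest to the origin has
        parameter \<open>- b\<close>, and \<open>c\<close> is the squared distance of the line from
        the origin.\<close>
      define b c where "b = (x \<bullet> h) / H\<^sup>2" and "c = (norm x)\<^sup>2 - (x \<bullet> h)\<^sup>2 / H\<^sup>2"
      have "(x \<bullet> h)\<^sup>2 \<le> (norm x)\<^sup>2 * H\<^sup>2"
        using Cauchy_Schwarz_ineq[of x h] by (simp add: H_def power2_norm_eq_inner)
      then have c: "0 \<le> c" using H by (simp add: c_def divide_simps)
      have line: "(norm (x + t *\<^sub>R h))\<^sup>2 = H\<^sup>2 * (t + b)\<^sup>2 + c" for t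
      proof -
        have "(norm (x + t *\<^sub>R h))\<^sup>2 = (norm x)\<^sup>2 + 2 * t * (x \<bullet> h) + t\<^sup>2 * H\<^sup>2"
          unfolding H_def power2_norm_eq_inner
          by (simp add: inner_add_left inner_add_right inner_commute power2_eq_square algebra_simps)
        also have "\<dots> = H\<^sup>2 * (t + b)\<^sup>2 + c"
          using H unfolding b_def c_def by (simp add: field_simps power2_eq_square)
        finally show ?thesis .
      qed
      show ?thesis
      proof (cases "R\<^sup>2 \<le> c")
        case True
        have "bump R M (x + t *\<^sub>R h) = 0" for t
        proof -
          have "R\<^sup>2 \<le> H\<^sup>2 * (t + b)\<^sup>2 + c" using True by (simp add: add_increasing)
          then show ?thesis unfolding bump_def line by simp
        qed
        then have "(\<lambda>t. bump R M (x + t *\<^sub>R h)) = (\<lambda>_. 0)" by auto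
        moreover have "\<bar>(shift_diff n \<delta> ^^ M) (\<lambda>_. 0) (0::real)\<bar> \<le> 2 ^ M * 0"
          by (rule abs_shift_diff_power_le) (use n in auto)
        ultimately show ?thesis using rhs pb by simp
      next
        case False
        define \<alpha> where "\<alpha> = sqrt (R\<^sup>2 - c)"
        have \<alpha>: "0 < \<alpha>" "\<alpha>\<^sup>2 = R\<^sup>2 - c" using False by (auto simp: \<alpha>_def)
        have "\<alpha> \<le> \<bar>R\<bar>" unfolding \<alpha>_def using c by (intro real_le_lsqrt) auto
        define \<phi> where "\<phi> k t = \<alpha> ^ (2 * Suc M) * (H / \<alpha>) ^ k * g k ((t + b) * (H / \<alpha>))" for k t
        have \<phi>0: "(\<lambda>t. bump R M (x + t *\<^sub>R h)) = \<phi> 0"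
        proof
          fix t
          have "R\<^sup>2 - (norm (x + t *\<^sub>R h))\<^sup>2 = \<alpha>\<^sup>2 * (1 - ((t + b) * (H / \<alpha>))\<^sup>2)"
          proof -
            have "\<alpha>\<^sup>2 * ((t + b) * (H / \<alpha>))\<^sup>2 = H\<^sup>2 * (t + b)\<^sup>2"
              using \<alpha>(1) by (simp add: power_mult_distrib power_divide)
            then show ?thesis unfolding line right_diff_distrib using \<alpha>(2) by simp
          qed
          moreover have "max 0 (\<alpha>\<^sup>2 * y) = \<alpha>\<^sup>2 * max 0 y" for y
            by (simp add: max_mult_distrib_left)
          ultimately show "bump R M (x + t *\<^sub>R h) = \<phi> 0 t"
            unfolding bump_def \<phi>_def g(1) power_mult by (simp add: power_mult_distrib del: power_Suc)
        qed
        have main: "\<bar>(shift_diff n \<delta> ^^ M) (\<phi> 0) 0\<bar>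
            \<le> (\<alpha> ^ (2 * Suc M) * (H / \<alpha>) ^ M * C) * (real n * \<delta>) ^ M"
        proof (rule abs_shift_diff_deriv_le)
          fix k t assume "k < M"
          have "((\<lambda>t. (t + b) * (H / \<alpha>)) has_real_derivative H / \<alpha>) (at t)"
            using \<alpha>(1) by (auto intro!: derivative_eq_intros)
          from DERIV_cmult[OF DERIV_chain2[OF g(2)[OF \<open>k < M\<close>] this], of "\<alpha> ^ (2 * Suc M) * (H / \<alpha>) ^ k"]
          show "(\<phi> k has_real_derivative \<phi> (Suc k) t) (at t)"
            unfolding \<phi>_def[abs_def] power_Suc by (simp only: mult_ac)
        next
          fix t show "\<bar>\<phi> M t\<bar> \<le> \<alpha> ^ (2 * Suc M) * (H / \<alpha>) ^ M * C"
          proof -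
            have nn: "0 \<le> \<alpha> ^ (2 * Suc M) * (H / \<alpha>) ^ M" using \<alpha>(1) H by simp
            show ?thesis
              unfolding \<phi>_def abs_mult[of _ "g M _"] abs_of_nonneg[OF nn] by (rule mult_left_mono[OF g(3) nn])
          qed
        qed (use n \<delta> in auto)
        have scale: "\<alpha> ^ (2 * Suc M) * (H / \<alpha>) ^ M = \<alpha> ^ (M + 2) * H ^ M"
          using \<alpha> by (simp add: power_divide field_simps flip: power_add mult_2)
        have "\<alpha> ^ (M + 2) \<le> \<bar>R\<bar> ^ (M + 2)" using \<alpha> \<open>\<alpha> \<le> \<bar>R\<bar>\<close> by (intro power_mono) auto
        then have le: "\<alpha> ^ (M + 2) * (H ^ M * C * (real n * \<delta>) ^ M)
            \<le> \<bar>R\<bar> ^ (M + 2) * (H ^ M * C * (real n * \<delta>) ^ M)"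
          using H \<open>0 \<le> C\<close> \<delta> by (intro mult_right_mono) auto
        have "\<bar>(shift_diff n \<delta> ^^ M) (\<phi> 0) 0\<bar> \<le> \<bar>R\<bar> ^ (M + 2) * (H ^ M * C * (real n * \<delta>) ^ M)"
          using main le unfolding scale by (simp only: mult.assoc)
        also have "\<dots> = \<bar>R\<bar> ^ (M + 2) * C * (real n * \<delta> * H) ^ M"
          by (simp only: power_mult_distrib mult_ac)
        finally show ?thesis unfolding pb \<phi>0 H_def .
      qed
    qed
  qed
qed


section \<open>Slabs, translations and transversal hyperplanes\<close>

lemma sum_at_most_one_le:
  fixes c :: real
  assumes "finite I" "0 \<le> c" "\<And>i j. i \<in> I \<Longrightarrow> j \<in> I \<Longrightarrow> P i \<Longrightarrow> P j \<Longrightarrow> i = j"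
  shows "(\<Sum>i\<in>I. if P i then c else 0) \<le> c"
proof (cases "\<exists>i\<in>I. P i")
  case True
  then obtain i where i: "i \<in> I" "P i" by blast
  have "(\<Sum>j\<in>I. if P j then c else 0) = (\<Sum>j\<in>I. if j = i then c else 0)"
    by (rule sum.cong) (use i assms(3) in auto)
  then show ?thesis using assms(1) i by simp
next
  case False
  then have "(\<Sum>j\<in>I. if P j then c else 0) = (\<Sum>j\<in>I. 0)" by (intro sum.cong) auto
  then show ?thesis using assms(2) by simp
qed

lemma shifts_in_half_open_eq:
  fixes \<sigma> \<tau> :: real and i j :: nat
  assumes "a \<le> \<tau> + real i * \<sigma>" "\<tau> + real i * \<sigma> < a + \<sigma>"
    "a \<le> \<tau> + real j * \<sigma>" "\<tau> + real j * \<sigma> < a + \<sigma>"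
  shows "i = j"
proof -
  have "(real i - real j) * \<sigma> < 1 * \<sigma>" "(real j - real i) * \<sigma> < 1 * \<sigma>" "0 < \<sigma>"
    using assms by (auto simp: algebra_simps)
  then have "real i - real j < 1" "real j - real i < 1" by (auto simp: mult_less_cancel_right)
  then show ?thesis by linarith
qed

lemma lborel_integral_shift:
  fixes f :: "'a::euclidean_space \<Rightarrow> real"
  assumes [measurable]: "f \<in> borel_measurable borel"
  shows "(\<integral>x. f (x + z) \<partial>lborel) = (\<integral>x. f x \<partial>lborel)"
proof -
  have "(\<integral>x. f x \<partial>lborel) = (\<integral>x. f x \<partial>distr lborel borel ((+) z))"
    by (simp add: lborel_distr_plus)
  also have "\<dots> = (\<integral>x. f (z + x) \<partial>lborel)" by (rule integral_distr) simp_all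
  finally show ?thesis by (simp add: add.commute)
qed

lemma lborel_integrable_shift:
  fixes f :: "'a::euclidean_space \<Rightarrow> real"
  assumes "integrable lborel f"
  shows "integrable lborel (\<lambda>x. f (x + z))"
proof -
  have "integrable (distr lborel borel ((+) z)) f" using assms by (simp add: lborel_distr_plus)
  then have "integrable lborel (\<lambda>x. f (z + x))" by (rule integrable_distr[rotated]) simp
  then show ?thesis by (simp add: add.commute)
qed

lemma emeasure_cball_finite: "emeasure lborel (cball (x::'a::euclidean_space) R) < \<infinity>"
  by (rule emeasure_bounded_finite) simp

lemma integrable_bounded_support:
  fixes f :: "'a::euclidean_space \<Rightarrow> real"
  assumes [measurable]: "f \<in> borel_measurable borel"
    and "\<And>x. \<bar>f x\<bar> \<le> C" "\<And>x. R < norm x \<Longrightarrow> f x = 0"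
  shows "integrable lborel f"
proof (rule Bochner_Integration.integrable_bound)
  show "integrable lborel (\<lambda>x::'a. indicator (cball 0 R) x * C)"
    by (intro integrable_mult_left integrable_real_indicator emeasure_cball_finite) simp_all
  show "AE x in lborel. norm (f x) \<le> norm (indicator (cball 0 R) x * C)"
    using assms(3) order_trans[OF assms(2) abs_ge_self] by (intro AE_I2) (auto simp: indicator_def)
qed simp

lemma integrable_indicator_bounded:
  assumes "S \<in> sets borel" "S \<subseteq> cball 0 R"
  shows "integrable lborel (indicator S :: 'a::euclidean_space \<Rightarrow> real)"
  by (rule integrable_bounded_support[of _ 1 R]) (use assms in \<open>auto simp: indicator_def\<close>)

lemma measure_mono_bounded:
  assumes "S \<in> sets borel" "T \<in> sets borel" "S \<subseteq> T" "T \<subseteq> cball (0::'a::euclidean_space) R"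
  shows "measure lborel S \<le> measure lborel T"
  using assms emeasure_bounded_finite[of T] bounded_subset[OF bounded_cball assms(4)]
  by (intro measure_mono_fmeasurable) (auto simp: fmeasurable_def)

text \<open>The translates of \<open>S\<close> by multiples of \<open>z\<close> lie in consecutive
  half-open slabs with normal \<open>p\<close>, so they are disjoint, and about
  \<open>1 / norm z\<close> of them stay inside \<open>T\<close>.\<close>

lemma measure_le_of_translates:
  fixes S T :: "'a::euclidean_space set" and z :: 'a
  assumes [measurable]: "S \<in> sets borel" "T \<in> sets borel"
    and T: "T \<subseteq> cball 0 R" and ST: "\<And>x s. x \<in> S \<Longrightarrow> 0 \<le> s \<Longrightarrow> s * norm z \<le> 1 \<Longrightarrow> x + s *\<^sub>R z \<in> T"
    and p: "\<And>x. x \<in> S \<Longrightarrow> a \<le> p \<bullet> x \<and> p \<bullet> x < a + p \<bullet> z"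
    and z: "z \<noteq> 0"
  shows "measure lborel S \<le> norm z * measure lborel T"
proof -
  \<comment> \<open>The ceiling serves both purposes: every index below \<open>n\<close> moves
    \<open>S\<close> by at most 1, and \<open>n\<close> is at least
    \<open>1 / norm z\<close>.\<close>
  define n where "n = nat \<lceil>1 / norm z\<rceil>"
  have nz: "0 < norm z" using z by simp
  have n: "1 / norm z \<le> real n" unfolding n_def by linarith
  have inj: "s * norm z \<le> 1" if "i < n" "s = real i" for i s
  proof -
    have "real i \<le> 1 / norm z" using that unfolding n_def by linarith
    then show ?thesis using nz that by (simp add: field_simps)
  qed
  have "S \<subseteq> T" using ST[of _ 0] by auto
  then have intS: "integrable lborel (indicator S :: 'a \<Rightarrow> real)"
    using T by (intro integrable_indicator_bounded) auto
  have pw: "(\<Sum>i<n. indicator S (x + real i *\<^sub>R (- z))) \<le> (indicator T x :: real)" for x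
  proof (cases "x \<in> T")
    case True
    have "(\<Sum>i<n. indicator S (x + real i *\<^sub>R (- z)))
        = (\<Sum>i<n. if x + real i *\<^sub>R (- z) \<in> S then 1 else (0::real))"
      by (rule sum.cong[OF refl]) (simp add: indicator_def)
    also have "\<dots> \<le> 1"
    proof (rule sum_at_most_one_le)
      fix i j assume "x + real i *\<^sub>R (- z) \<in> S" "x + real j *\<^sub>R (- z) \<in> S"
      from p[OF this(1)] p[OF this(2)] show "i = j"
        using shifts_in_half_open_eq[of "- (p \<bullet> x)" "-(a + p \<bullet> z)" i "p \<bullet> z" j]
          shifts_in_half_open_eq[of "a" "p \<bullet> x - real (i + j) * (p \<bullet> z)" i "p \<bullet> z" j]
        by (auto simp: inner_diff_right algebra_simps)
    qed auto
    finally show ?thesis using True by simp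
  next
    case False
    have "x + real i *\<^sub>R (- z) \<notin> S" if "i < n" for i
      using ST[of "x + real i *\<^sub>R (- z)" "real i"] inj[OF that] False by auto
    then show ?thesis using False by (simp add: indicator_def)
  qed
  have "real n * measure lborel S = (\<Sum>i<n. \<integral>x. indicator S (x + real i *\<^sub>R (- z)) \<partial>lborel)"
    by (subst lborel_integral_shift) auto
  also have "\<dots> = (\<integral>x. (\<Sum>i<n. indicator S (x + real i *\<^sub>R (- z))) \<partial>lborel)"
    by (rule Bochner_Integration.integral_sum [symmetric]) (rule lborel_integrable_shift[OF intS])
  also have "\<dots> \<le> (\<integral>x. indicator T x \<partial>lborel)"
    by (intro integral_mono Bochner_Integration.integrable_sum lborel_integrable_shift intS
        integrable_indicator_bounded[OF _ T] pw) simp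
  finally have "real n * measure lborel S \<le> measure lborel T" by simp
  moreover have "1 / norm z * measure lborel S \<le> real n * measure lborel S"
    using n by (intro mult_right_mono) auto
  ultimately have "1 / norm z * measure lborel S \<le> measure lborel T" by linarith
  then show ?thesis using nz by (simp add: field_simps)
qed

lemma measure_slab_le:
  fixes p u :: "'a::euclidean_space"
  assumes "p \<bullet> u = 1" "norm u = 1" "0 < c"
  shows "measure lborel {x \<in> cball 0 R. \<bar>p \<bullet> x - a\<bar> \<le> c} \<le> 3 * c * measure lborel (cball (0::'a) (R + 1))"
proof -
  have "measure lborel {x \<in> cball 0 R. \<bar>p \<bullet> x - a\<bar> \<le> c}
      \<le> norm ((3 * c) *\<^sub>R u) * measure lborel (cball (0::'a) (R + 1))"
  \<comment> \<open>The step \<open>3 * c\<close> is longer than the width \<open>2 * c\<close>, so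
    the closed slab fits into a half-open one whose width is the step.\<close>
  proof (rule measure_le_of_translates[where a = "a - c" and p = p and R = "R + 1"])
    fix x s assume x: "x \<in> {x \<in> cball 0 R. \<bar>p \<bullet> x - a\<bar> \<le> c}"
      and s: "0 \<le> s" "s * norm ((3 * c) *\<^sub>R u) \<le> 1"
    have "norm (x + s *\<^sub>R (3 * c) *\<^sub>R u) \<le> norm x + s * norm ((3 * c) *\<^sub>R u)"
      using s by (intro norm_triangle_le) (auto simp: abs_mult mult.assoc)
    then show "x + s *\<^sub>R (3 * c) *\<^sub>R u \<in> cball 0 (R + 1)" using x s by auto
  next
    have "closed (cball 0 R \<inter> {x. \<bar>p \<bullet> x - a\<bar> \<le> c})"
      by (intro closed_Int closed_cball closed_Collect_le continuous_intros)
    moreover have "cball 0 R \<inter> {x. \<bar>p \<bullet> x - a\<bar> \<le> c} = {x \<in> cball 0 R. \<bar>p \<bullet> x - a\<bar> \<le> c}" by auto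
    ultimately show "{x \<in> cball 0 R. \<bar>p \<bullet> x - a\<bar> \<le> c} \<in> sets borel" by simp
    show "a - c \<le> p \<bullet> x \<and> p \<bullet> x < a - c + p \<bullet> (3 * c) *\<^sub>R u"
      if "x \<in> {x \<in> cball 0 R. \<bar>p \<bullet> x - a\<bar> \<le> c}" for x
      using that assms by (auto simp: abs_le_iff)
    show "(3 * c) *\<^sub>R u \<noteq> 0" using assms by auto
  qed auto
  then show ?thesis using assms by simp
qed

section \<open>Moving differences across an integral\<close>

text \<open>Translation invariance of Lebesgue measure turns a shift of \<open>F\<close> by
  \<open>- z\<close> into a shift of \<open>w\<close> by \<open>z\<close>; \<eta> is untouched
  because it is constant along \<open>z\<close>. The induction varies \<open>w\<close>, whose bound
  and support grow with every difference.\<close>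

lemma shift_diff_power_adjoint:
  fixes F \<eta> w :: "'a::euclidean_space \<Rightarrow> real"
  assumes [measurable]: "F \<in> borel_measurable borel" "\<eta> \<in> borel_measurable borel"
      "w \<in> borel_measurable borel"
    and F: "\<And>x. \<bar>F x\<bar> \<le> CF" and \<eta>: "\<And>x. \<bar>\<eta> x\<bar> \<le> C\<eta>" "\<And>x s. \<eta> (x + s *\<^sub>R z) = \<eta> x"
    and w: "\<And>x. \<bar>w x\<bar> \<le> Cw" "\<And>x. R < norm x \<Longrightarrow> w x = 0" and n: "0 < n"
  shows "(\<integral>x. (shift_diff n (- z) ^^ M) F x * \<eta> x * w x \<partial>lborel)
    = (\<integral>x. F x * \<eta> x * (shift_diff n z ^^ M) w x \<partial>lborel)"
  using assms(3) w
proof (induction M arbitrary: w Cw R)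
  case (Suc M)
  note Suc.prems(1)[measurable]
  define G where "G = (shift_diff n (- z) ^^ M) F"
  have [measurable]: "G \<in> borel_measurable borel" unfolding G_def by measurable
  have G: "\<bar>G x\<bar> \<le> 2 ^ M * CF" for x
    unfolding G_def by (rule abs_shift_diff_power_le) (use F n in auto)
  have CF: "0 \<le> 2 ^ M * CF" and C\<eta>: "0 \<le> C\<eta>" and Cw: "0 \<le> Cw"
    using G[of 0] \<eta>(1)[of 0] Suc.prems(2)[of 0] by linarith+
  have Gint: "integrable lborel (\<lambda>x. G (x + a) * \<eta> x * w (x + b))" for a b
  proof (rule integrable_bounded_support[where R = "R + norm b"])
    show "\<bar>G (x + a) * \<eta> x * w (x + b)\<bar> \<le> 2 ^ M * CF * C\<eta> * Cw" for x
      unfolding abs_mult using G \<eta>(1) Suc.prems(2) CF C\<eta> by (intro mult_mono) auto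
    show "G (x + a) * \<eta> x * w (x + b) = 0" if "R + norm b < norm x" for x
    proof -
      have "norm x \<le> norm (x + b) + norm b" by (metis add_diff_cancel norm_triangle_ineq4)
      then show ?thesis using Suc.prems(3)[of "x + b"] that by simp
    qed
  qed measurable
  have I1: "integrable lborel (\<lambda>x. G (x + real i *\<^sub>R (- z)) * \<eta> x * w x)"
    and I2: "integrable lborel (\<lambda>x. G x * \<eta> x * w (x + real i *\<^sub>R z))"
    and Gint': "integrable lborel (\<lambda>x. G x * \<eta> x * w x)" for i
    using Gint[of "real i *\<^sub>R (- z)" 0] Gint[of 0 "real i *\<^sub>R z"] Gint[of 0 0] by simp_all
  have shift: "(\<integral>x. G (x + real i *\<^sub>R (- z)) * \<eta> x * w x \<partial>lborel)
      = (\<integral>x. G x * \<eta> x * w (x + real i *\<^sub>R z) \<partial>lborel)" for i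
    using lborel_integral_shift[of "\<lambda>x. G (x + real i *\<^sub>R (- z)) * \<eta> x * w x" "real i *\<^sub>R z"]
    by (simp add: \<eta>(2))
  have "(\<integral>x. (shift_diff n (- z) ^^ Suc M) F x * \<eta> x * w x \<partial>lborel)
      = (\<integral>x. G x * \<eta> x * w x - (\<Sum>i<n. G (x + real i *\<^sub>R (- z)) * \<eta> x * w x) / real n \<partial>lborel)"
    unfolding shift_diff_power_Suc G_def[symmetric]
    by (simp add: left_diff_distrib sum_distrib_right)
  also have "\<dots> = (\<integral>x. G x * \<eta> x * w x \<partial>lborel)
      - (\<Sum>i<n. \<integral>x. G (x + real i *\<^sub>R (- z)) * \<eta> x * w x \<partial>lborel) / real n"
    by (subst Bochner_Integration.integral_diff; (subst integral_divide_zero)?;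
        (subst Bochner_Integration.integral_sum)?; (intro refl integrable_divide_zero Bochner_Integration.integrable_sum I1 Gint')?)
  also have "\<dots> = (\<integral>x. G x * \<eta> x * w x - (\<Sum>i<n. G x * \<eta> x * w (x + real i *\<^sub>R z)) / real n \<partial>lborel)"
    unfolding shift
    by (subst Bochner_Integration.integral_diff; (subst integral_divide_zero)?;
        (subst Bochner_Integration.integral_sum)?; (intro refl integrable_divide_zero Bochner_Integration.integrable_sum I2 Gint')?)
  also have "\<dots> = (\<integral>x. G x * \<eta> x * shift_diff n z w x \<partial>lborel)"
    by (simp add: shift_diff_def shift_avg_def right_diff_distrib sum_distrib_left)
  also have "\<dots> = (\<integral>x. F x * \<eta> x * (shift_diff n z ^^ M) (shift_diff n z w) x \<partial>lborel)"
    unfolding G_def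
  proof (rule Suc.IH)
    show "shift_diff n z w \<in> borel_measurable borel"
      using measurable_shift_diff_power[OF Suc.prems(1), where n = n and z = z and M = 1] by simp
    show "\<bar>shift_diff n z w x\<bar> \<le> 2 * Cw" for x
      by (rule abs_shift_diff_le) (use Suc.prems n in auto)
    show "shift_diff n z w x = 0" if "R + real n * norm z < norm x" for x
      using shift_diff_power_supported[where \<rho> = R and f = w and M = 1 and n = n and z = z] Suc.prems(3) that by simp
  qed
  finally show ?case by (simp add: funpow_swap1)
qed simp

text \<open>With \<open>v = v' + b *\<^sub>R u\<close> and \<open>v'\<close> orthogonal to the unit vector \<open>u\<close>, the zero set of
  \<open>plane_height u v\<close> is the hyperplane \<open>x \<bullet> u = v' \<bullet> x + b\<close>.\<close>

definition plane_normal :: "'a::euclidean_space \<Rightarrow> 'a \<Rightarrow> 'a" where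
  "plane_normal u v = u - (v - (v \<bullet> u) *\<^sub>R u)"

definition plane_height :: "'a::euclidean_space \<Rightarrow> 'a \<Rightarrow> 'a \<Rightarrow> real" where
  "plane_height u v x = plane_normal u v \<bullet> x - v \<bullet> u"

lemma plane_height_measurable [measurable]: "plane_height u v \<in> borel_measurable borel"
  unfolding plane_height_def[abs_def] by measurable

lemma plane_height_add: "plane_height u v (x + z) = plane_height u v x + plane_normal u v \<bullet> z"
  by (simp add: plane_height_def inner_add_right)

lemma plane_normal_inner_self: "norm u = 1 \<Longrightarrow> plane_normal u v \<bullet> u = 1"
  by (simp add: plane_normal_def inner_diff_left dot_square_norm)

lemma norm_horizontal_le:
  assumes "norm u = 1"
  shows "norm (v - (v \<bullet> u) *\<^sub>R u) \<le> norm (v :: 'a::euclidean_space)"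
proof -
  have "u \<bullet> u = 1" using assms by (simp add: dot_square_norm)
  then have "(norm (v - (v \<bullet> u) *\<^sub>R u))\<^sup>2 = (norm v)\<^sup>2 - (v \<bullet> u)\<^sup>2"
    unfolding power2_norm_eq_inner
    by (simp add: inner_diff_left inner_diff_right inner_commute power2_eq_square)
  then have "(norm (v - (v \<bullet> u) *\<^sub>R u))\<^sup>2 \<le> (norm v)\<^sup>2" by simp
  then show ?thesis by (rule power2_le_imp_le) simp
qed

lemma norm_plane_normal_le: "norm u = 1 \<Longrightarrow> norm (plane_normal u v) \<le> 1 + norm v"
  unfolding plane_normal_def using norm_triangle_ineq4[of u "v - (v \<bullet> u) *\<^sub>R u"] norm_horizontal_le[of u v]
  by simp

lemma norm_plane_normal_diff_le:
  "norm u = 1 \<Longrightarrow> norm (plane_normal u v - plane_normal u w) \<le> norm (v - w)"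
proof -
  assume u: "norm u = 1"
  have "plane_normal u v - plane_normal u w = - ((v - w) - ((v - w) \<bullet> u) *\<^sub>R u)"
    by (simp add: plane_normal_def algebra_simps inner_diff_left)
  then show ?thesis using norm_horizontal_le[OF u, of "v - w"] by (metis norm_minus_cancel)
qed

lemma norm_diff_le_plane_normal:
  assumes "norm u = 1"
  shows "norm (v - w) \<le> norm (plane_normal u v - plane_normal u w) + \<bar>(v - w) \<bullet> u\<bar>"
proof -
  have "v - w = - (plane_normal u v - plane_normal u w) + ((v - w) \<bullet> u) *\<^sub>R u"
    by (simp add: plane_normal_def algebra_simps inner_diff_left)
  then have "norm (v - w) \<le> norm (- (plane_normal u v - plane_normal u w)) + norm (((v - w) \<bullet> u) *\<^sub>R u)"
    by (metis norm_triangle_ineq)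
  then show ?thesis using assms by (simp only: norm_minus_cancel) simp
qed

text \<open>Both normals have inner product 1 with \<open>u\<close>, so their difference
  \<open>D\<close> is orthogonal to \<open>u\<close>. Correcting \<open>D\<close> along
  \<open>u\<close> therefore makes it parallel to the second plane without changing its product with
  \<open>D\<close>. The length is of the order of the reciprocal of the angle between the
  planes.\<close>

lemma transversal_vector:
  fixes u v w :: "'a::euclidean_space"
  assumes u: "norm u = 1" and ne: "plane_normal u v \<noteq> plane_normal u w"
  obtains h where "plane_normal u v \<bullet> h = 1" "plane_normal u w \<bullet> h = 0"
    "norm h \<le> (1 + norm w) / norm (plane_normal u v - plane_normal u w)" "h \<noteq> 0"
proof -
  define D where "D = plane_normal u v - plane_normal u w"
  have D: "0 < norm D" using ne by (simp add: D_def)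
  define h where "h = (D - (plane_normal u w \<bullet> D) *\<^sub>R u) /\<^sub>R (norm D)\<^sup>2"
  have Du: "D \<bullet> u = 0" using plane_normal_inner_self[OF u] by (simp add: D_def inner_diff_left)
  have w: "plane_normal u w \<bullet> h = 0"
    by (simp add: h_def inner_diff_right plane_normal_inner_self[OF u])
  have "D \<bullet> h = 1" using D by (simp add: h_def inner_diff_right Du power2_norm_eq_inner)
  then have v: "plane_normal u v \<bullet> h = 1" using w by (simp add: D_def inner_diff_left)
  have h_eq: "D - (plane_normal u w \<bullet> D) *\<^sub>R u = D + (w \<bullet> D) *\<^sub>R u"
    using Du by (simp add: plane_normal_def inner_diff_left inner_commute[of u D])
  have "norm (D + (w \<bullet> D) *\<^sub>R u) \<le> norm D + \<bar>w \<bullet> D\<bar>"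
    using norm_triangle_ineq[of D "(w \<bullet> D) *\<^sub>R u"] u by simp
  also have "\<dots> \<le> (1 + norm w) * norm D" using Cauchy_Schwarz_ineq2[of w D] by (simp add: algebra_simps)
  finally have "norm h \<le> (1 + norm w) * norm D / (norm D)\<^sup>2"
    unfolding h_def h_eq by (simp add: divide_simps mult.commute)
  also have "\<dots> = (1 + norm w) / norm D" using D by (simp add: power2_eq_square)
  finally show thesis using that v w by (force simp: D_def)
qed


section \<open>Pairings of kernels with cancellation\<close>

lemma abs_integral_le_measure:
  fixes f :: "'a::euclidean_space \<Rightarrow> real"
  assumes [measurable]: "S \<in> sets borel" and f: "f \<in> borel_measurable borel"
    and "S \<subseteq> cball 0 R" "0 \<le> C"
    and le: "\<And>x. x \<in> S \<Longrightarrow> \<bar>f x\<bar> \<le> C" "\<And>x. x \<notin> S \<Longrightarrow> f x = 0"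
  shows "\<bar>\<integral>x. f x \<partial>lborel\<bar> \<le> C * measure lborel S"
proof -
  have int: "integrable lborel f"
    by (rule integrable_bounded_support[of f C R]) (use assms in force)+
  have "\<bar>\<integral>x. f x \<partial>lborel\<bar> \<le> (\<integral>x. \<bar>f x\<bar> \<partial>lborel)" by (rule integral_abs_bound)
  also have "\<dots> \<le> (\<integral>x. indicator S x * C \<partial>lborel)"
    by (intro integral_mono integrable_abs int integrable_mult_left integrable_indicator_bounded[OF _ assms(3)])
      (use le in \<open>auto simp: indicator_def\<close>)
  also have "\<dots> = C * measure lborel S" by simp
  finally show ?thesis .
qed

section \<open>Kernels of one variable and their pairings over two planes\<close>

text \<open>The half-open support makes the shifts by multiples of \<delta> tile the line, so that
  averaging them gives a flat pulse.\<close>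

definition pulse :: "real \<Rightarrow> real \<Rightarrow> real" where
  "pulse \<delta> \<tau> = (if 0 \<le> \<tau> \<and> \<tau> < \<delta> then 1 / \<delta> else 0)"

text \<open>This is \<open>(1 - A)\<^sup>M\<close> applied to the pulse, where \<open>A\<close> averages over \<open>n\<close> consecutive shifts by
  \<open>\<delta>\<close>. It vanishes for \<open>n = 1\<close>, so the pulse telescopes into differences over \<open>n = 2\<^sup>i\<close>, which have
  size \<open>1 / (n * \<delta>)\<close> and \<open>M\<close>-fold cancellation at scale \<open>n * \<delta>\<close>.\<close>

definition smoothed_defect :: "nat \<Rightarrow> nat \<Rightarrow> real \<Rightarrow> real \<Rightarrow> real" where
  "smoothed_defect M n \<delta> = (shift_diff n (- \<delta>) ^^ M) (pulse \<delta>)"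

lemma pulse_measurable [measurable]: "pulse \<delta> \<in> borel_measurable borel"
  unfolding pulse_def[abs_def] by measurable

lemma smoothed_defect_measurable [measurable]: "smoothed_defect M n \<delta> \<in> borel_measurable borel"
  unfolding smoothed_defect_def by measurable

lemma abs_pulse_le: "0 < \<delta> \<Longrightarrow> \<bar>pulse \<delta> \<tau>\<bar> \<le> 1 / \<delta>"
  by (simp add: pulse_def)

lemma abs_smoothed_defect_le: "0 < \<delta> \<Longrightarrow> 0 < n \<Longrightarrow> \<bar>smoothed_defect M n \<delta> \<tau>\<bar> \<le> 2 ^ M * (1 / \<delta>)"
  unfolding smoothed_defect_def by (rule abs_shift_diff_power_le) (auto intro: abs_pulse_le)

text \<open>At every point at most one of the \<open>n\<close> shifted pulses is nonzero.\<close>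

lemma abs_shift_avg_pulse_le:
  assumes "0 < \<delta>" "0 < n"
  shows "\<bar>shift_avg n (- \<delta>) (pulse \<delta>) \<tau>\<bar> \<le> 1 / (real n * \<delta>)"
proof -
  have "(\<Sum>i<n. pulse \<delta> (\<tau> + real i *\<^sub>R (- \<delta>)))
      = (\<Sum>i<n. if 0 \<le> \<tau> - real i * \<delta> \<and> \<tau> - real i * \<delta> < \<delta> then 1 / \<delta> else 0)"
    by (simp add: pulse_def)
  also have "\<dots> \<le> 1 / \<delta>"
  proof (rule sum_at_most_one_le)
    fix i j assume "0 \<le> \<tau> - real i * \<delta> \<and> \<tau> - real i * \<delta> < \<delta>" "0 \<le> \<tau> - real j * \<delta> \<and> \<tau> - real j * \<delta> < \<delta>"
    then show "i = j"
      using shifts_in_half_open_eq[of 0 "\<tau> - real (i + j) * \<delta>" j \<delta> i] by (auto simp: algebra_simps)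
  qed (use assms in auto)
  finally have "(\<Sum>i<n. pulse \<delta> (\<tau> + real i *\<^sub>R (- \<delta>))) \<le> 1 / \<delta>" .
  moreover have "0 \<le> (\<Sum>i<n. pulse \<delta> (\<tau> + real i *\<^sub>R (- \<delta>)))"
    using assms by (intro sum_nonneg) (simp add: pulse_def)
  ultimately show ?thesis
    using assms by (simp add: shift_avg_def field_simps)
qed

lemma abs_pulse_minus_smoothed_defect_le:
  assumes "0 < \<delta>" "0 < n"
  shows "\<bar>pulse \<delta> \<tau> - smoothed_defect M n \<delta> \<tau>\<bar> \<le> 2 ^ M / (real n * \<delta>)"
  using abs_minus_shift_diff_power_le[of n "- \<delta>" "pulse \<delta>", OF abs_shift_avg_pulse_le[OF assms] assms(2)]
  by (simp add: smoothed_defect_def)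

lemma smoothed_defect_eq_0:
  assumes "0 < \<delta>" "\<delta> + real M * (real n * \<delta>) < \<bar>\<tau>\<bar>"
  shows "smoothed_defect M n \<delta> \<tau> = 0"
  unfolding smoothed_defect_def
  by (rule shift_diff_power_supported[of \<delta>]) (use assms in \<open>auto simp: pulse_def\<close>)

abbreviation height_pairing ::
    "'a::euclidean_space \<Rightarrow> real \<Rightarrow> nat \<Rightarrow> (real \<Rightarrow> real) \<Rightarrow> (real \<Rightarrow> real) \<Rightarrow> 'a \<Rightarrow> 'a \<Rightarrow> real" where
  "height_pairing u R M \<phi> \<psi> v w \<equiv>
     \<integral>x. \<phi> (plane_height u v x) * \<psi> (plane_height u w x) * bump R M x \<partial>lborel"

text \<open>Translation along \<open>h\<close> shifts the height over the first plane and preserves the height over the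
  second, so the differences can be moved onto the bump function.\<close>

lemma plane_height_pair_integral_le:
  fixes u :: "'a::euclidean_space"
  assumes u: "norm u = 1" and R: "0 \<le> R" "0 \<le> L"
  obtains C where "0 \<le> C"
    "\<And>n \<delta> v w h \<psi> B c. 0 < n \<Longrightarrow> 0 < \<delta> \<Longrightarrow> plane_normal u v \<bullet> h = 1 \<Longrightarrow> plane_normal u w \<bullet> h = 0 \<Longrightarrow>
      real n * \<delta> * norm h \<le> L \<Longrightarrow> \<psi> \<in> borel_measurable borel \<Longrightarrow> 0 < c \<Longrightarrow>
      (\<And>\<tau>. \<bar>\<psi> \<tau>\<bar> \<le> B) \<Longrightarrow> (\<And>\<tau>. c < \<bar>\<tau>\<bar> \<Longrightarrow> \<psi> \<tau> = 0) \<Longrightarrow>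
      \<bar>height_pairing u R M (smoothed_defect M n \<delta>) \<psi> v w\<bar>
        \<le> C * (real n * \<delta> * norm h) ^ M * B * c * norm h"
proof -
  obtain C where C: "0 \<le> C" "\<And>n \<delta> (h :: 'a) x. 0 < n \<Longrightarrow> 0 \<le> \<delta> \<Longrightarrow>
       \<bar>(shift_diff n (\<delta> *\<^sub>R h) ^^ M) (bump R M) x\<bar> \<le> C * (real n * \<delta> * norm h) ^ M"
    using bump_shift_diff_le by blast
  \<comment> \<open>Each of the \<open>M\<close> differences enlarges the support of the bump by at
    most \<open>n * norm z\<close>, which is at most \<open>L\<close>.\<close>
  define \<rho> where "\<rho> = R + real M * L"
  define V where "V = measure lborel (cball (0::'a) (\<rho> + 1 + 1))"
  show thesis
  proof
    show "0 \<le> 3 * C * V" using C by (simp add: V_def)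
    fix n :: nat and \<delta> B c :: real and v w h :: 'a and \<psi> :: "real \<Rightarrow> real"
    assume n: "0 < n" and \<delta>: "0 < \<delta>" and hv: "plane_normal u v \<bullet> h = 1" and hw: "plane_normal u w \<bullet> h = 0"
      and L: "real n * \<delta> * norm h \<le> L" and [measurable]: "\<psi> \<in> borel_measurable borel" and c: "0 < c"
      and \<psi>: "\<And>\<tau>. \<bar>\<psi> \<tau>\<bar> \<le> B" "\<And>\<tau>. c < \<bar>\<tau>\<bar> \<Longrightarrow> \<psi> \<tau> = 0"
    have B: "0 \<le> B" using \<psi>(1)[of 0] by linarith
    define z where "z = \<delta> *\<^sub>R h"
    define w' where "w' = (shift_diff n z ^^ M) (bump R M)"
    have h0: "h \<noteq> 0" using hv by auto
    have bump_meas [measurable]: "(bump R M :: 'a \<Rightarrow> real) \<in> borel_measurable borel"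
      by (rule borel_measurable_continuous_onI[OF continuous_bump])
    have w'_meas [measurable]: "w' \<in> borel_measurable borel" unfolding w'_def by measurable
    \<comment> \<open>Contains every point where the integrand is nonzero. Translation by
      \<open>z\<close> raises the first height by \<delta> and preserves the second, so the
      translates of \<open>S\<close> are disjoint inside the slab \<open>T\<close> of the second
      plane, and the volume of \<open>S\<close> is at most of order
      \<open>\<delta> * norm h * c\<close>.\<close>
    define S where "S = {x \<in> cball 0 \<rho>. 0 \<le> plane_height u v x \<and> plane_height u v x < \<delta>
        \<and> \<bar>plane_height u w x\<bar> \<le> c}"
    define T where "T = {x \<in> cball 0 (\<rho> + 1). \<bar>plane_normal u w \<bullet> x - w \<bullet> u\<bar> \<le> c}"
    have S: "S \<in> sets borel" unfolding S_def by measurable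
    have T: "T \<in> sets borel" unfolding T_def by measurable
    have "measure lborel S \<le> norm z * measure lborel T"
    proof (rule measure_le_of_translates[where a = "v \<bullet> u" and p = "plane_normal u v" and R = "\<rho> + 1"])
      fix x s assume x: "x \<in> S" and s: "0 \<le> s" "s * norm z \<le> 1"
      have "norm (x + s *\<^sub>R z) \<le> norm x + s * norm z"
        using s by (intro norm_triangle_le) auto
      moreover have "plane_normal u w \<bullet> (x + s *\<^sub>R z) - w \<bullet> u = plane_height u w x"
        by (simp add: plane_height_def inner_add_right z_def hw)
      ultimately show "x + s *\<^sub>R z \<in> T" using x s by (auto simp: T_def S_def)
    qed (use S T \<delta> h0 hv in \<open>auto simp: S_def T_def z_def plane_height_def\<close>)
    also have "\<dots> \<le> norm z * (3 * c * V)"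
      unfolding T_def V_def
      by (intro mult_left_mono measure_slab_le[OF plane_normal_inner_self[OF u] u c]) simp
    finally have mS: "measure lborel S \<le> \<delta> * norm h * (3 * c * V)" using \<delta> by (simp add: z_def)
    have pb: "smoothed_defect M n \<delta> (plane_height u v x)
        = (shift_diff n (- z) ^^ M) (\<lambda>x. pulse \<delta> (plane_height u v x)) x" for x
      unfolding smoothed_defect_def
    proof (rule shift_diff_pullback)
      show "plane_height u v (x + real i *\<^sub>R (- z)) = plane_height u v x + real i *\<^sub>R (- \<delta>)" for x i
        unfolding plane_height_add by (simp add: z_def hv)
    qed
    have "(height_pairing u R M (smoothed_defect M n \<delta>) \<psi> v w)
      = (\<integral>x. (shift_diff n (- z) ^^ M) (\<lambda>x. pulse \<delta> (plane_height u v x)) x * \<psi> (plane_height u w x) * bump R M x \<partial>lborel)"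
      unfolding pb ..
    also have "\<dots> = (\<integral>x. pulse \<delta> (plane_height u v x) * \<psi> (plane_height u w x) * w' x \<partial>lborel)"
      unfolding w'_def
    proof (rule shift_diff_power_adjoint)
      show "\<bar>pulse \<delta> (plane_height u v x)\<bar> \<le> 1 / \<delta>" for x by (rule abs_pulse_le[OF \<delta>])
      show "\<bar>bump R M x\<bar> \<le> (R\<^sup>2) ^ Suc M" for x :: 'a using bump_le[of R M x] bump_nonneg[of R M x] by simp
      show "R < norm x \<Longrightarrow> bump R M x = 0" for x :: 'a by (rule bump_eq_0[OF R(1)])
    qed (use n \<psi>(1) hw in \<open>simp_all add: plane_height_add z_def\<close>)
    finally have eq: "(height_pairing u R M (smoothed_defect M n \<delta>) \<psi> v w)
      = (\<integral>x. pulse \<delta> (plane_height u v x) * \<psi> (plane_height u w x) * w' x \<partial>lborel)" .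
    \<comment> \<open>The suprema of the pulse, of \<psi> and of the differenced bump; the factor
      \<open>1 / \<delta>\<close> cancels against the \<delta> in the volume of
      \<open>S\<close>.\<close>
    define K where "K = 1 / \<delta> * B * (C * (real n * \<delta> * norm h) ^ M)"
    have K: "0 \<le> K" using \<delta> B C by (simp add: K_def)
    have "\<bar>\<integral>x. pulse \<delta> (plane_height u v x) * \<psi> (plane_height u w x) * w' x \<partial>lborel\<bar> \<le> K * measure lborel S"
    proof (rule abs_integral_le_measure[OF S])
      show "S \<subseteq> cball 0 \<rho>" by (auto simp: S_def)
      show "\<bar>pulse \<delta> (plane_height u v x) * \<psi> (plane_height u w x) * w' x\<bar> \<le> K" for x
        unfolding K_def abs_mult w'_def z_def
        using B \<delta> C n \<psi>(1) abs_pulse_le[OF \<delta>] by (intro mult_mono) auto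
      show "pulse \<delta> (plane_height u v x) * \<psi> (plane_height u w x) * w' x = 0" if "x \<notin> S" for x
      proof (rule ccontr)
        assume ne: "\<not> ?thesis"
        have "norm x \<le> \<rho>"
        proof (rule ccontr)
          assume "\<not> norm x \<le> \<rho>"
          moreover have "real M * (real n * norm z) \<le> real M * L"
            using L \<delta> by (intro mult_left_mono) (auto simp: z_def mult.assoc)
          ultimately have "w' x = 0" unfolding w'_def
            by (intro shift_diff_power_supported[of R]) (auto simp: \<rho>_def intro: bump_eq_0[OF R(1)])
          then show False using ne by simp
        qed
        then show False using ne that \<psi>(2)[of "plane_height u w x"]
          by (auto simp: S_def pulse_def split: if_splits)
      qed
    qed (use K in measurable)
    also have "\<dots> \<le> K * (\<delta> * norm h * (3 * c * V))" by (intro mult_left_mono mS K)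
    also have "\<dots> = 3 * C * V * (real n * \<delta> * norm h) ^ M * B * c * norm h"
      using \<delta> by (simp add: K_def)
    finally show "\<bar>height_pairing u R M (smoothed_defect M n \<delta>) \<psi> v w\<bar>
        \<le> 3 * C * V * (real n * \<delta> * norm h) ^ M * B * c * norm h" unfolding eq .
  qed
qed

section \<open>Decay of the pairing of dyadic bands\<close>

definition band :: "nat \<Rightarrow> nat \<Rightarrow> real \<Rightarrow> real \<Rightarrow> real" where
  "band M n \<delta> \<tau> = smoothed_defect M (2 * n) \<delta> \<tau> - smoothed_defect M n \<delta> \<tau>"

lemma band_measurable [measurable]: "band M n \<delta> \<in> borel_measurable borel"
  unfolding band_def[abs_def] by measurable

text \<open>Each defect contains the pulse of height \<open>1 / \<delta>\<close>. It drops out of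
  the difference, so both defects are compared with the pulse instead of with zero.\<close>

lemma abs_band_le:
  assumes "0 < \<delta>" "0 < n"
  shows "\<bar>band M n \<delta> \<tau>\<bar> \<le> 2 * 2 ^ M / (real n * \<delta>)"
proof -
  have "2 ^ M / (real (2 * n) * \<delta>) \<le> 2 ^ M / (real n * \<delta>)"
    using assms by (intro divide_left_mono) auto
  moreover have "\<bar>pulse \<delta> \<tau> - smoothed_defect M (2 * n) \<delta> \<tau>\<bar> \<le> 2 ^ M / (real (2 * n) * \<delta>)"
    using assms by (intro abs_pulse_minus_smoothed_defect_le) auto
  ultimately have "\<bar>pulse \<delta> \<tau> - smoothed_defect M (2 * n) \<delta> \<tau>\<bar> \<le> 2 ^ M / (real n * \<delta>)"
    by (rule order_trans[rotated])
  moreover have "\<bar>band M n \<delta> \<tau>\<bar>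
      \<le> \<bar>pulse \<delta> \<tau> - smoothed_defect M n \<delta> \<tau>\<bar> + \<bar>pulse \<delta> \<tau> - smoothed_defect M (2 * n) \<delta> \<tau>\<bar>"
    unfolding band_def by linarith
  ultimately have "\<bar>band M n \<delta> \<tau>\<bar> \<le> 2 ^ M / (real n * \<delta>) + 2 ^ M / (real n * \<delta>)"
    using abs_pulse_minus_smoothed_defect_le[OF assms, of \<tau> M] by (meson add_mono order_trans)
  then show ?thesis by (simp add: mult.commute)
qed

lemma band_eq_0:
  assumes "0 < \<delta>" "0 < n" "(2 * real M + 1) * (real n * \<delta>) < \<bar>\<tau>\<bar>"
  shows "band M n \<delta> \<tau> = 0"
proof -
  have "\<delta> \<le> real n * \<delta>" "0 \<le> real M * (real n * \<delta>)" using assms by auto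
  moreover have "real M * (real (2 * n) * \<delta>) = 2 * (real M * (real n * \<delta>))" by simp
  moreover have "(2 * real M + 1) * (real n * \<delta>) = 2 * (real M * (real n * \<delta>)) + real n * \<delta>"
    by (simp add: algebra_simps)
  ultimately have "\<delta> + real M * (real n * \<delta>) < \<bar>\<tau>\<bar>" "\<delta> + real M * (real (2 * n) * \<delta>) < \<bar>\<tau>\<bar>"
    using assms(3) by linarith+
  then show ?thesis unfolding band_def using assms by (simp add: smoothed_defect_eq_0)
qed

lemma integrable_height_pair:
  fixes u :: "'a::euclidean_space"
  assumes [measurable]: "\<phi> \<in> borel_measurable borel" "\<psi> \<in> borel_measurable borel"
    and "\<And>\<tau>. \<bar>\<phi> \<tau>\<bar> \<le> A" "\<And>\<tau>. \<bar>\<psi> \<tau>\<bar> \<le> B" and R: "0 \<le> R"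
  shows "integrable lborel (\<lambda>x. \<phi> (plane_height u v x) * \<psi> (plane_height u w x) * bump R M x)"
proof (rule integrable_bounded_support)
  have [measurable]: "(bump R M :: 'a \<Rightarrow> real) \<in> borel_measurable borel"
    by (rule borel_measurable_continuous_onI[OF continuous_bump])
  show "(\<lambda>x. \<phi> (plane_height u v x) * \<psi> (plane_height u w x) * bump R M x) \<in> borel_measurable borel"
    by measurable
  have "0 \<le> A" "0 \<le> B" using assms(3)[of 0] assms(4)[of 0] by linarith+
  then show "\<bar>\<phi> (plane_height u v x) * \<psi> (plane_height u w x) * bump R M x\<bar> \<le> A * B * (R\<^sup>2) ^ Suc M" for x
    unfolding abs_mult abs_of_nonneg[OF bump_nonneg]
    by (intro mult_mono assms bump_le bump_nonneg mult_nonneg_nonneg) auto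
  show "R < norm x \<Longrightarrow> \<phi> (plane_height u v x) * \<psi> (plane_height u w x) * bump R M x = 0" for x
    using bump_eq_0[OF R, of x M] by simp
qed

text \<open>No cancellation is involved: two factors of size \<open>b / r\<close> are integrated
  over a slab of thickness proportional to \<open>r\<close>.\<close>

lemma height_pair_integral_trivial_bound:
  fixes u :: "'a::euclidean_space"
  assumes u: "norm u = 1" and R: "0 \<le> R" and b: "0 < b"
  obtains C where "0 \<le> C"
    "\<And>\<psi> r v w. \<psi> \<in> borel_measurable borel \<Longrightarrow> 0 < r \<Longrightarrow> (\<And>\<tau>. \<bar>\<psi> \<tau>\<bar> \<le> b / r) \<Longrightarrow>
      (\<And>\<tau>. b * r < \<bar>\<tau>\<bar> \<Longrightarrow> \<psi> \<tau> = 0) \<Longrightarrow>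
      \<bar>height_pairing u R M \<psi> \<psi> v w\<bar> \<le> C / r"
proof
  define V where "V = measure lborel (cball (0::'a) (R + 1))"
  show "0 \<le> b * b * (R\<^sup>2) ^ Suc M * (3 * b * V)" using b by (simp add: V_def)
  fix \<psi> :: "real \<Rightarrow> real" and r and v w :: 'a
  assume [measurable]: "\<psi> \<in> borel_measurable borel" and r: "0 < r" and \<psi>: "\<And>\<tau>. \<bar>\<psi> \<tau>\<bar> \<le> b / r"
    "\<And>\<tau>. b * r < \<bar>\<tau>\<bar> \<Longrightarrow> \<psi> \<tau> = 0"
  have [measurable]: "(bump R M :: 'a \<Rightarrow> real) \<in> borel_measurable borel"
    by (rule borel_measurable_continuous_onI[OF continuous_bump])
  define S where "S = {x \<in> cball 0 R. \<bar>plane_normal u w \<bullet> x - w \<bullet> u\<bar> \<le> b * r}"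
  have S: "S \<in> sets borel" unfolding S_def by measurable
  define K where "K = b / r * (b / r) * (R\<^sup>2) ^ Suc M"
  have K: "0 \<le> K" using b r by (simp add: K_def)
  have "\<bar>height_pairing u R M \<psi> \<psi> v w\<bar> \<le> K * measure lborel S"
  proof (rule abs_integral_le_measure[OF S])
    show "S \<subseteq> cball 0 R" by (auto simp: S_def)
    show "\<bar>\<psi> (plane_height u v x) * \<psi> (plane_height u w x) * bump R M x\<bar> \<le> K" for x
      unfolding K_def abs_mult abs_of_nonneg[OF bump_nonneg] using b r
      by (intro mult_mono \<psi> bump_le bump_nonneg mult_nonneg_nonneg) auto
    show "\<psi> (plane_height u v x) * \<psi> (plane_height u w x) * bump R M x = 0" if "x \<notin> S" for x
      using that \<psi>(2)[of "plane_height u w x"] bump_eq_0[OF R, of x M]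
      by (fastforce simp: S_def plane_height_def)
  qed (use K in measurable)
  also have "\<dots> \<le> K * (3 * (b * r) * V)"
    unfolding S_def V_def using b r
    by (intro mult_left_mono K measure_slab_le[OF plane_normal_inner_self[OF u] u]) auto
  also have "\<dots> = b * b * (R\<^sup>2) ^ Suc M * (3 * b * V) / r"
    using r by (simp add: K_def field_simps)
  finally show "\<bar>height_pairing u R M \<psi> \<psi> v w\<bar>
    \<le> b * b * (R\<^sup>2) ^ Suc M * (3 * b * V) / r" .
qed

text \<open>Three regimes for the parameter distance \<rho>. Up to a multiple of \<open>r\<close>
  the trivial bound is enough. Beyond it, planes whose normals almost agree are separated throughout
  the support of the bump, and the integrand vanishes. Otherwise the normals differ by at least a
  multiple of \<rho>, the transversal vector has length at most \<open>H / \<rho>\<close>, and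
  \<open>M\<close>-fold cancellation gives \<open>(r / \<rho>) ^ M / \<rho>\<close> up to a
  constant.\<close>

lemma band_pair_integral_le:
  fixes u :: "'a::euclidean_space"
  assumes u: "norm u = 1" and R: "0 \<le> R"
  obtains C where "0 \<le> C"
    "\<And>n \<delta> v w. 0 < n \<Longrightarrow> 0 < \<delta> \<Longrightarrow> norm v \<le> R \<Longrightarrow> norm w \<le> R \<Longrightarrow>
      \<bar>height_pairing u (2 * R) M (band M n \<delta>) (band M n \<delta>) v w\<bar>
        \<le> C / (real n * \<delta>)"
    "\<And>n \<delta> v w. 0 < n \<Longrightarrow> 0 < \<delta> \<Longrightarrow> norm v \<le> R \<Longrightarrow> norm w \<le> R \<Longrightarrow>
      \<bar>height_pairing u (2 * R) M (band M n \<delta>) (band M n \<delta>) v w\<bar>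
        * norm (v - w) ^ Suc M \<le> C * (real n * \<delta>) ^ M"
proof -
  \<comment> \<open>A single constant for the height of a band in units of \<open>1 / r\<close> and
    for its support in units of \<open>r\<close>.\<close>
  define b where "b = 2 * 2 ^ M + 2 * real M + 1"
  have b: "1 \<le> b" by (simp add: b_def)
  \<comment> \<open>Bounds \<open>norm h * \<rho>\<close> in the transversal case:
    \<open>norm h \<le> (1 + R) / D\<close> and
    \<open>\<rho> \<le> D * (2 * (1 + 2 * R))\<close>.\<close>
  define H where "H = (1 + R) * (2 * (1 + 2 * R))"
  have H: "0 \<le> H" using R by (simp add: H_def)
  obtain C1 where C1: "0 \<le> C1" "\<And>\<psi> r v w. \<psi> \<in> borel_measurable borel \<Longrightarrow> 0 < r \<Longrightarrow> (\<And>\<tau>. \<bar>\<psi> \<tau>\<bar> \<le> b / r) \<Longrightarrow>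
      (\<And>\<tau>. b * r < \<bar>\<tau>\<bar> \<Longrightarrow> \<psi> \<tau> = 0) \<Longrightarrow>
      \<bar>height_pairing u (2 * R) M \<psi> \<psi> v w\<bar> \<le> C1 / r"
    using height_pair_integral_trivial_bound[OF u, of "2 * R" b M] R b by auto
  obtain C2 where C2: "0 \<le> C2" "\<And>n \<delta> v w h \<psi> B c. 0 < n \<Longrightarrow> 0 < \<delta> \<Longrightarrow> plane_normal u v \<bullet> h = 1 \<Longrightarrow> plane_normal u w \<bullet> h = 0 \<Longrightarrow>
      real n * \<delta> * norm h \<le> 2 * H \<Longrightarrow> \<psi> \<in> borel_measurable borel \<Longrightarrow> 0 < c \<Longrightarrow>
      (\<And>\<tau>. \<bar>\<psi> \<tau>\<bar> \<le> B) \<Longrightarrow> (\<And>\<tau>. c < \<bar>\<tau>\<bar> \<Longrightarrow> \<psi> \<tau> = 0) \<Longrightarrow>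
      \<bar>height_pairing u (2 * R) M (smoothed_defect M n \<delta>) \<psi> v w\<bar>
        \<le> C2 * (real n * \<delta> * norm h) ^ M * B * c * norm h"
    using plane_height_pair_integral_le[OF u, of "2 * R" "2 * H" M] R H by auto
  define C3 where "C3 = 2 * C2 * (2 * H) ^ M * b\<^sup>2 * H"
  have C3: "0 \<le> C3" using C2 H by (simp add: C3_def)
  define C where "C = C1 + C1 * (4 * b) ^ Suc M + C3"
  have C: "C1 \<le> C" "C1 * (4 * b) ^ Suc M \<le> C" "C3 \<le> C" "0 \<le> C"
    using C1(1) C3 b by (auto simp: C_def)
  show thesis
  proof
    show "0 \<le> C" by fact
    fix n :: nat and \<delta> :: real and v w :: 'a
    assume n: "0 < n" and \<delta>: "0 < \<delta>" and vw: "norm v \<le> R" "norm w \<le> R"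
    define r where "r = real n * \<delta>"
    have r: "0 < r" using n \<delta> by (simp add: r_def)
    have bound: "\<bar>band M n \<delta> \<tau>\<bar> \<le> b / r" for \<tau>
    proof -
      have "2 * 2 ^ M / r \<le> b / r" using r by (intro divide_right_mono) (auto simp: b_def)
      then show ?thesis using abs_band_le[OF \<delta> n, of M \<tau>] by (simp add: r_def)
    qed
    have supp: "band M n \<delta> \<tau> = 0" if "b * r < \<bar>\<tau>\<bar>" for \<tau>
    proof (rule band_eq_0[OF \<delta> n])
      have "(2 * real M + 1) * r \<le> b * r" using r by (intro mult_right_mono) (auto simp: b_def)
      then show "(2 * real M + 1) * (real n * \<delta>) < \<bar>\<tau>\<bar>" using that by (simp add: r_def)
    qed
    define I where "I = (height_pairing u (2 * R) M (band M n \<delta>) (band M n \<delta>) v w)"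
    define \<rho> where "\<rho> = norm (v - w)"
    have I1: "\<bar>I\<bar> \<le> C1 / r" unfolding I_def by (rule C1(2)) (use r bound supp in auto)
    also have "\<dots> \<le> C / r" using C r by (intro divide_right_mono) auto
    finally show "\<bar>height_pairing u (2 * R) M (band M n \<delta>) (band M n \<delta>) v w\<bar>
        \<le> C / (real n * \<delta>)" by (simp add: I_def r_def)
    have "\<bar>I\<bar> * \<rho> ^ Suc M \<le> C * r ^ M"
    proof (cases "\<rho> \<le> 4 * b * r")
      case True
      have "\<bar>I\<bar> * \<rho> ^ Suc M \<le> C1 / r * (4 * b * r) ^ Suc M"
        using True C1 r by (intro mult_mono I1 power_mono) (auto simp: \<rho>_def)
      also have "\<dots> = C1 * (4 * b) ^ Suc M * r ^ M" using r by (simp add: power_mult_distrib)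
      also have "\<dots> \<le> C * r ^ M" using C r by (intro mult_right_mono) auto
      finally show ?thesis .
    next
      case far: False
      define D where "D = norm (plane_normal u v - plane_normal u w)"
      show ?thesis
      \<comment> \<open>If the normals are this close, the two heights differ by more than
        \<open>\<rho> / 2\<close> for all \<open>x\<close> with \<open>norm x \<le> 2 * R\<close>.
        This exceeds \<open>2 * b * r\<close>, so at least one of the two bands is zero
        there.\<close>
      proof (cases "D * (1 + 2 * R) < \<rho> / 2")
        case True
        have zero: "band M n \<delta> (plane_height u v x) * band M n \<delta> (plane_height u w x) * bump (2 * R) M x = 0" for x
        proof (cases "norm x \<le> 2 * R")
          case True
          have "\<bar>(plane_normal u v - plane_normal u w) \<bullet> x\<bar> \<le> D * norm x"
            unfolding D_def by (rule Cauchy_Schwarz_ineq2)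
          also have "\<dots> \<le> D * (2 * R)" using True by (intro mult_left_mono) (auto simp: D_def)
          finally have "\<bar>(plane_normal u v - plane_normal u w) \<bullet> x\<bar> \<le> D * (2 * R)" .
          moreover have "\<rho> \<le> D + \<bar>(v - w) \<bullet> u\<bar>"
            unfolding \<rho>_def D_def by (rule norm_diff_le_plane_normal[OF u])
          moreover have "plane_height u v x - plane_height u w x
              = (plane_normal u v - plane_normal u w) \<bullet> x - (v - w) \<bullet> u"
            by (simp add: plane_height_def inner_diff_left)
          moreover have "D * (1 + 2 * R) = D + D * (2 * R)" by (simp add: algebra_simps)
          ultimately have "\<rho> / 2 < \<bar>plane_height u v x - plane_height u w x\<bar>"
            using \<open>D * (1 + 2 * R) < \<rho> / 2\<close> by linarith
          then have "b * r < \<bar>plane_height u v x\<bar> \<or> b * r < \<bar>plane_height u w x\<bar>"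
            using far by linarith
          then show ?thesis using supp by auto
        next
          case False
          then show ?thesis using bump_eq_0[of "2 * R" x M] R by simp
        qed
        have "I = 0" unfolding I_def zero by simp
        then show ?thesis using C r by simp
      next
        case False
        have \<rho>: "0 < \<rho>" using far b r by (smt (verit) mult_pos_pos)
        have "0 < \<rho> / 2" using \<rho> by simp
        then have D: "0 < D" using False R by (smt (verit) zero_less_mult_pos2)
        then have "plane_normal u v \<noteq> plane_normal u w" by (auto simp: D_def)
        then obtain h where h: "plane_normal u v \<bullet> h = 1" "plane_normal u w \<bullet> h = 0"
          "norm h \<le> (1 + norm w) / D" "h \<noteq> 0"
          unfolding D_def using transversal_vector[OF u] by blast
        have "norm h * \<rho> \<le> (1 + R) / D * (D * (2 * (1 + 2 * R)))"
        proof (rule mult_mono)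
          show "norm h \<le> (1 + R) / D" using h(3) vw D by (smt (verit) divide_right_mono)
          show "\<rho> \<le> D * (2 * (1 + 2 * R))" using False by (simp add: algebra_simps)
        qed (use D R \<rho> in auto)
        also have "\<dots> = H" using D by (simp add: H_def)
        finally have h\<rho>: "norm h * \<rho> \<le> H" .
        have "norm h * r \<le> norm h * \<rho>" using far b r
          by (intro mult_left_mono) (smt (verit) mult_le_cancel_right1 mult.assoc, simp)
        then have rh: "r * norm h \<le> H" using h\<rho> by (simp add: mult.commute)
        \<comment> \<open>Only the first band is split into its two defects. The second is kept
          whole, because its bound \<open>b / r\<close> and its support \<open>b * r\<close>
          compensate each other, whereas a defect alone has height of order
          \<open>1 / \<delta>\<close>. The defect for \<open>2 * n\<close> is responsible for
          \<open>2 * r\<close>.\<close>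
        have J: "\<bar>height_pairing u (2 * R) M (smoothed_defect M m \<delta>) (band M n \<delta>) v w\<bar>
            \<le> C2 * (2 * r * norm h) ^ M * (b / r) * (b * r) * norm h" if "m = n \<or> m = 2 * n" for m
        proof -
          have le: "real m * \<delta> * norm h \<le> 2 * r * norm h"
            using that n \<delta> by (intro mult_right_mono) (auto simp: r_def)
          have "\<bar>height_pairing u (2 * R) M (smoothed_defect M m \<delta>) (band M n \<delta>) v w\<bar>
              \<le> C2 * (real m * \<delta> * norm h) ^ M * (b / r) * (b * r) * norm h"
          proof (rule C2(2))
            have "2 * r * norm h \<le> 2 * H" using rh by simp
            with le show "real m * \<delta> * norm h \<le> 2 * H" by (rule order_trans)
          qed (use that n \<delta> h b r bound supp in auto)
          also have "\<dots> \<le> C2 * (2 * r * norm h) ^ M * (b / r) * (b * r) * norm h"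
            using power_mono[OF le, of M] C2(1) b r \<delta>
            by (intro mult_right_mono[where c = "norm h"] mult_right_mono[where c = "b * r"]
                mult_right_mono[where c = "b / r"] mult_left_mono) auto
          finally show ?thesis .
        qed
        have int: "integrable lborel (\<lambda>x. smoothed_defect M m \<delta> (plane_height u v x) * band M n \<delta> (plane_height u w x) * bump (2 * R) M x)"
          if "0 < m" for m
          by (rule integrable_height_pair[OF _ _ abs_smoothed_defect_le[OF \<delta> that] bound]) (use R in auto)
        have "I = (height_pairing u (2 * R) M (smoothed_defect M (2 * n) \<delta>) (band M n \<delta>) v w)
          - (height_pairing u (2 * R) M (smoothed_defect M n \<delta>) (band M n \<delta>) v w)"
          unfolding I_def using n
          by (subst Bochner_Integration.integral_diff[symmetric])
            (auto intro!: int Bochner_Integration.integral_cong simp: band_def[of M n \<delta> "plane_height u v _"] left_diff_distrib)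
        then have "\<bar>I\<bar> \<le> 2 * (C2 * (2 * r * norm h) ^ M * (b / r) * (b * r) * norm h)"
          using J[of n] J[of "2 * n"] by simp
        then have "\<bar>I\<bar> * \<rho> ^ Suc M \<le> 2 * (C2 * (2 * r * norm h) ^ M * (b / r) * (b * r) * norm h) * \<rho> ^ Suc M"
          using \<rho> by (intro mult_right_mono) auto
        also have "\<dots> = 2 * C2 * b\<^sup>2 * (2 * (norm h * \<rho>)) ^ M * (norm h * \<rho>) * r ^ M"
          using r by (simp add: power_mult_distrib power2_eq_square mult_ac)
        also have "\<dots> \<le> 2 * C2 * b\<^sup>2 * (2 * H) ^ M * H * r ^ M"
          using h\<rho> C2(1) r H \<rho> by (intro mult_right_mono mult_mono mult_left_mono power_mono) auto
        also have "\<dots> = C3 * r ^ M" by (simp add: C3_def mult_ac)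
        also have "\<dots> \<le> C * r ^ M" using C r by (intro mult_right_mono) auto
        finally show ?thesis .
      qed
    qed
    then show "\<bar>height_pairing u (2 * R) M (band M n \<delta>) (band M n \<delta>) v w\<bar>
        * norm (v - w) ^ Suc M \<le> C * (real n * \<delta>) ^ M"
      by (simp add: I_def \<rho>_def r_def)
  qed
qed


section \<open>The incidence estimate\<close>

text \<open>A discretised Frostman measure: below the resolution \<delta> a finite set of point
  masses cannot be expected to obey the growth condition.\<close>

definition frostman_weight ::
    "real \<Rightarrow> real \<Rightarrow> real \<Rightarrow> 'a::euclidean_space set \<Rightarrow> ('a \<Rightarrow> real) \<Rightarrow> bool" where
  "frostman_weight \<delta> t A Z m \<longleftrightarrow> finite Z \<and> (\<forall>q\<in>Z. 0 \<le> m q) \<and>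
     (\<forall>y r. \<delta> \<le> r \<longrightarrow> (\<Sum>q\<in>Z \<inter> cball y r. m q) \<le> A * r powr t)"

lemma frostman_weightD:
  assumes "frostman_weight \<delta> t A Z m"
  shows "finite Z" "\<And>q. q \<in> Z \<Longrightarrow> 0 \<le> m q"
    "\<And>y r. \<delta> \<le> r \<Longrightarrow> (\<Sum>q\<in>Z \<inter> cball y r. m q) \<le> A * r powr t"
  using assms by (auto simp: frostman_weight_def)

text \<open>Integrate over \<open>y\<close> the mass of the points of \<open>S\<close> within
  distance \<open>r\<close> of \<open>y\<close>. The growth condition bounds the integrand, and
  exchanging sum and integral yields the left side. This replaces counting balls that cover
  \<open>T\<close> by a ratio of volumes.\<close>

lemma frostman_sum_le_measure:
  fixes S T Z :: "'a::euclidean_space set"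
  assumes fr: "frostman_weight \<delta> t A Z m" and r: "\<delta> \<le> r" "0 < r" and S: "S \<subseteq> Z"
    and [measurable]: "T \<in> sets borel" and T: "T \<subseteq> cball 0 R" "\<And>q. q \<in> S \<Longrightarrow> cball q r \<subseteq> T"
  shows "(\<Sum>q\<in>S. m q) * measure lborel (cball (0::'a) r) \<le> A * r powr t * measure lborel T"
proof -
  note fin = frostman_weightD(1)[OF fr] and nn = frostman_weightD(2)[OF fr]
  have finS: "finite S" using fin S finite_subset by blast
  have vol: "(\<integral>y. indicator (cball q r) y \<partial>lborel) = measure lborel (cball (0::'a) r)" for q :: 'a
    using r by (simp add: content_cball)
  have int: "integrable lborel (indicator (cball q r) :: 'a \<Rightarrow> real)" for q
    by (intro integrable_real_indicator emeasure_cball_finite) simp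
  have pw: "(\<Sum>q\<in>S. m q * indicator (cball q r) y) \<le> A * r powr t * indicator T y" for y
  proof (cases "y \<in> T")
    case True
    have "(\<Sum>q\<in>S. m q * indicator (cball q r) y) = (\<Sum>q\<in>S \<inter> cball y r. m q)"
      unfolding sum.inter_restrict[OF finS] by (rule sum.cong) (auto simp: dist_commute)
    also have "\<dots> \<le> (\<Sum>q\<in>Z \<inter> cball y r. m q)" using S fin nn by (intro sum_mono2) auto
    also have "\<dots> \<le> A * r powr t" using frostman_weightD(3)[OF fr r(1)] .
    finally show ?thesis using True by simp
  next
    case False
    then have "indicator (cball q r) y = (0::real)" if "q \<in> S" for q
      using T(2)[OF that] by (auto simp: indicator_def)
    then show ?thesis using False by simp
  qed
  have "(\<Sum>q\<in>S. m q) * measure lborel (cball (0::'a) r) = (\<Sum>q\<in>S. m q * (\<integral>y. indicator (cball q r) y \<partial>lborel))"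
    by (simp only: vol sum_distrib_right)
  also have "\<dots> = (\<integral>y. (\<Sum>q\<in>S. m q * indicator (cball q r) y) \<partial>lborel)"
    by (subst Bochner_Integration.integral_sum) (auto intro!: integrable_mult_right int)
  also have "\<dots> \<le> (\<integral>y. A * r powr t * indicator T y \<partial>lborel)"
    by (intro integral_mono Bochner_Integration.integrable_sum integrable_mult_right int
        integrable_indicator_bounded[OF _ T(1)] pw) simp
  finally show ?thesis by simp
qed

text \<open>Point-hyperplane duality: for fixed \<open>x\<close> the height is affine in the
  parameter, so the planes passing near \<open>x\<close> have their parameters in a slab with normal
  \<open>p\<close>, and the balls of radius \<open>r\<close> around these stay in a slab of
  comparable thickness.\<close>

lemma frostman_slab_mass_le:
  fixes u :: "'a::euclidean_space"
  assumes u: "norm u = 1" and R: "1 \<le> R" and A: "0 \<le> A" and b: "0 < b"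
  obtains C where "0 \<le> C"
    "\<And>\<delta> Z m r x. frostman_weight \<delta> t A Z m \<Longrightarrow> Z \<subseteq> cball 0 R \<Longrightarrow> \<delta> \<le> r \<Longrightarrow> 0 < r \<Longrightarrow> r \<le> 1 \<Longrightarrow> norm x \<le> R \<Longrightarrow>
      (\<Sum>q\<in>{q \<in> Z. \<bar>plane_height u q x\<bar> \<le> b * r}. m q) \<le> C * r powr (t - real DIM('a)) * r"
proof
  \<comment> \<open>Moving a parameter by \<open>r\<close> changes the height at \<open>x\<close> by
    at most \<open>norm p * r\<close>, and \<open>norm p \<le> 1 + R\<close>.\<close>
  define b' where "b' = b + (1 + R)"
  have b': "0 < b'" using b R by (simp add: b'_def)
  define V where "V = measure lborel (cball (0::'a) (R + 1 + 1))"
  define U where "U = unit_ball_vol (real DIM('a))"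
  have U: "0 < U" by (simp add: U_def)
  show "0 \<le> A * (3 * b' * V) / U" using A b' U by (simp add: V_def)
  fix \<delta> r and Z :: "'a set" and m and x :: 'a
  assume fr: "frostman_weight \<delta> t A Z m" and Z: "Z \<subseteq> cball 0 R" and r: "\<delta> \<le> r" "0 < r" "r \<le> 1" and x: "norm x \<le> R"
  define p where "p = x - (x \<bullet> u) *\<^sub>R u + u"
  have pu: "p \<bullet> u = 1" using u by (simp add: p_def inner_add_left inner_diff_left dot_square_norm)
  have pn: "norm p \<le> 1 + R"
    unfolding p_def using norm_triangle_ineq[of "x - (x \<bullet> u) *\<^sub>R u" u] norm_horizontal_le[OF u, of x] u x by simp
  have hp: "plane_height u v x = - (p \<bullet> v - x \<bullet> u)" for v
    by (simp add: plane_height_def plane_normal_def p_def inner_diff_left inner_diff_right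
        inner_add_left inner_add_right inner_commute)
  define S where "S = {q \<in> Z. \<bar>plane_height u q x\<bar> \<le> b * r}"
  define T where "T = {v \<in> cball 0 (R + 1). \<bar>p \<bullet> v - x \<bullet> u\<bar> \<le> b' * r}"
  have "(\<Sum>q\<in>S. m q) * measure lborel (cball (0::'a) r) \<le> A * r powr t * measure lborel T"
  proof (rule frostman_sum_le_measure[OF fr r(1,2)])
    fix q assume q: "q \<in> S"
    show "cball q r \<subseteq> T"
    proof
      fix v assume v: "v \<in> cball q r"
      then have qv: "norm (q - v) \<le> r" by (simp add: dist_norm)
      have "norm v \<le> norm q + norm (q - v)" by (metis norm_minus_commute norm_triangle_sub)
      then have "norm v \<le> R + 1" using qv q Z r by (auto simp: S_def)
      have "\<bar>p \<bullet> (q - v)\<bar> \<le> (1 + R) * r"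
        using Cauchy_Schwarz_ineq2[of p "q - v"] mult_mono[OF pn qv] R by force
      then have "\<bar>p \<bullet> q - p \<bullet> v\<bar> \<le> (1 + R) * r" by (simp only: inner_diff_right)
      moreover have "\<bar>p \<bullet> q - x \<bullet> u\<bar> \<le> b * r" using q by (simp add: S_def hp abs_minus_commute)
      moreover have "b' * r = b * r + (1 + R) * r" by (simp only: b'_def distrib_right)
      ultimately have "\<bar>p \<bullet> v - x \<bullet> u\<bar> \<le> b' * r" by linarith
      with \<open>norm v \<le> R + 1\<close> show "v \<in> T" by (simp add: T_def)
    qed
  qed (auto simp: S_def T_def)
  also have "\<dots> \<le> A * r powr t * (3 * (b' * r) * V)"
    unfolding T_def V_def using A b' r by (intro mult_left_mono measure_slab_le[OF pu u]) auto
  finally have le: "(\<Sum>q\<in>S. m q) * measure lborel (cball (0::'a) r) \<le> A * r powr t * (3 * (b' * r) * V)" .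
  have vol: "measure lborel (cball (0::'a) r) = U * r powr real DIM('a)"
    using r by (simp add: content_cball U_def powr_realpow)
  have "(\<Sum>q\<in>S. m q) \<le> A * r powr t * (3 * (b' * r) * V) / (U * r powr real DIM('a))"
    using le U r unfolding vol by (simp add: pos_le_divide_eq)
  also have "\<dots> = A * (3 * b' * V) / U * r powr (t - real DIM('a)) * r"
    using U r by (simp add: powr_diff)
  finally show "(\<Sum>q\<in>{q \<in> Z. \<bar>plane_height u q x\<bar> \<le> b * r}. m q)
      \<le> A * (3 * b' * V) / U * r powr (t - real DIM('a)) * r" by (simp add: S_def)
qed

text \<open>Dyadic balls about \<open>q\<close>: at distance about \<open>2 ^ i * r\<close> the
  kernel is at most of order \<open>1 / (2 ^ (i * Suc M) * r)\<close>, while the mass is at most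
  \<open>A * (2 ^ i * r) powr t\<close>. Since \<open>t \<le> M\<close>, the products decay at least
  like \<open>(1 / 2) ^ i\<close>, and the smallest ball determines the order of the sum.\<close>

lemma frostman_kernel_sum_le:
  fixes Z :: "'a::euclidean_space set"
  assumes fr: "frostman_weight \<delta> t A Z m" and Z: "Z \<subseteq> cball 0 R" and q: "q \<in> Z"
    and r: "\<delta> \<le> r" "0 < r" and A: "0 \<le> A" and C: "0 \<le> C" and t: "t \<le> real M"
    and K: "\<And>w. w \<in> Z \<Longrightarrow> K w \<le> C / r" "\<And>w. w \<in> Z \<Longrightarrow> K w * norm (q - w) ^ Suc M \<le> C * r ^ M"
  shows "(\<Sum>w\<in>Z. m w * K w) \<le> 2 ^ Suc (Suc M) * C * A * r powr (t - 1)"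
proof -
  note fin = frostman_weightD(1)[OF fr] and nn = frostman_weightD(2)[OF fr]
  obtain I0 where I0: "2 * R / r < 2 ^ I0" using real_arch_pow[of 2 "2 * R / r"] by auto
  define I where "I = Suc I0"
  \<comment> \<open>The leading factor \<open>2 ^ Suc M\<close> is due to the least dyadic radius
    containing a point: its distance is only known to exceed half that radius.\<close>
  define e where "e i = 2 ^ Suc M * (C / r) * (1 / 2 ^ Suc M) ^ i" for i :: nat
  have e: "0 \<le> e i" for i using C r by (simp add: e_def)
  have pw: "K w \<le> (\<Sum>i<I. e i * indicator (cball q (2 ^ i * r)) w)" if w: "w \<in> Z" for w
  proof -
    have "norm (q - w) \<le> 2 * R"
      using norm_triangle_ineq4[of q w] subsetD[OF Z q] subsetD[OF Z w] by simp
    also have "\<dots> \<le> 2 ^ I0 * r" using I0 r by (simp add: field_simps)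
    finally have ex: "norm (q - w) \<le> 2 ^ I0 * r" .
    define i where "i = (LEAST i. norm (q - w) \<le> 2 ^ i * r)"
    have i: "norm (q - w) \<le> 2 ^ i * r" unfolding i_def using ex by (rule LeastI)
    have "i \<le> I0" unfolding i_def using ex by (rule Least_le)
    have "K w \<le> e i"
    proof (cases i)
      case 0
      have "C / r * 1 \<le> C / r * 2 ^ Suc M" using C r by (intro mult_left_mono one_le_power) auto
      then show ?thesis using K(1)[OF w] 0 by (simp add: e_def mult.commute)
    next
      case (Suc j)
      have j: "2 ^ j * r < norm (q - w)"
        using not_less_Least[of j "\<lambda>i. norm (q - w) \<le> 2 ^ i * r"] Suc by (simp add: i_def[symmetric] not_le)
      have pos: "0 < 2 ^ j * r" using r by simp
      show ?thesis
      proof (cases "K w \<le> 0")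
        case True then show ?thesis using e[of i] by linarith
      next
        case False
        have "K w * (2 ^ j * r) ^ Suc M \<le> K w * norm (q - w) ^ Suc M"
          using False j pos by (intro mult_left_mono power_mono) auto
        then have "K w * (2 ^ j * r) ^ Suc M \<le> C * r ^ M" using K(2)[OF w] by linarith
        then have "K w \<le> C * r ^ M / (2 ^ j * r) ^ Suc M"
          using pos by (simp add: pos_le_divide_eq del: power_Suc)
        also have "\<dots> = C / r * (1 / 2 ^ Suc M) ^ j"
          using r by (simp add: power_mult_distrib power_divide power_commutes flip: power_mult)
        also have "\<dots> = e i" unfolding e_def Suc by simp
        finally show ?thesis .
      qed
    qed
    also have "e i = e i * indicator (cball q (2 ^ i * r)) w" using i by (simp add: dist_norm)
    also have "\<dots> \<le> (\<Sum>i<I. e i * indicator (cball q (2 ^ i * r)) w)"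
      using \<open>i \<le> I0\<close> e by (intro member_le_sum) (auto simp: I_def)
    finally show ?thesis .
  qed
  have "(\<Sum>w\<in>Z. m w * K w) \<le> (\<Sum>w\<in>Z. m w * (\<Sum>i<I. e i * indicator (cball q (2 ^ i * r)) w))"
    by (intro sum_mono mult_left_mono pw nn)
  also have "\<dots> = (\<Sum>i<I. e i * (\<Sum>w\<in>Z. m w * indicator (cball q (2 ^ i * r)) w))"
    unfolding sum_distrib_left by (subst sum.swap) (simp add: mult_ac)
  also have "\<dots> = (\<Sum>i<I. e i * (\<Sum>w\<in>Z \<inter> cball q (2 ^ i * r). m w))"
    unfolding sum.inter_restrict[OF fin] by (intro sum.cong refl arg_cong2[where f = "(*)"]) auto
  also have "\<dots> \<le> (\<Sum>i<I. 2 ^ Suc M * C * A * r powr (t - 1) * (1 / 2) ^ i)"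
  proof (rule sum_mono)
    fix i
    have "1 * r \<le> 2 ^ i * r" using r by (intro mult_right_mono) auto
    then have "\<delta> \<le> 2 ^ i * r" using r by linarith
    then have "(\<Sum>w\<in>Z \<inter> cball q (2 ^ i * r). m w) \<le> A * (2 ^ i * r) powr t"
      by (rule frostman_weightD(3)[OF fr])
    also have "\<dots> = A * r powr t * (2 ^ i) powr t" using r by (simp add: powr_mult)
    also have "\<dots> \<le> A * r powr t * (2 ^ i) powr real M"
      using A t by (intro mult_left_mono powr_mono) auto
    also have "\<dots> = A * r powr t * (2 ^ M) ^ i"
      by (simp add: powr_realpow mult.commute flip: power_mult)
    finally have "e i * (\<Sum>w\<in>Z \<inter> cball q (2 ^ i * r). m w) \<le> e i * (A * r powr t * (2 ^ M) ^ i)"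
      using e by (intro mult_left_mono) auto
    also have "\<dots> = 2 ^ Suc M * C * A * (r powr t / r) * ((1 / 2 ^ Suc M) ^ i * (2 ^ M) ^ i)"
      by (simp add: e_def)
    also have "(1 / 2 ^ Suc M) ^ i * (2 ^ M) ^ i = ((1 / 2 :: real)) ^ i"
      by (simp flip: power_mult_distrib)
    also have "r powr t / r = r powr (t - 1)" using r by (simp add: powr_diff)
    finally show "e i * (\<Sum>w\<in>Z \<inter> cball q (2 ^ i * r). m w) \<le> 2 ^ Suc M * C * A * r powr (t - 1) * (1 / 2) ^ i" .
  qed
  also have "\<dots> = 2 ^ Suc M * C * A * r powr (t - 1) * (\<Sum>i<I. (1 / 2) ^ i)"
    by (simp only: sum_distrib_left)
  finally have le: "(\<Sum>w\<in>Z. m w * K w) \<le> 2 ^ Suc M * C * A * r powr (t - 1) * (\<Sum>i<I. (1 / 2) ^ i)" .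
  have "(\<Sum>i<I. (1 / 2) ^ i) = ((1 / 2) ^ I - 1) / (1 / 2 - 1 :: real)"
    by (rule geometric_sum) simp
  also have "\<dots> \<le> 2" by (simp add: field_simps)
  finally have "(\<Sum>i<I. (1 / 2) ^ i) \<le> (2::real)" .
  then have "2 ^ Suc M * C * A * r powr (t - 1) * (\<Sum>i<I. (1 / 2) ^ i) \<le> 2 ^ Suc M * C * A * r powr (t - 1) * 2"
    using C A by (intro mult_left_mono) auto
  also have "\<dots> = 2 ^ Suc (Suc M) * C * A * r powr (t - 1)" by simp
  finally show ?thesis using le by linarith
qed

text \<open>The supremum bound \<open>r powr (t - d)\<close> is used when \<open>r\<close> is at least \<open>e powr (1 / (2 * d - t - 1))\<close>,
  where \<open>e\<close> is the measure of \<open>E\<close>, and the bound \<open>r powr (t - 1)\<close> for the squared L2 norm otherwise.\<close>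

lemma single_scale_L1_bound:
  fixes u :: "'a::euclidean_space"
  assumes u: "norm u = 1" and d: "2 \<le> DIM('a)" and R: "1 \<le> R" and t: "1 \<le> t" "t \<le> real DIM('a)"
    and A: "0 \<le> A" and b: "0 < b" and CK: "0 \<le> CK" and M: "M = DIM('a)"
  obtains C where "0 \<le> C"
    "\<And>\<delta> Z m r E \<psi>. frostman_weight \<delta> t A Z m \<Longrightarrow> Z \<subseteq> cball 0 R \<Longrightarrow> \<delta> \<le> r \<Longrightarrow> 0 < r \<Longrightarrow> r \<le> 1 \<Longrightarrow>
      E \<in> sets borel \<Longrightarrow> E \<subseteq> cball 0 R \<Longrightarrow> 0 < measure lborel E \<Longrightarrow>
      \<psi> \<in> borel_measurable borel \<Longrightarrow> (\<And>\<tau>. \<bar>\<psi> \<tau>\<bar> \<le> b / r) \<Longrightarrow> (\<And>\<tau>. b * r < \<bar>\<tau>\<bar> \<Longrightarrow> \<psi> \<tau> = 0) \<Longrightarrow>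
      (\<And>v w. v \<in> Z \<Longrightarrow> w \<in> Z \<Longrightarrow>
        \<bar>height_pairing u (2 * R) M \<psi> \<psi> v w\<bar> \<le> CK / r) \<Longrightarrow>
      (\<And>v w. v \<in> Z \<Longrightarrow> w \<in> Z \<Longrightarrow>
        \<bar>height_pairing u (2 * R) M \<psi> \<psi> v w\<bar>
          * norm (v - w) ^ Suc M \<le> CK * r ^ M) \<Longrightarrow>
      (\<integral>x. indicator E x * \<bar>\<Sum>q\<in>Z. m q * \<psi> (plane_height u q x)\<bar> \<partial>lborel)
        \<le> C * measure lborel E powr ((real DIM('a) - 1) / (2 * real DIM('a) - t - 1))"
proof -
  define d where "d = real DIM('a)"
  obtain C1 where C1: "0 \<le> C1"
    "\<And>\<delta> Z m r x. frostman_weight \<delta> t A Z m \<Longrightarrow> Z \<subseteq> cball 0 R \<Longrightarrow> \<delta> \<le> r \<Longrightarrow> 0 < r \<Longrightarrow> r \<le> 1 \<Longrightarrow> norm x \<le> R \<Longrightarrow>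
      (\<Sum>q\<in>{q \<in> Z. \<bar>plane_height u q x\<bar> \<le> b * r}. m q) \<le> C1 * r powr (t - d) * r"
    using frostman_slab_mass_le[OF u R A b, of t] unfolding d_def by blast
  define C2 where "C2 = A * R powr t * (2 ^ Suc (Suc M) * CK * A)"
  have C2: "0 \<le> C2" using A CK by (simp add: C2_def)
  \<comment> \<open>At radius \<open>r = e powr g\<close> the supremum bound
    \<open>r powr (t - d) * e\<close> and the Cauchy-Schwarz bound, the square root of
    \<open>e * r powr (t - 1)\<close>, coincide; their common value is
    \<open>e powr \<gamma>\<close>. The identities \<open>e1\<close> and \<open>e2\<close> express
    this in exponents.\<close>
  define g where "g = 1 / (2 * d - t - 1)"
  have dd: "2 \<le> d" "t \<le> d" using d t by (auto simp: d_def)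
  then have g: "0 < g" by (simp add: g_def)
  define \<gamma> where "\<gamma> = (d - 1) * g"
  have e1: "1 - \<gamma> = (d - t) * g" using dd by (simp add: \<gamma>_def g_def field_simps)
  have e2: "(t - 1) * g + (1 - \<gamma>) = \<gamma>" unfolding e1 by (simp add: \<gamma>_def algebra_simps)
  show thesis
  proof
    show "0 \<le> b * C1 + (1 + C2) / 2" using b C1 C2 by simp
    fix \<delta> r and Z E :: "'a set" and m and \<psi> :: "real \<Rightarrow> real"
    assume fr: "frostman_weight \<delta> t A Z m" and Z: "Z \<subseteq> cball 0 R" and r: "\<delta> \<le> r" "0 < r" "r \<le> 1"
      and E [measurable]: "E \<in> sets borel" and ER: "E \<subseteq> cball 0 R" and E0: "0 < measure lborel E"
      and \<psi>m [measurable]: "\<psi> \<in> borel_measurable borel"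
      and \<psi>: "\<And>\<tau>. \<bar>\<psi> \<tau>\<bar> \<le> b / r" "\<And>\<tau>. b * r < \<bar>\<tau>\<bar> \<Longrightarrow> \<psi> \<tau> = 0"
      and K1: "\<And>v w. v \<in> Z \<Longrightarrow> w \<in> Z \<Longrightarrow>
        \<bar>height_pairing u (2 * R) M \<psi> \<psi> v w\<bar> \<le> CK / r"
      and K2: "\<And>v w. v \<in> Z \<Longrightarrow> w \<in> Z \<Longrightarrow>
        \<bar>height_pairing u (2 * R) M \<psi> \<psi> v w\<bar>
          * norm (v - w) ^ Suc M \<le> CK * r ^ M"
    note fin = frostman_weightD(1)[OF fr] and nn = frostman_weightD(2)[OF fr]
    define F where "F x = (\<Sum>q\<in>Z. m q * \<psi> (plane_height u q x))" for x
    have [measurable]: "F \<in> borel_measurable borel" unfolding F_def by measurable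
    have [measurable]: "(bump (2 * R) M :: 'a \<Rightarrow> real) \<in> borel_measurable borel"
      by (rule borel_measurable_continuous_onI[OF continuous_bump])
    define e where "e = measure lborel E"
    have e: "0 < e" using E0 by (simp add: e_def)
    have intE: "integrable lborel (indicator E :: 'a \<Rightarrow> real)" by (rule integrable_indicator_bounded[OF E ER])
    have Fsup: "\<bar>F x\<bar> \<le> b * C1 * r powr (t - d)" if x: "x \<in> E" for x
    proof -
      have "\<bar>F x\<bar> \<le> (\<Sum>q\<in>Z. \<bar>m q * \<psi> (plane_height u q x)\<bar>)" unfolding F_def by (rule sum_abs)
      also have "\<dots> \<le> (\<Sum>q\<in>Z. if \<bar>plane_height u q x\<bar> \<le> b * r then m q * (b / r) else 0)"
      proof (rule sum_mono)
        fix q assume q: "q \<in> Z"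
        show "\<bar>m q * \<psi> (plane_height u q x)\<bar> \<le> (if \<bar>plane_height u q x\<bar> \<le> b * r then m q * (b / r) else 0)"
          using mult_left_mono[OF \<psi>(1)[of "plane_height u q x"] nn[OF q]] \<psi>(2)[of "plane_height u q x"] nn[OF q]
          by (auto simp: abs_mult)
      qed
      also have "\<dots> = (\<Sum>q\<in>{q \<in> Z. \<bar>plane_height u q x\<bar> \<le> b * r}. m q) * (b / r)"
        unfolding sum_distrib_right by (rule sum.inter_filter[OF fin, symmetric])
      also have "\<dots> \<le> C1 * r powr (t - d) * r * (b / r)"
      proof (rule mult_right_mono)
        have "norm x \<le> R" using x ER by auto
        then show "(\<Sum>q\<in>{q \<in> Z. \<bar>plane_height u q x\<bar> \<le> b * r}. m q) \<le> C1 * r powr (t - d) * r"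
          by (rule C1(2)[OF fr Z r])
      qed (use b r in simp)
      also have "\<dots> = b * C1 * r powr (t - d)" using r by simp
      finally show ?thesis .
    qed
    have Fall: "\<bar>F x\<bar> \<le> (\<Sum>q\<in>Z. m q * (b / r))" for x
      unfolding F_def
    proof (rule order_trans[OF sum_abs], rule sum_mono)
      show "\<bar>m q * \<psi> (plane_height u q x)\<bar> \<le> m q * (b / r)" if "q \<in> Z" for q
        using mult_left_mono[OF \<psi>(1)[of "plane_height u q x"] nn[OF that]] nn[OF that] by (simp add: abs_mult)
    qed
    have intEF: "integrable lborel (\<lambda>x. indicator E x * \<bar>F x\<bar>)"
    proof (rule integrable_bounded_support)
      show "\<bar>indicator E x * \<bar>F x\<bar>\<bar> \<le> (\<Sum>q\<in>Z. m q * (b / r))" for x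
        using Fall[of x] order_trans[OF abs_ge_zero Fall[of x]] by (simp add: indicator_def)
      show "R < norm x \<Longrightarrow> indicator E x * \<bar>F x\<bar> = 0" for x using ER by (auto simp: indicator_def)
    qed measurable
    have sup: "(\<integral>x. indicator E x * \<bar>F x\<bar> \<partial>lborel) \<le> b * C1 * r powr (t - d) * e"
    proof -
      have "(\<integral>x. indicator E x * \<bar>F x\<bar> \<partial>lborel) \<le> (\<integral>x. indicator E x * (b * C1 * r powr (t - d)) \<partial>lborel)"
        by (intro integral_mono intEF integrable_mult_left intE) (auto simp: indicator_def Fsup)
      then show ?thesis by (simp add: e_def mult.commute)
    qed
    have pair_int: "integrable lborel (\<lambda>x. m v * (m w * (\<psi> (plane_height u v x) * \<psi> (plane_height u w x) * bump (2 * R) M x)))" for v w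
      using R by (intro integrable_mult_right integrable_height_pair[OF \<psi>m \<psi>m \<psi>(1) \<psi>(1)]) auto
    have Fsq: "(F x)\<^sup>2 * bump (2 * R) M x
        = (\<Sum>v\<in>Z. \<Sum>w\<in>Z. m v * (m w * (\<psi> (plane_height u v x) * \<psi> (plane_height u w x) * bump (2 * R) M x)))" for x
      unfolding F_def power2_eq_square sum_product
      unfolding sum_distrib_right by (intro sum.cong refl) (simp only: mult_ac)
    have intF2: "integrable lborel (\<lambda>x. (F x)\<^sup>2 * bump (2 * R) M x)"
      unfolding Fsq by (intro Bochner_Integration.integrable_sum pair_int)
    have L2: "(\<integral>x. (F x)\<^sup>2 * bump (2 * R) M x \<partial>lborel) \<le> C2 * r powr (t - 1)"
    proof -
      have "(\<integral>x. (F x)\<^sup>2 * bump (2 * R) M x \<partial>lborel)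
        = (\<Sum>v\<in>Z. m v * (\<Sum>w\<in>Z. m w * (height_pairing u (2 * R) M \<psi> \<psi> v w)))"
      proof -
        have "(\<integral>x. (F x)\<^sup>2 * bump (2 * R) M x \<partial>lborel) = (\<Sum>v\<in>Z. \<integral>x. (\<Sum>w\<in>Z.
            m v * (m w * (\<psi> (plane_height u v x) * \<psi> (plane_height u w x) * bump (2 * R) M x))) \<partial>lborel)"
          unfolding Fsq by (intro Bochner_Integration.integral_sum Bochner_Integration.integrable_sum pair_int)
        also have "\<dots> = (\<Sum>v\<in>Z. \<Sum>w\<in>Z. \<integral>x.
            m v * (m w * (\<psi> (plane_height u v x) * \<psi> (plane_height u w x) * bump (2 * R) M x)) \<partial>lborel)"
          by (intro sum.cong refl Bochner_Integration.integral_sum pair_int)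
        finally show ?thesis by (simp only: integral_mult_right_zero sum_distrib_left)
      qed
      also have "\<dots> \<le> (\<Sum>v\<in>Z. m v * (2 ^ Suc (Suc M) * CK * A * r powr (t - 1)))"
      proof (intro sum_mono mult_left_mono nn)
        fix v assume v: "v \<in> Z"
        have "(\<Sum>w\<in>Z. m w * (height_pairing u (2 * R) M \<psi> \<psi> v w))
          \<le> (\<Sum>w\<in>Z. m w * \<bar>height_pairing u (2 * R) M \<psi> \<psi> v w\<bar>)"
          by (intro sum_mono mult_left_mono nn) auto
        also have "\<dots> \<le> 2 ^ Suc (Suc M) * CK * A * r powr (t - 1)"
          by (rule frostman_kernel_sum_le[OF fr Z v r(1,2) A CK]) (use t M K1 K2 v in auto)
        finally show "(\<Sum>w\<in>Z. m w * (height_pairing u (2 * R) M \<psi> \<psi> v w))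
          \<le> 2 ^ Suc (Suc M) * CK * A * r powr (t - 1)" .
      qed
      also have "\<dots> = (\<Sum>v\<in>Z. m v) * (2 ^ Suc (Suc M) * CK * A * r powr (t - 1))"
        by (simp only: sum_distrib_right)
      also have "\<dots> \<le> A * R powr t * (2 ^ Suc (Suc M) * CK * A * r powr (t - 1))"
      proof (rule mult_right_mono)
        have "Z \<inter> cball 0 R = Z" using Z by auto
        then show "(\<Sum>v\<in>Z. m v) \<le> A * R powr t"
          using frostman_weightD(3)[OF fr, of R 0] r R by simp
      qed (use CK A in simp)
      finally show ?thesis by (simp add: C2_def mult.assoc)
    qed
    \<comment> \<open>Cauchy-Schwarz in additive form with a free parameter. The bump is at least 1
      on \<open>E\<close>, so it can be inserted before the integral is extended to the whole
      space.\<close>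
    have amgm: "(\<integral>x. indicator E x * \<bar>F x\<bar> \<partial>lborel) \<le> (\<kappa> * e + C2 * r powr (t - 1) / \<kappa>) / 2" if l: "0 < \<kappa>" for \<kappa>
    proof -
      have "indicator E x * \<bar>F x\<bar> \<le> indicator E x * (\<kappa> / 2) + (F x)\<^sup>2 * bump (2 * R) M x * (1 / (2 * \<kappa>))" for x
      proof (cases "x \<in> E")
        case True
        have "0 \<le> (\<bar>F x\<bar> - \<kappa>)\<^sup>2" by simp
        then have "\<bar>F x\<bar> \<le> \<kappa> / 2 + (F x)\<^sup>2 * (1 / (2 * \<kappa>))"
          using l by (simp add: power2_diff field_simps power2_eq_square)
        also have "(F x)\<^sup>2 * 1 \<le> (F x)\<^sup>2 * bump (2 * R) M x"
          using True ER R by (intro mult_left_mono bump_ge_1) auto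
        then have "(F x)\<^sup>2 * (1 / (2 * \<kappa>)) \<le> (F x)\<^sup>2 * bump (2 * R) M x * (1 / (2 * \<kappa>))"
          using l by (intro mult_right_mono) auto
        finally show ?thesis using True by simp
      next
        case False
        then show ?thesis using l bump_nonneg[of "2 * R" M x] by simp
      qed
      then have "(\<integral>x. indicator E x * \<bar>F x\<bar> \<partial>lborel)
        \<le> (\<integral>x. indicator E x * (\<kappa> / 2) + (F x)\<^sup>2 * bump (2 * R) M x * (1 / (2 * \<kappa>)) \<partial>lborel)"
        by (intro integral_mono intEF Bochner_Integration.integrable_add integrable_mult_left intE intF2)
      also have "\<dots> = e * (\<kappa> / 2) + (\<integral>x. (F x)\<^sup>2 * bump (2 * R) M x \<partial>lborel) * (1 / (2 * \<kappa>))"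
        unfolding Bochner_Integration.integral_add[OF integrable_mult_left[OF intE] integrable_mult_left[OF intF2]]
        by (simp only: integral_mult_left_zero e_def) simp
      also have "\<dots> \<le> e * (\<kappa> / 2) + C2 * r powr (t - 1) * (1 / (2 * \<kappa>))"
        by (rule add_left_mono, rule mult_right_mono[OF L2]) (use l in simp)
      also have "\<dots> = (\<kappa> * e + C2 * r powr (t - 1) / \<kappa>) / 2"
        by (simp add: add_divide_distrib mult.commute)
      finally show ?thesis .
    qed
    have main: "(\<integral>x. indicator E x * \<bar>F x\<bar> \<partial>lborel) \<le> (b * C1 + (1 + C2) / 2) * e powr \<gamma>"
    proof (cases "e powr g \<le> r")
      case True
      have "r powr (t - d) \<le> (e powr g) powr (t - d)"
        using True e dd by (intro powr_mono2') auto
      then have "b * C1 * r powr (t - d) * e \<le> b * C1 * (e powr g) powr (t - d) * e"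
        using b C1 e by (intro mult_right_mono mult_left_mono) auto
      also have "\<dots> = b * C1 * (e powr (g * (t - d)) * e powr 1)" using e by (simp add: powr_powr)
      also have "\<dots> = b * C1 * e powr (g * (t - d) + 1)" by (simp only: powr_add)
      also have "g * (t - d) + 1 = \<gamma>" using e1 by (simp add: algebra_simps)
      finally have "b * C1 * r powr (t - d) * e \<le> b * C1 * e powr \<gamma>" .
      also have "\<dots> \<le> (b * C1 + (1 + C2) / 2) * e powr \<gamma>" using C2 by (intro mult_right_mono) auto
      finally show ?thesis using sup by linarith
    next
      case False
      \<comment> \<open>With this value of \<kappa> the first term is exactly
        \<open>e powr \<gamma>\<close>, and the second is at most a multiple of it because
        \<open>r\<close> is below the critical radius.\<close>
      have "(\<integral>x. indicator E x * \<bar>F x\<bar> \<partial>lborel) \<le> (e powr (\<gamma> - 1) * e + C2 * r powr (t - 1) / e powr (\<gamma> - 1)) / 2"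
        by (rule amgm) (use e in simp)
      also have "e powr (\<gamma> - 1) * e = e powr \<gamma>" using e by (simp add: powr_diff)
      finally have am: "(\<integral>x. indicator E x * \<bar>F x\<bar> \<partial>lborel) \<le> (e powr \<gamma> + C2 * r powr (t - 1) / e powr (\<gamma> - 1)) / 2" .
      have "C2 * r powr (t - 1) / e powr (\<gamma> - 1) \<le> C2 * e powr \<gamma>"
      proof -
        have "r powr (t - 1) \<le> (e powr g) powr (t - 1)"
          using False r t by (intro powr_mono2) auto
        also have "\<dots> = e powr ((t - 1) * g)" by (simp add: powr_powr mult.commute)
        finally have "r powr (t - 1) * e powr (1 - \<gamma>) \<le> e powr ((t - 1) * g) * e powr (1 - \<gamma>)"
          by (rule mult_right_mono) simp
        also have "\<dots> = e powr \<gamma>" by (simp only: powr_add[symmetric] e2)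
        finally have "C2 * (r powr (t - 1) * e powr (1 - \<gamma>)) \<le> C2 * e powr \<gamma>"
          using C2 by (rule mult_left_mono)
        moreover have "e powr (1 - \<gamma>) = 1 / e powr (\<gamma> - 1)"
          using powr_minus_divide[of e "\<gamma> - 1"] by simp
        ultimately show ?thesis by simp
      qed
      then have "(e powr \<gamma> + C2 * r powr (t - 1) / e powr (\<gamma> - 1)) / 2 \<le> (e powr \<gamma> + C2 * e powr \<gamma>) / 2"
        by (intro divide_right_mono add_left_mono) auto
      with am have "(\<integral>x. indicator E x * \<bar>F x\<bar> \<partial>lborel) \<le> (e powr \<gamma> + C2 * e powr \<gamma>) / 2"
        by (rule order_trans)
      also have "\<dots> = (1 + C2) / 2 * e powr \<gamma>" by (simp only: times_divide_eq_left distrib_right mult_1)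
      also have "\<dots> \<le> (b * C1 + (1 + C2) / 2) * e powr \<gamma>" using b C1 by (intro mult_right_mono) auto
      finally show ?thesis .
    qed
    have \<gamma>_eq: "\<gamma> = (real DIM('a) - 1) / (2 * real DIM('a) - t - 1)" by (simp add: \<gamma>_def g_def d_def)
    show "(\<integral>x. indicator E x * \<bar>\<Sum>q\<in>Z. m q * \<psi> (plane_height u q x)\<bar> \<partial>lborel)
        \<le> (b * C1 + (1 + C2) / 2) * measure lborel E powr ((real DIM('a) - 1) / (2 * real DIM('a) - t - 1))"
      using main unfolding \<gamma>_eq e_def F_def .
  qed
qed


section \<open>Summation over the dyadic scales\<close>

text \<open>The pulse of width \<open>1 / 2 ^ k\<close> is the sum of \<open>k\<close> bands and a
  remainder at unit scale. Every one of these \<open>Suc k\<close> pieces obeys the same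
  single-scale bound, which explains the factor \<open>Suc k\<close>.\<close>

lemma frostman_incidence_estimate:
  fixes u :: "'a::euclidean_space"
  assumes u: "norm u = 1" and d: "2 \<le> DIM('a)" and R: "1 \<le> R" and t: "1 \<le> t" "t \<le> real DIM('a)"
    and A: "0 \<le> A"
  obtains C where "0 \<le> C"
    "\<And>k Z m E. frostman_weight (1 / 2 ^ k) t A Z m \<Longrightarrow> Z \<subseteq> cball 0 R \<Longrightarrow> E \<in> sets borel \<Longrightarrow> E \<subseteq> cball 0 R \<Longrightarrow>
      (\<Sum>q\<in>Z. m q * measure lborel {x \<in> E. 0 \<le> plane_height u q x \<and> plane_height u q x < 1 / 2 ^ k})
      \<le> C * real (Suc k) * (1 / 2 ^ k)
        * measure lborel E powr ((real DIM('a) - 1) / (2 * real DIM('a) - t - 1))"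
proof -
  define M where "M = DIM('a)"
  define \<gamma> where "\<gamma> = (real DIM('a) - 1) / (2 * real DIM('a) - t - 1)"
  define b where "b = 2 * 2 ^ M + 2 * real M + 1"
  have b: "0 < b" by (simp add: b_def add_pos_nonneg)
  obtain C0 where C0: "0 \<le> C0" "\<And>\<psi> r v w. \<psi> \<in> borel_measurable borel \<Longrightarrow> 0 < r \<Longrightarrow> (\<And>\<tau>. \<bar>\<psi> \<tau>\<bar> \<le> b / r) \<Longrightarrow>
      (\<And>\<tau>. b * r < \<bar>\<tau>\<bar> \<Longrightarrow> \<psi> \<tau> = 0) \<Longrightarrow>
      \<bar>height_pairing u (2 * R) M \<psi> \<psi> v w\<bar> \<le> C0 / r"
    using height_pair_integral_trivial_bound[OF u, of "2 * R" b M] R b by auto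
  obtain CB where CB: "0 \<le> CB"
    "\<And>n \<delta> v w. 0 < n \<Longrightarrow> 0 < \<delta> \<Longrightarrow> norm v \<le> R \<Longrightarrow> norm w \<le> R \<Longrightarrow>
      \<bar>height_pairing u (2 * R) M (band M n \<delta>) (band M n \<delta>) v w\<bar>
        \<le> CB / (real n * \<delta>)"
    "\<And>n \<delta> v w. 0 < n \<Longrightarrow> 0 < \<delta> \<Longrightarrow> norm v \<le> R \<Longrightarrow> norm w \<le> R \<Longrightarrow>
      \<bar>height_pairing u (2 * R) M (band M n \<delta>) (band M n \<delta>) v w\<bar>
        * norm (v - w) ^ Suc M \<le> CB * (real n * \<delta>) ^ M"
    using band_pair_integral_le[OF u, of R M] R by auto
  define CK where "CK = CB + C0 + C0 * (2 * R) ^ Suc M"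
  have CK: "CB \<le> CK" "C0 \<le> CK" "C0 * (2 * R) ^ Suc M \<le> CK" "0 \<le> CK"
    using C0(1) CB(1) R by (auto simp: CK_def)
  obtain C where C: "0 \<le> C"
    "\<And>\<delta> Z m r E \<psi>. frostman_weight \<delta> t A Z m \<Longrightarrow> Z \<subseteq> cball 0 R \<Longrightarrow> \<delta> \<le> r \<Longrightarrow> 0 < r \<Longrightarrow> r \<le> 1 \<Longrightarrow>
      E \<in> sets borel \<Longrightarrow> E \<subseteq> cball 0 R \<Longrightarrow> 0 < measure lborel E \<Longrightarrow>
      \<psi> \<in> borel_measurable borel \<Longrightarrow> (\<And>\<tau>. \<bar>\<psi> \<tau>\<bar> \<le> b / r) \<Longrightarrow> (\<And>\<tau>. b * r < \<bar>\<tau>\<bar> \<Longrightarrow> \<psi> \<tau> = 0) \<Longrightarrow>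
      (\<And>v w. v \<in> Z \<Longrightarrow> w \<in> Z \<Longrightarrow>
        \<bar>height_pairing u (2 * R) M \<psi> \<psi> v w\<bar> \<le> CK / r) \<Longrightarrow>
      (\<And>v w. v \<in> Z \<Longrightarrow> w \<in> Z \<Longrightarrow>
        \<bar>height_pairing u (2 * R) M \<psi> \<psi> v w\<bar>
          * norm (v - w) ^ Suc M \<le> CK * r ^ M) \<Longrightarrow>
      (\<integral>x. indicator E x * \<bar>\<Sum>q\<in>Z. m q * \<psi> (plane_height u q x)\<bar> \<partial>lborel) \<le> C * measure lborel E powr \<gamma>"
    using single_scale_L1_bound[OF u d R t A b CK(4) M_def] unfolding \<gamma>_def by blast
  show thesis
  proof
    show "0 \<le> C" by fact
    fix k and Z E :: "'a set" and m
    assume fr: "frostman_weight (1 / 2 ^ k) t A Z m" and Z: "Z \<subseteq> cball 0 R"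
      and E [measurable]: "E \<in> sets borel" and ER: "E \<subseteq> cball 0 R"
    define \<delta> :: real where "\<delta> = 1 / 2 ^ k"
    have \<delta>: "0 < \<delta>" by (simp add: \<delta>_def)
    note fin = frostman_weightD(1)[OF fr] and nn = frostman_weightD(2)[OF fr]
    define e where "e = measure lborel E"
    define S where "S q = {x \<in> E. 0 \<le> plane_height u q x \<and> plane_height u q x < \<delta>}" for q
    have S: "S q \<in> sets borel" for q unfolding S_def by measurable
    have intE: "integrable lborel (\<lambda>x. indicator E x * f x)"
      if "f \<in> borel_measurable borel" "\<And>x. \<bar>f x\<bar> \<le> B" for f :: "'a \<Rightarrow> real" and B
    proof (rule integrable_bounded_support)
      note that(1)[measurable]
      show "(\<lambda>x. indicator E x * f x) \<in> borel_measurable borel" by measurable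
      show "\<bar>indicator E x * f x\<bar> \<le> B" for x
        using that(2)[of x] order_trans[OF abs_ge_zero that(2)[of x]] by (simp add: indicator_def)
      show "R < norm x \<Longrightarrow> indicator E x * f x = 0" for x using ER by (auto simp: indicator_def)
    qed
    have sumint: "integrable lborel (\<lambda>x. indicator E x * \<bar>\<Sum>q\<in>Z. m q * \<psi> (plane_height u q x)\<bar>)"
      if "\<psi> \<in> borel_measurable borel" "\<And>\<tau>. \<bar>\<psi> \<tau>\<bar> \<le> B" for \<psi> B
    proof (rule intE)
      note that(1)[measurable]
      show "(\<lambda>x. \<bar>\<Sum>q\<in>Z. m q * \<psi> (plane_height u q x)\<bar>) \<in> borel_measurable borel" by measurable
      show "\<bar>\<bar>\<Sum>q\<in>Z. m q * \<psi> (plane_height u q x)\<bar>\<bar> \<le> (\<Sum>q\<in>Z. m q * B)" for x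
        unfolding abs_idempotent
      proof (rule order_trans[OF sum_abs], rule sum_mono)
        show "\<bar>m q * \<psi> (plane_height u q x)\<bar> \<le> m q * B" if "q \<in> Z" for q
          using mult_left_mono[OF \<open>\<And>\<tau>. \<bar>\<psi> \<tau>\<bar> \<le> B\<close> nn[OF that]] nn[OF that] by (simp add: abs_mult)
      qed
    qed
    show "(\<Sum>q\<in>Z. m q * measure lborel {x \<in> E. 0 \<le> plane_height u q x \<and> plane_height u q x < 1 / 2 ^ k})
      \<le> C * real (Suc k) * (1 / 2 ^ k) * measure lborel E powr ((real DIM('a) - 1) / (2 * real DIM('a) - t - 1))"
    proof (cases "e = 0")
      case True
      have "measure lborel (S q) = 0" for q
      proof -
        have "measure lborel (S q) \<le> e" unfolding e_def
          by (rule measure_mono_bounded[OF S E _ ER]) (auto simp: S_def)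
        then show ?thesis using True by (simp add: measure_le_0_iff)
      qed
      then show ?thesis using C(1) by (simp add: S_def \<delta>_def)
    next
      case False
      then have e: "0 < e" by (simp add: e_def zero_less_measure_iff)
      \<comment> \<open>For \<open>n = 2 ^ k\<close> the scale \<open>n * \<delta>\<close> equals 1.
        The trivial bound then supplies both pairing hypotheses, since two parameters are at
        distance at most \<open>2 * R\<close>.\<close>
      define \<psi>0 where "\<psi>0 \<tau> = pulse \<delta> \<tau> - smoothed_defect M (2 ^ k) \<delta> \<tau>" for \<tau>
      have \<psi>0m [measurable]: "\<psi>0 \<in> borel_measurable borel" unfolding \<psi>0_def[abs_def] by measurable
      have \<psi>0b: "\<bar>\<psi>0 \<tau>\<bar> \<le> b / 1" for \<tau>
      proof -
        have "\<bar>\<psi>0 \<tau>\<bar> \<le> 2 ^ M / (real (2 ^ k) * \<delta>)"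
          unfolding \<psi>0_def by (rule abs_pulse_minus_smoothed_defect_le) (auto simp: \<delta>)
        also have "\<dots> = 2 ^ M" by (simp add: \<delta>_def)
        also have "\<dots> \<le> b / 1" by (simp add: b_def)
        finally show ?thesis .
      qed
      have \<psi>0s: "\<psi>0 \<tau> = 0" if "b * 1 < \<bar>\<tau>\<bar>" for \<tau>
      proof -
        have "real M * (real (2 ^ k) * \<delta>) = real M" "\<delta> \<le> 1" by (simp_all add: \<delta>_def)
        moreover have "1 + real M \<le> b" by (simp add: b_def)
        ultimately have "\<delta> + real M * (real (2 ^ k) * \<delta>) < \<bar>\<tau>\<bar>" using that by linarith
        then have "smoothed_defect M (2 ^ k) \<delta> \<tau> = 0" by (rule smoothed_defect_eq_0[OF \<delta>])
        moreover have "pulse \<delta> \<tau> = 0" using that \<open>\<delta> \<le> 1\<close> \<open>1 + real M \<le> b\<close> by (auto simp: pulse_def)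
        ultimately show ?thesis by (simp add: \<psi>0_def)
      qed
      have one: "(\<integral>x. indicator E x * \<bar>\<Sum>q\<in>Z. m q * \<psi>0 (plane_height u q x)\<bar> \<partial>lborel) \<le> C * e powr \<gamma>"
        unfolding e_def
      proof (rule C(2)[OF fr Z _ _ _ E ER, where r = 1])
        fix v w assume v: "v \<in> Z" and w: "w \<in> Z"
        define I where "I = (height_pairing u (2 * R) M \<psi>0 \<psi>0 v w)"
        have I: "\<bar>I\<bar> \<le> C0" using C0(2)[OF \<psi>0m, of 1 v w] \<psi>0b \<psi>0s unfolding I_def by simp
        then show "\<bar>height_pairing u (2 * R) M \<psi>0 \<psi>0 v w\<bar> \<le> CK / 1"
          using CK unfolding I_def by linarith
        have "norm (v - w) \<le> 2 * R"
          using norm_triangle_ineq4[of v w] subsetD[OF Z v] subsetD[OF Z w] by simp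
        then have "\<bar>I\<bar> * norm (v - w) ^ Suc M \<le> C0 * (2 * R) ^ Suc M"
          using I C0 by (intro mult_mono power_mono) auto
        also have "\<dots> \<le> CK * 1 ^ M" using CK by simp
        finally show "\<bar>height_pairing u (2 * R) M \<psi>0 \<psi>0 v w\<bar>
          * norm (v - w) ^ Suc M \<le> CK * 1 ^ M" unfolding I_def .
      qed (use \<psi>0b \<psi>0s e \<psi>0m in \<open>auto simp: e_def\<close>)
      have scale: "(\<integral>x. indicator E x * \<bar>\<Sum>q\<in>Z. m q * band M (2 ^ i) \<delta> (plane_height u q x)\<bar> \<partial>lborel) \<le> C * e powr \<gamma>"
        if i: "i < k" for i
        unfolding e_def
      proof (rule C(2)[OF fr Z _ _ _ E ER, where r = "2 ^ i * \<delta>"])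
        have pos: "0 < (2::nat) ^ i" by simp
        have r: "0 < 2 ^ i * \<delta>" using \<delta> by simp
        show "1 / 2 ^ k \<le> 2 ^ i * \<delta>" using \<delta> by (simp add: \<delta>_def divide_right_mono)
        have "(2::real) ^ i \<le> 2 ^ k" using i by (intro power_increasing) auto
        then show "2 ^ i * \<delta> \<le> 1" by (simp add: \<delta>_def)
        show "\<bar>band M (2 ^ i) \<delta> \<tau>\<bar> \<le> b / (2 ^ i * \<delta>)" for \<tau>
        proof -
          have "2 * 2 ^ M / (2 ^ i * \<delta>) \<le> b / (2 ^ i * \<delta>)"
            using r by (intro divide_right_mono) (auto simp: b_def)
          then show ?thesis using abs_band_le[OF \<delta> pos, of M \<tau>] by simp
        qed
        show "band M (2 ^ i) \<delta> \<tau> = 0" if "b * (2 ^ i * \<delta>) < \<bar>\<tau>\<bar>" for \<tau>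
        proof (rule band_eq_0[OF \<delta> pos])
          have "(2 * real M + 1) * (2 ^ i * \<delta>) \<le> b * (2 ^ i * \<delta>)"
            using r by (intro mult_right_mono) (auto simp: b_def)
          then show "(2 * real M + 1) * (real (2 ^ i) * \<delta>) < \<bar>\<tau>\<bar>"
            unfolding of_nat_power of_nat_numeral using that by (rule le_less_trans)
        qed
        fix v w assume "v \<in> Z" "w \<in> Z"
        then have vw: "norm v \<le> R" "norm w \<le> R" using Z by auto
        define I where "I = (height_pairing u (2 * R) M (band M (2 ^ i) \<delta>) (band M (2 ^ i) \<delta>) v w)"
        have "\<bar>I\<bar> \<le> CB / (real (2 ^ i) * \<delta>)" unfolding I_def by (rule CB(2)[OF pos \<delta> vw])
        also have "\<dots> \<le> CK / (2 ^ i * \<delta>)" using CK r by (simp add: divide_right_mono)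
        finally show "\<bar>height_pairing u (2 * R) M (band M (2 ^ i) \<delta>) (band M (2 ^ i) \<delta>) v w\<bar>
          \<le> CK / (2 ^ i * \<delta>)" unfolding I_def .
        have "\<bar>I\<bar> * norm (v - w) ^ Suc M \<le> CB * (real (2 ^ i) * \<delta>) ^ M" unfolding I_def by (rule CB(3)[OF pos \<delta> vw])
        also have "\<dots> \<le> CK * (2 ^ i * \<delta>) ^ M" using CK r by (simp add: mult_right_mono)
        finally show "\<bar>height_pairing u (2 * R) M (band M (2 ^ i) \<delta>) (band M (2 ^ i) \<delta>) v w\<bar>
          * norm (v - w) ^ Suc M \<le> CK * (2 ^ i * \<delta>) ^ M" unfolding I_def .
      qed (use \<delta> e in \<open>auto simp: e_def\<close>)
      \<comment> \<open>Averaging over a single shift is the identity, so the telescoping sum starts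
        from zero; \<open>M\<close> is positive because it is the dimension.\<close>
      have defect_1: "smoothed_defect M (Suc 0) \<delta> = (\<lambda>_. 0)"
      proof -
        obtain M' where "M = Suc M'" using d unfolding M_def by (cases "DIM('a)") auto
        then show ?thesis
          by (auto simp: smoothed_defect_def shift_diff_def shift_avg_def fun_eq_iff)
      qed
      have pulse_eq: "pulse \<delta> \<tau> = \<psi>0 \<tau> + (\<Sum>i<k. band M (2 ^ i) \<delta> \<tau>)" for \<tau>
      proof -
        have "(\<Sum>i<k. band M (2 ^ i) \<delta> \<tau>) = (\<Sum>i<k. smoothed_defect M (2 ^ Suc i) \<delta> \<tau> - smoothed_defect M (2 ^ i) \<delta> \<tau>)"
          by (simp add: band_def)
        also have "\<dots> = smoothed_defect M (2 ^ k) \<delta> \<tau>" by (subst sum_lessThan_telescope) (simp add: defect_1)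
        finally show ?thesis by (simp add: \<psi>0_def)
      qed
      have bandb: "\<bar>band M (2 ^ i) \<delta> \<tau>\<bar> \<le> 2 * 2 ^ M / (real (2 ^ i) * \<delta>)" for i \<tau> by (rule abs_band_le[OF \<delta>]) simp
      have pulseint: "integrable lborel (\<lambda>x. indicator E x * pulse \<delta> (plane_height u q x))" for q
        by (rule intE[OF _ abs_pulse_le[OF \<delta>]]) measurable
      have "(\<Sum>q\<in>Z. m q * measure lborel (S q)) = (\<Sum>q\<in>Z. m q * (\<delta> * (\<integral>x. indicator E x * pulse \<delta> (plane_height u q x) \<partial>lborel)))"
      proof (intro sum.cong refl arg_cong2[where f = "(*)"])
        fix q
        have "indicator (S q) x = \<delta> * (indicator E x * pulse \<delta> (plane_height u q x))" for x
          using \<delta> by (auto simp: S_def pulse_def indicator_def)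
        then have "(\<integral>x. indicator (S q) x \<partial>lborel) = \<delta> * (\<integral>x. indicator E x * pulse \<delta> (plane_height u q x) \<partial>lborel)"
          by (simp only: integral_mult_right_zero)
        then show "measure lborel (S q) = \<delta> * (\<integral>x. indicator E x * pulse \<delta> (plane_height u q x) \<partial>lborel)" by simp
      qed
      also have "\<dots> = \<delta> * (\<Sum>q\<in>Z. \<integral>x. m q * (indicator E x * pulse \<delta> (plane_height u q x)) \<partial>lborel)"
        by (simp only: integral_mult_right_zero sum_distrib_left mult.left_commute)
      also have "(\<Sum>q\<in>Z. \<integral>x. m q * (indicator E x * pulse \<delta> (plane_height u q x)) \<partial>lborel)
          = (\<integral>x. (\<Sum>q\<in>Z. m q * (indicator E x * pulse \<delta> (plane_height u q x))) \<partial>lborel)"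
        by (rule Bochner_Integration.integral_sum[symmetric]) (intro integrable_mult_right pulseint)
      finally have eq: "(\<Sum>q\<in>Z. m q * measure lborel (S q))
          = \<delta> * (\<integral>x. (\<Sum>q\<in>Z. m q * (indicator E x * pulse \<delta> (plane_height u q x))) \<partial>lborel)" .
      have pw: "(\<Sum>q\<in>Z. m q * (indicator E x * pulse \<delta> (plane_height u q x)))
          \<le> indicator E x * \<bar>\<Sum>q\<in>Z. m q * \<psi>0 (plane_height u q x)\<bar>
            + (\<Sum>i<k. indicator E x * \<bar>\<Sum>q\<in>Z. m q * band M (2 ^ i) \<delta> (plane_height u q x)\<bar>)" for x
      proof -
        have "(\<Sum>q\<in>Z. m q * pulse \<delta> (plane_height u q x))
            = (\<Sum>q\<in>Z. m q * \<psi>0 (plane_height u q x)) + (\<Sum>i<k. \<Sum>q\<in>Z. m q * band M (2 ^ i) \<delta> (plane_height u q x))"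
          unfolding pulse_eq distrib_left sum.distrib sum_distrib_left by (simp only: sum.swap[of _ "{..<k}"])
        also have "\<dots> \<le> \<bar>\<Sum>q\<in>Z. m q * \<psi>0 (plane_height u q x)\<bar>
            + (\<Sum>i<k. \<bar>\<Sum>q\<in>Z. m q * band M (2 ^ i) \<delta> (plane_height u q x)\<bar>)"
          by (intro add_mono sum_mono abs_ge_self)
        finally have "indicator E x * (\<Sum>q\<in>Z. m q * pulse \<delta> (plane_height u q x))
            \<le> indicator E x * (\<bar>\<Sum>q\<in>Z. m q * \<psi>0 (plane_height u q x)\<bar>
            + (\<Sum>i<k. \<bar>\<Sum>q\<in>Z. m q * band M (2 ^ i) \<delta> (plane_height u q x)\<bar>))"
          by (rule mult_left_mono) simp
        then show ?thesis by (simp only: distrib_left sum_distrib_left mult.left_commute)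
      qed
      have "(\<integral>x. (\<Sum>q\<in>Z. m q * (indicator E x * pulse \<delta> (plane_height u q x))) \<partial>lborel)
          \<le> (\<integral>x. indicator E x * \<bar>\<Sum>q\<in>Z. m q * \<psi>0 (plane_height u q x)\<bar>
            + (\<Sum>i<k. indicator E x * \<bar>\<Sum>q\<in>Z. m q * band M (2 ^ i) \<delta> (plane_height u q x)\<bar>) \<partial>lborel)"
        by (intro integral_mono pw Bochner_Integration.integrable_add Bochner_Integration.integrable_sum
            integrable_mult_right pulseint sumint[OF \<psi>0m \<psi>0b] sumint[OF band_measurable bandb])
      also have "\<dots> = (\<integral>x. indicator E x * \<bar>\<Sum>q\<in>Z. m q * \<psi>0 (plane_height u q x)\<bar> \<partial>lborel)
            + (\<integral>x. (\<Sum>i<k. indicator E x * \<bar>\<Sum>q\<in>Z. m q * band M (2 ^ i) \<delta> (plane_height u q x)\<bar>) \<partial>lborel)"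
        by (intro Bochner_Integration.integral_add Bochner_Integration.integrable_sum
            sumint[OF \<psi>0m \<psi>0b] sumint[OF band_measurable bandb])
      also have "(\<integral>x. (\<Sum>i<k. indicator E x * \<bar>\<Sum>q\<in>Z. m q * band M (2 ^ i) \<delta> (plane_height u q x)\<bar>) \<partial>lborel)
          = (\<Sum>i<k. \<integral>x. indicator E x * \<bar>\<Sum>q\<in>Z. m q * band M (2 ^ i) \<delta> (plane_height u q x)\<bar> \<partial>lborel)"
        by (intro Bochner_Integration.integral_sum sumint[OF band_measurable bandb])
      finally have "(\<integral>x. (\<Sum>q\<in>Z. m q * (indicator E x * pulse \<delta> (plane_height u q x))) \<partial>lborel)
          \<le> (\<integral>x. indicator E x * \<bar>\<Sum>q\<in>Z. m q * \<psi>0 (plane_height u q x)\<bar> \<partial>lborel)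
            + (\<Sum>i<k. \<integral>x. indicator E x * \<bar>\<Sum>q\<in>Z. m q * band M (2 ^ i) \<delta> (plane_height u q x)\<bar> \<partial>lborel)" .
      also have "\<dots> \<le> C * e powr \<gamma> + (\<Sum>i<k. C * e powr \<gamma>)"
        by (intro add_mono one sum_mono scale) simp
      also have "\<dots> = C * real (Suc k) * e powr \<gamma>" by (simp add: algebra_simps)
      finally have "(\<Sum>q\<in>Z. m q * measure lborel (S q)) \<le> \<delta> * (C * real (Suc k) * e powr \<gamma>)"
        unfolding eq using \<delta> by (intro mult_left_mono) auto
      also have "\<dots> = C * real (Suc k) * \<delta> * e powr \<gamma>" by (simp only: mult_ac)
      finally show ?thesis unfolding S_def e_def \<gamma>_def \<delta>_def .
    qed
  qed
qed


section \<open>Hausdorff content and discrete Frostman weights\<close>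

text \<open>The numbers \<open>\<rho> i\<close> only bound the diameters, so that pieces of diameter zero can be assigned
  a positive scale.\<close>

definition diameter_cover :: "'a::metric_space set \<Rightarrow> (nat \<Rightarrow> 'a set) \<Rightarrow> (nat \<Rightarrow> real) \<Rightarrow> bool" where
  "diameter_cover E U \<rho> \<longleftrightarrow> E \<subseteq> (\<Union>i. U i) \<and> (\<forall>i. 0 \<le> \<rho> i \<and> (\<forall>x\<in>U i. \<forall>y\<in>U i. dist x y \<le> \<rho> i))"

definition hausdorff_content :: "real \<Rightarrow> 'a::metric_space set \<Rightarrow> ennreal" where
  "hausdorff_content t E = (INF (U, \<rho>) \<in> {(U, \<rho>). diameter_cover E U \<rho>}. \<Sum>i. ennreal (\<rho> i powr t))"

lemma hausdorff_content_le:
  "diameter_cover E U \<rho> \<Longrightarrow> hausdorff_content t E \<le> (\<Sum>i. ennreal (\<rho> i powr t))"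
  unfolding hausdorff_content_def by (rule INF_lower2[of "(U, \<rho>)"]) auto

lemma hausdorff_content_lessE:
  assumes "hausdorff_content t E < c"
  obtains U \<rho> where "diameter_cover E U \<rho>" "(\<Sum>i. ennreal (\<rho> i powr t)) < c"
  using assms unfolding hausdorff_content_def by (auto simp: INF_less_iff)

lemma hausdorff_content_mono:
  assumes "E \<subseteq> F"
  shows "hausdorff_content t E \<le> hausdorff_content t F"
proof -
  have "diameter_cover E U \<rho>" if "diameter_cover F U \<rho>" for U \<rho>
    using that assms unfolding diameter_cover_def by (meson order_trans)
  then show ?thesis unfolding hausdorff_content_def by (intro INF_superset_mono) auto
qed

lemma hausdorff_content_UN_le:
  assumes "\<And>k::nat. hausdorff_content t (E k) < b k"
  shows "hausdorff_content t (\<Union>k. E k) \<le> (\<Sum>k. b k)"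
proof -
  have "\<exists>U \<rho>. diameter_cover (E k) U \<rho> \<and> (\<Sum>i. ennreal (\<rho> i powr t)) < b k" for k
    using hausdorff_content_lessE[OF assms[of k]] by blast
  then obtain U \<rho> where U: "\<And>k. diameter_cover (E k) (U k) (\<rho> k)"
    "\<And>k. (\<Sum>i. ennreal (\<rho> k i powr t)) < b k" by metis
  define V where "V i = (case prod_decode i of (k, j) \<Rightarrow> U k j)" for i
  define \<sigma> where "\<sigma> i = (case prod_decode i of (k, j) \<Rightarrow> \<rho> k j)" for i
  have "diameter_cover (\<Union>k. E k) V \<sigma>"
    unfolding diameter_cover_def
  proof (intro conjI allI)
    show "(\<Union>k. E k) \<subseteq> (\<Union>i. V i)"
    proof
      fix x assume "x \<in> (\<Union>k. E k)"
      then obtain k j where "x \<in> U k j" using U(1) by (fastforce simp: diameter_cover_def)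
      then have "x \<in> V (prod_encode (k, j))" by (simp add: V_def)
      then show "x \<in> (\<Union>i. V i)" by blast
    qed
    show "0 \<le> \<sigma> i" "\<forall>x\<in>V i. \<forall>y\<in>V i. dist x y \<le> \<sigma> i" for i
      using U(1) by (auto simp: V_def \<sigma>_def diameter_cover_def split: prod.split)
  qed
  then have "hausdorff_content t (\<Union>k. E k) \<le> (\<Sum>i. ennreal (\<sigma> i powr t))" by (rule hausdorff_content_le)
  also have "\<dots> = (\<Sum>i. (\<lambda>(k, j). ennreal (\<rho> k j powr t)) (prod_decode i))"
    by (simp add: \<sigma>_def case_prod_unfold)
  also have "\<dots> = (\<Sum>k. \<Sum>i. ennreal (\<rho> k i powr t))" by (rule suminf_ennreal_2dimen) simp
  also have "\<dots> \<le> (\<Sum>k. b k)" using U(2) by (intro suminf_le less_imp_le) auto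
  finally show ?thesis .
qed

lemma suminf_geometric_ennreal:
  assumes "0 \<le> c" "0 < q" "q < 1"
  shows "(\<Sum>k. ennreal (c * q ^ k)) = ennreal (c / (1 - q))"
proof (rule suminf_ennreal_eq)
  have "(\<lambda>k. c * q ^ k) sums (c * (1 / (1 - q)))" using assms by (intro sums_mult geometric_sums) auto
  then show "(\<lambda>k. c * q ^ k) sums (c / (1 - q))" by simp
qed (use assms in auto)

text \<open>The geometric bounds are normalised to have sum \<open>c / 2\<close>, so they cannot all
  be strict upper bounds. Later \<open>q\<close> is a small negative power of 2, which makes the
  loss \<open>q ^ k\<close> a small power of the scale.\<close>

lemma hausdorff_content_pigeonhole:
  assumes c: "ennreal c \<le> hausdorff_content t (\<Union>k::nat. E k)" "0 < c" and q: "0 < q" "q < 1"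
  obtains k where "ennreal (c * (1 - q) / 2 * q ^ k) \<le> hausdorff_content t (E k)"
proof -
  have "\<exists>k. ennreal (c * (1 - q) / 2 * q ^ k) \<le> hausdorff_content t (E k)"
  proof (rule ccontr)
    assume "\<not> ?thesis"
    then have "hausdorff_content t (\<Union>k. E k) \<le> (\<Sum>k. ennreal (c * (1 - q) / 2 * q ^ k))"
      by (intro hausdorff_content_UN_le) (simp add: not_le)
    also have "\<dots> = ennreal (c * (1 - q) / 2 / (1 - q))" using c q by (intro suminf_geometric_ennreal) auto
    also have "c * (1 - q) / 2 / (1 - q) = c / 2"
      using nonzero_mult_div_cancel_right[of "1 - q" "c / 2"] q by simp
    also have "\<dots> < ennreal c" using c(2) by (intro ennreal_lessI) auto
    finally show False using c(1) by simp
  qed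
  then show thesis using that by blast
qed

lemma hausdorff_content_UN_eq_0:
  assumes "\<And>k::nat. hausdorff_content t (E k) = 0"
  shows "hausdorff_content t (\<Union>k. E k) = 0"
proof (rule ccontr)
  assume "hausdorff_content t (\<Union>k. E k) \<noteq> 0"
  then obtain c where c: "0 < c" "ennreal c \<le> hausdorff_content t (\<Union>k. E k)"
  proof (cases "hausdorff_content t (\<Union>k. E k)")
    case (real r)
    with \<open>_ \<noteq> 0\<close> show ?thesis using that[of r] by (cases "r = 0") auto
  next
    case top
    then show ?thesis using that[of 1] by simp
  qed
  obtain k where "ennreal (c * (1 - 1 / 2) / 2 * (1 / 2) ^ k) \<le> hausdorff_content t (E k)"
    using hausdorff_content_pigeonhole[OF c(2,1), of "1 / 2"] by auto
  then show False using assms c(1) by simp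
qed

lemma hausdorff_content_finite_cover_le:
  fixes a :: "'i \<Rightarrow> 'a::metric_space"
  assumes "finite I" "E \<subseteq> (\<Union>i\<in>I. cball (a i) (r i))" "\<And>i. i \<in> I \<Longrightarrow> 0 \<le> r i" "0 < t"
  shows "hausdorff_content t E \<le> ennreal (\<Sum>i\<in>I. (2 * r i) powr t)"
proof -
  obtain f where f: "bij_betw f {..<card I} I"
    using ex_bij_betw_nat_finite[OF assms(1)] by (auto simp: atLeast0LessThan)
  define U where "U n = (if n < card I then cball (a (f n)) (r (f n)) else {})" for n
  define \<rho> where "\<rho> n = (if n < card I then 2 * r (f n) else 0)" for n
  have fI: "f n \<in> I" if "n < card I" for n using f that by (auto simp: bij_betw_def)
  have "diameter_cover E U \<rho>"
    unfolding diameter_cover_def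
  proof (intro conjI allI ballI)
    show "E \<subseteq> (\<Union>n. U n)"
    proof
      fix x assume "x \<in> E"
      then obtain i where i: "i \<in> I" "x \<in> cball (a i) (r i)" using assms(2) by blast
      then have "i \<in> f ` {..<card I}" using f by (simp add: bij_betw_def)
      then obtain n where "n < card I" "f n = i" by blast
      then show "x \<in> (\<Union>n. U n)" using i by (auto simp: U_def)
    qed
    show "0 \<le> \<rho> n" for n using assms(3) fI by (auto simp: \<rho>_def)
    fix n x y assume "x \<in> U n" "y \<in> U n"
    then have "n < card I" "dist (a (f n)) x \<le> r (f n)" "dist (a (f n)) y \<le> r (f n)"
      by (auto simp: U_def split: if_splits)
    then show "dist x y \<le> \<rho> n" using dist_triangle3[of x y "a (f n)"] by (simp add: \<rho>_def)
  qed
  then have "hausdorff_content t E \<le> (\<Sum>n. ennreal (\<rho> n powr t))" by (rule hausdorff_content_le)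
  also have "\<dots> = (\<Sum>n<card I. ennreal (\<rho> n powr t))"
    by (rule suminf_finite) (auto simp: \<rho>_def)
  also have "\<dots> = ennreal (\<Sum>n<card I. (2 * r (f n)) powr t)"
    by (simp add: \<rho>_def sum_ennreal)
  also have "(\<Sum>n<card I. (2 * r (f n)) powr t) = (\<Sum>i\<in>I. (2 * r i) powr t)"
    by (rule sum.reindex_bij_betw[OF f])
  finally show ?thesis .
qed

section \<open>Separated subsets and Frostman weights on nets\<close>

lemma bounded_finite_net:
  fixes Y :: "'a::euclidean_space set"
  assumes "bounded Y" "0 < \<delta>"
  obtains F where "finite F" "F \<subseteq> Y" "Y \<subseteq> (\<Union>y\<in>F. cball y \<delta>)"
proof -
  have "compact (closure Y)" using assms(1) by (simp add: compact_closure)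
  moreover have "closure Y \<subseteq> (\<Union>y\<in>Y. ball y \<delta>)"
    using assms(2) closure_approachable[of _ Y] by (force simp: dist_commute)
  ultimately obtain F where "F \<subseteq> Y" "finite F" "closure Y \<subseteq> (\<Union>y\<in>F. ball y \<delta>)"
    using compactE_image[of "closure Y" Y "\<lambda>y. ball y \<delta>"] by (metis open_ball)
  moreover have "(\<Union>y\<in>F. ball y \<delta>) \<subseteq> (\<Union>y\<in>F. cball y \<delta>)" using ball_subset_cball by blast
  ultimately show thesis using that[of F] closure_subset[of Y] by blast
qed

text \<open>Vitali selection from the balls of a net: enlarging the selected disjoint balls five
  times covers the net, one more \<delta> covers \<open>Y\<close>. This gives pieces of diameter
  \<open>12 * \<delta>\<close>.\<close>

lemma hausdorff_content_separated_subset: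
  fixes Y :: "'a::euclidean_space set"
  assumes "bounded Y" "0 < \<delta>" "0 < s" "ennreal c \<le> hausdorff_content s Y"
  obtains F where "finite F" "F \<subseteq> Y" "disjoint_family_on (\<lambda>y. cball y \<delta>) F"
    "c \<le> real (card F) * (12 * \<delta>) powr s"
proof -
  obtain F0 where F0: "finite F0" "F0 \<subseteq> Y" "Y \<subseteq> (\<Union>y\<in>F0. cball y \<delta>)"
    by (rule bounded_finite_net[OF assms(1,2)])
  have "F0 \<subseteq> (\<Union>y\<in>F0. cball y \<delta>)" using assms(2) by auto
  then obtain F where F: "F \<subseteq> F0" "pairwise (\<lambda>i j. disjnt (cball i \<delta>) (cball j \<delta>)) F"
    "F0 \<subseteq> (\<Union>i\<in>F. cball i (5 * \<delta>))"
    by (rule Vitali_covering_lemma_cballs[where K = F0 and a = "\<lambda>y. y" and r = "\<lambda>_. \<delta>" and B = \<delta>]) (use assms(2) in auto)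
  have fin: "finite F" using F(1) F0(1) finite_subset by blast
  have "Y \<subseteq> (\<Union>y\<in>F. cball y (6 * \<delta>))"
  proof
    fix x assume "x \<in> Y"
    then obtain y where y: "y \<in> F0" "dist y x \<le> \<delta>" using F0(3) by auto
    then obtain z where z: "z \<in> F" "dist z y \<le> 5 * \<delta>" using F(3) by auto
    then have "dist z x \<le> 6 * \<delta>" using dist_triangle[of z x y] y by simp
    then show "x \<in> (\<Union>y\<in>F. cball y (6 * \<delta>))" using z by auto
  qed
  then have "hausdorff_content s Y \<le> ennreal (\<Sum>y\<in>F. (2 * (6 * \<delta>)) powr s)"
    using assms by (intro hausdorff_content_finite_cover_le fin) auto
  also have "(\<Sum>y\<in>F. (2 * (6 * \<delta>)) powr s) = real (card F) * (12 * \<delta>) powr s" by simp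
  finally have "ennreal c \<le> ennreal (real (card F) * (12 * \<delta>) powr s)"
    using assms(4) by (rule order_trans[rotated])
  then have "c \<le> real (card F) * (12 * \<delta>) powr s" by (subst (asm) ennreal_le_iff) auto
  moreover have "disjoint_family_on (\<lambda>y. cball y \<delta>) F"
    using F(2) by (auto simp: disjoint_family_on_def pairwise_def disjnt_def)
  ultimately show thesis using that fin F(1) F0(2) by blast
qed

text \<open>Points are added one at a time with the largest weight that the constraints permit; tight
  constraints remain tight.\<close>

lemma saturated_weight_exists:
  fixes B :: "'i \<Rightarrow> 'a set" and cap :: "'i \<Rightarrow> real"
  assumes "finite Z" "finite I" "\<And>i. i \<in> I \<Longrightarrow> 0 \<le> cap i" "\<And>z. z \<in> Z \<Longrightarrow> \<exists>i\<in>I. z \<in> B i"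
  obtains m :: "'a \<Rightarrow> real" where "\<And>z. z \<in> Z \<Longrightarrow> 0 \<le> m z"
    "\<And>i. i \<in> I \<Longrightarrow> (\<Sum>z\<in>Z \<inter> B i. m z) \<le> cap i"
    "\<And>z. z \<in> Z \<Longrightarrow> \<exists>i\<in>I. z \<in> B i \<and> (\<Sum>z\<in>Z \<inter> B i. m z) = cap i"
proof -
  have "\<exists>m :: 'a \<Rightarrow> real. (\<forall>z\<in>Z. 0 \<le> m z) \<and> (\<forall>i\<in>I. (\<Sum>z\<in>Z \<inter> B i. m z) \<le> cap i) \<and>
      (\<forall>z\<in>Z. \<exists>i\<in>I. z \<in> B i \<and> (\<Sum>z\<in>Z \<inter> B i. m z) = cap i)"
    using assms(1,4)
  proof (induction Z)
    case empty
    then show ?case using assms(3) by auto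
  next
    case (insert z Z)
    then obtain m :: "'a \<Rightarrow> real" where m: "\<forall>z\<in>Z. 0 \<le> m z" "\<forall>i\<in>I. (\<Sum>z\<in>Z \<inter> B i. m z) \<le> cap i"
      "\<forall>z\<in>Z. \<exists>i\<in>I. z \<in> B i \<and> (\<Sum>z\<in>Z \<inter> B i. m z) = cap i" by auto
    define J where "J = {i\<in>I. z \<in> B i}"
    have J: "finite J" "J \<noteq> {}" using assms(2) insert.prems by (auto simp: J_def)
    define \<mu> where "\<mu> = Min ((\<lambda>i. cap i - (\<Sum>z\<in>Z \<inter> B i. m z)) ` J)"
    have \<mu>_le: "\<mu> \<le> cap i - (\<Sum>z\<in>Z \<inter> B i. m z)" if "i \<in> J" for i
      unfolding \<mu>_def using J that by (intro Min_le) auto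
    have "\<mu> \<in> (\<lambda>i. cap i - (\<Sum>z\<in>Z \<inter> B i. m z)) ` J" unfolding \<mu>_def using J by (intro Min_in) auto
    then obtain i0 where i0: "i0 \<in> J" "\<mu> = cap i0 - (\<Sum>z\<in>Z \<inter> B i0. m z)" by auto
    have \<mu>0: "0 \<le> \<mu>" using i0 m(2) by (auto simp: J_def)
    define m' where "m' = m(z := \<mu>)"
    have same: "(\<Sum>w\<in>Z \<inter> B i. m' w) = (\<Sum>w\<in>Z \<inter> B i. m w)" for i
      by (rule sum.cong) (use insert.hyps in \<open>auto simp: m'_def\<close>)
    have sum': "(\<Sum>w\<in>insert z Z \<inter> B i. m' w) = (\<Sum>w\<in>Z \<inter> B i. m w) + (if z \<in> B i then \<mu> else 0)" for i
    proof (cases "z \<in> B i")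
      case True
      then have "insert z Z \<inter> B i = insert z (Z \<inter> B i)" by auto
      then show ?thesis using True insert.hyps same[of i] by (simp add: m'_def)
    next
      case False
      then have "insert z Z \<inter> B i = Z \<inter> B i" by auto
      then show ?thesis using False same[of i] by simp
    qed
    have le: "(\<Sum>w\<in>insert z Z \<inter> B i. m' w) \<le> cap i" if "i \<in> I" for i
      unfolding sum' using \<mu>_le[of i] m(2) that by (auto simp: J_def)
    have tight: "(\<Sum>w\<in>insert z Z \<inter> B i. m' w) = cap i" if "i \<in> I" "(\<Sum>w\<in>Z \<inter> B i. m w) = cap i" for i
      using le[OF that(1)] \<mu>0 that(2) unfolding sum' by (auto split: if_splits)
    have "\<exists>i\<in>I. w \<in> B i \<and> (\<Sum>w\<in>insert z Z \<inter> B i. m' w) = cap i" if "w \<in> insert z Z" for w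
    proof (cases "w = z")
      case True
      then show ?thesis using i0 sum'[of i0] by (auto simp: J_def)
    next
      case False
      then show ?thesis using m(3) tight that by blast
    qed
    moreover have "\<forall>w\<in>insert z Z. 0 \<le> m' w" using m(1) \<mu>0 by (auto simp: m'_def)
    ultimately show ?case using le by blast
  qed
  then show thesis using that by blast
qed

text \<open>A maximal weight with caps on the dyadic balls about net points. Every net point lies in
  a ball whose cap is attained; a disjoint Vitali subfamily of such balls, enlarged, covers
  \<open>W\<close>. Its cost is \<open>12 powr t\<close> times the mass it carries, so the total
  mass dominates the content. No regularity of \<open>W\<close> enters.\<close>

lemma frostman_weight_exists:
  fixes W :: "'a::euclidean_space set"
  assumes W: "W \<subseteq> cball 0 R" and t: "0 < t" and c: "ennreal c \<le> hausdorff_content t W"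
  obtains Z m where "Z \<subseteq> W" "frostman_weight (1 / 2 ^ k) t (4 powr t) Z m" "c \<le> 12 powr t * (\<Sum>q\<in>Z. m q)"
proof -
  define \<delta> :: real where "\<delta> = 1 / 2 ^ k"
  have \<delta>: "0 < \<delta>" by (simp add: \<delta>_def)
  have "bounded W" using W bounded_subset bounded_cball by blast
  then obtain Z where Z: "finite Z" "Z \<subseteq> W" "W \<subseteq> (\<Union>y\<in>Z. cball y \<delta>)"
    using bounded_finite_net \<delta> by blast
  \<comment> \<open>The largest radius considered, \<open>rad (k + L) = 2 ^ L\<close>, exceeds
    \<open>2 * R\<close>, so a ball of that radius about any net point contains the whole
    net.\<close>
  obtain L where L: "2 * R < 2 ^ L" using real_arch_pow[of 2 "2 * R"] by auto
  define rad where "rad i = \<delta> * 2 ^ i" for i :: nat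
  have rad: "\<delta> \<le> rad i" "0 < rad i" for i
    using \<delta> mult_left_mono[of 1 "2 ^ i" \<delta>] by (auto simp: rad_def)
  define I where "I = Z \<times> {..k + L}"
  define B where "B = (\<lambda>(z, i). cball z (rad i) :: 'a set)"
  define cap where "cap = (\<lambda>(z::'a, i). rad i powr t)"
  obtain m where m: "\<And>z. z \<in> Z \<Longrightarrow> 0 \<le> m z" "\<And>i. i \<in> I \<Longrightarrow> (\<Sum>z\<in>Z \<inter> B i. m z) \<le> cap i"
    "\<And>z. z \<in> Z \<Longrightarrow> \<exists>i\<in>I. z \<in> B i \<and> (\<Sum>z\<in>Z \<inter> B i. m z) = cap i"
  proof (rule saturated_weight_exists[of Z I cap B])
    show "\<exists>i\<in>I. z \<in> B i" if "z \<in> Z" for z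
      using that less_imp_le[OF rad(2)[of 0]] by (intro bexI[of _ "(z, 0)"]) (auto simp: I_def B_def)
  qed (use Z in \<open>auto simp: I_def cap_def\<close>)
  \<comment> \<open>A ball that meets \<open>Z\<close> is contained in the ball of twice its radius
    about a point of \<open>Z\<close>, and rounding up to a dyadic radius costs another factor
    2.\<close>
  have "(\<Sum>q\<in>Z \<inter> cball y r. m q) \<le> 4 powr t * r powr t" if r: "\<delta> \<le> r" for y r
  proof (cases "Z \<inter> cball y r = {}")
    case True
    then show ?thesis by simp
  next
    case False
    then obtain z where z: "z \<in> Z" "dist y z \<le> r" by auto
    have r0: "0 < r" using r \<delta> by simp
    have sub: "cball y r \<subseteq> cball z (2 * r)"
    proof
      fix x assume "x \<in> cball y r"
      then show "x \<in> cball z (2 * r)" using z dist_triangle3[of z x y] by simp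
    qed
    have *: "(\<Sum>q\<in>Z \<inter> cball y r. m q) \<le> rad i powr t" if "i \<le> k + L" "Z \<inter> cball y r \<subseteq> cball z (rad i)" for i
    proof -
      have "(\<Sum>q\<in>Z \<inter> cball y r. m q) \<le> (\<Sum>q\<in>Z \<inter> B (z, i). m q)"
        using Z m(1) that by (intro sum_mono2) (auto simp: B_def)
      also have "\<dots> \<le> rad i powr t" using m(2)[of "(z, i)"] z that by (simp add: I_def cap_def)
      finally show ?thesis .
    qed
    have "\<exists>i\<le>k + L. Z \<inter> cball y r \<subseteq> cball z (rad i) \<and> rad i \<le> 4 * r"
    proof (cases "2 * r \<le> rad (k + L)")
      case True
      define i where "i = (LEAST i. 2 * r \<le> rad i)"
      have i: "2 * r \<le> rad i" "i \<le> k + L" unfolding i_def using True by (rule LeastI, rule Least_le)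
      have "i \<noteq> 0"
      proof
        assume "i = 0"
        then show False using i(1) r r0 by (simp add: rad_def)
      qed
      then obtain j where j: "i = Suc j" by (cases i) auto
      have "\<not> 2 * r \<le> rad j" using not_less_Least[of j "\<lambda>i. 2 * r \<le> rad i"] j by (simp add: i_def)
      then have "rad i \<le> 4 * r" by (simp add: j rad_def)
      moreover have "Z \<inter> cball y r \<subseteq> cball z (rad i)"
        using sub subset_cball[OF i(1), of z] by blast
      ultimately show ?thesis using i(2) by blast
    next
      case False
      have radL: "rad (k + L) = 2 ^ L" by (simp add: rad_def \<delta>_def power_add)
      have "Z \<subseteq> cball z (rad (k + L))"
      proof
        fix x assume "x \<in> Z"
        then have "norm x \<le> R" "norm z \<le> R" using Z(2) W z by auto
        then show "x \<in> cball z (rad (k + L))" using norm_triangle_ineq4[of z x] L radL by (simp add: dist_norm)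
      qed
      then show ?thesis using False r0 by (intro exI[of _ "k + L"]) auto
    qed
    then obtain i where i: "i \<le> k + L" "Z \<inter> cball y r \<subseteq> cball z (rad i)" "rad i \<le> 4 * r" by blast
    have "(\<Sum>q\<in>Z \<inter> cball y r. m q) \<le> rad i powr t" by (rule *[OF i(1,2)])
    also have "\<dots> \<le> (4 * r) powr t" using i(3) rad(2)[of i] t by (intro powr_mono2) auto
    also have "\<dots> = 4 powr t * r powr t" using r0 by (simp add: powr_mult)
    finally show ?thesis .
  qed
  then have fr: "frostman_weight (1 / 2 ^ k) t (4 powr t) Z m"
    using Z(1) m(1) by (auto simp: frostman_weight_def \<delta>_def)
  \<comment> \<open>For these balls mass and cap agree, so the cost of covering by them can be read
    as mass.\<close>
  define T where "T = {i \<in> I. (\<Sum>z\<in>Z \<inter> B i. m z) = cap i}"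
  have B_eq: "B i = cball (fst i) (rad (snd i))" for i by (simp add: B_def case_prod_unfold)
  have cap_eq: "cap i = rad (snd i) powr t" for i by (simp add: cap_def case_prod_unfold)
  have "Z \<subseteq> (\<Union>i\<in>T. cball (fst i) (rad (snd i)))"
    using m(3) unfolding B_eq[symmetric] T_def by fastforce
  moreover have "0 < rad (snd i) \<and> rad (snd i) \<le> rad (k + L)" if "i \<in> T" for i
    using that rad(2) \<delta> by (auto simp: T_def I_def rad_def)
  ultimately obtain D where D: "D \<subseteq> T" "pairwise (\<lambda>i j. disjnt (cball (fst i) (rad (snd i))) (cball (fst j) (rad (snd j)))) D"
    "Z \<subseteq> (\<Union>i\<in>D. cball (fst i) (5 * rad (snd i)))"
    by (rule Vitali_covering_lemma_cballs)
  have finD: "finite D" using D(1) Z(1) by (rule_tac finite_subset[of D I]) (auto simp: T_def I_def)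
  have "W \<subseteq> (\<Union>i\<in>D. cball (fst i) (6 * rad (snd i)))"
  proof
    fix x assume "x \<in> W"
    then obtain y where y: "y \<in> Z" "dist y x \<le> \<delta>" using Z(3) by auto
    then obtain i where i: "i \<in> D" "dist (fst i) y \<le> 5 * rad (snd i)" using D(3) by auto
    then have "dist (fst i) x \<le> 6 * rad (snd i)"
      using dist_triangle[of "fst i" x y] y rad(1)[of "snd i"] by simp
    then show "x \<in> (\<Union>i\<in>D. cball (fst i) (6 * rad (snd i)))" using i by auto
  qed
  then have "hausdorff_content t W \<le> ennreal (\<Sum>i\<in>D. (2 * (6 * rad (snd i))) powr t)"
    using t less_imp_le[OF rad(2)] by (intro hausdorff_content_finite_cover_le finD) auto
  with c have "ennreal c \<le> ennreal (\<Sum>i\<in>D. (2 * (6 * rad (snd i))) powr t)" by (rule order_trans)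
  then have "c \<le> (\<Sum>i\<in>D. (2 * (6 * rad (snd i))) powr t)" by (subst (asm) ennreal_le_iff) (auto intro: sum_nonneg)
  also have "\<dots> = (\<Sum>i\<in>D. 12 powr t * (\<Sum>z\<in>Z \<inter> B i. m z))"
  proof (rule sum.cong[OF refl])
    fix i assume "i \<in> D"
    then have "(\<Sum>z\<in>Z \<inter> B i. m z) = rad (snd i) powr t" using D(1) by (auto simp: T_def cap_eq)
    moreover have "(2 * (6 * rad (snd i))) powr t = 12 powr t * rad (snd i) powr t"
      using rad(2)[of "snd i"] by (simp flip: powr_mult)
    ultimately show "(2 * (6 * rad (snd i))) powr t = 12 powr t * (\<Sum>z\<in>Z \<inter> B i. m z)" by simp
  qed
  also have "\<dots> = 12 powr t * (\<Sum>z\<in>(\<Union>i\<in>D. Z \<inter> B i). m z)"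
  proof -
    have "(\<Sum>z\<in>(\<Union>i\<in>D. Z \<inter> B i). m z) = (\<Sum>i\<in>D. \<Sum>z\<in>Z \<inter> B i. m z)"
    proof (rule sum.UNION_disjoint)
      show "\<forall>i\<in>D. \<forall>j\<in>D. i \<noteq> j \<longrightarrow> (Z \<inter> B i) \<inter> (Z \<inter> B j) = {}"
        using D(2) unfolding pairwise_def disjnt_def B_eq by blast
    qed (use finD Z in auto)
    then show ?thesis by (simp add: sum_distrib_left)
  qed
  also have "\<dots> \<le> 12 powr t * (\<Sum>z\<in>Z. m z)"
    using m(1) Z(1) by (intro mult_left_mono sum_mono2) auto
  finally show thesis using that[OF Z(2) fr] by blast
qed


section \<open>The cover bound for families of hyperplanes\<close>

text \<open>Both sides estimate the weighted volume of the parts of the thickened pieces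
  \<open>E\<close> that lie within \<delta> = \<open>1 / 2 ^ k\<close> above the planes. From below,
  the content of each slice gives at least \<open>cs / (12 * \<delta>) powr s\<close> disjoint
  balls; from above, the incidence estimate applies to \<open>E\<close>.\<close>

lemma scale_inequality:
  fixes u :: "'a::euclidean_space"
  assumes u: "norm u = 1" and d: "2 \<le> DIM('a)" and R: "1 \<le> R" and t: "1 \<le> t" "t \<le> real DIM('a)"
    and s: "0 < s"
  obtains C where "0 \<le> C"
    "\<And>k W K (I :: 'i set) U cw cs. finite I \<Longrightarrow> W \<subseteq> cball 0 R \<Longrightarrow> 0 \<le> cs \<Longrightarrow>
      (\<And>i x y. i \<in> I \<Longrightarrow> x \<in> U i \<Longrightarrow> y \<in> U i \<Longrightarrow> dist x y \<le> 1 / 2 ^ k) \<Longrightarrow>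
      ennreal cw \<le> hausdorff_content t W \<Longrightarrow>
      (\<And>w. w \<in> W \<Longrightarrow> ennreal cs \<le> hausdorff_content s (K \<inter> {x. plane_height u w x = 0} \<inter> cball 0 R \<inter> (\<Union>i\<in>I. U i))) \<Longrightarrow>
      cw / 12 powr t * (cs / (12 / 2 ^ k) powr s * (unit_ball_vol (real DIM('a)) * (1 / 2 ^ k / (4 * (1 + R))) ^ DIM('a)))
      \<le> C * real (Suc k) * (1 / 2 ^ k)
        * (real (card I) * (unit_ball_vol (real DIM('a)) * (2 / 2 ^ k) ^ DIM('a))) powr ((real DIM('a) - 1) / (2 * real DIM('a) - t - 1))"
proof -
  have R2: "1 \<le> R + 2" using R by simp
  obtain C where C: "0 \<le> C"
    "\<And>k Z m E. frostman_weight (1 / 2 ^ k) t (4 powr t) Z m \<Longrightarrow> Z \<subseteq> cball 0 (R + 2) \<Longrightarrow> E \<in> sets borel \<Longrightarrow> E \<subseteq> cball 0 (R + 2) \<Longrightarrow>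
      (\<Sum>q\<in>Z. m q * measure lborel {x \<in> E. 0 \<le> plane_height u q x \<and> plane_height u q x < 1 / 2 ^ k})
      \<le> C * real (Suc k) * (1 / 2 ^ k)
        * measure lborel E powr ((real DIM('a) - 1) / (2 * real DIM('a) - t - 1))"
    using frostman_incidence_estimate[OF u d R2 t, of "4 powr t"] by auto
  show thesis
  proof
    show "0 \<le> C" by fact
    fix k and W K :: "'a set" and I :: "'i set" and U :: "'i \<Rightarrow> 'a set" and cw cs
    assume I: "finite I" and W: "W \<subseteq> cball 0 R" and cs: "0 \<le> cs"
      and U: "\<And>i x y. i \<in> I \<Longrightarrow> x \<in> U i \<Longrightarrow> y \<in> U i \<Longrightarrow> dist x y \<le> 1 / 2 ^ k"
      and cw: "ennreal cw \<le> hausdorff_content t W"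
      and cov: "\<And>w. w \<in> W \<Longrightarrow> ennreal cs \<le> hausdorff_content s (K \<inter> {x. plane_height u w x = 0} \<inter> cball 0 R \<inter> (\<Union>i\<in>I. U i))"
    define \<delta> :: real where "\<delta> = 1 / 2 ^ k"
    have \<delta>: "0 < \<delta>" "\<delta> \<le> 1" by (simp_all add: \<delta>_def)
    define V where "V = unit_ball_vol (real DIM('a))"
    have V: "0 < V" by (simp add: V_def)
    \<comment> \<open>Chosen so that over a ball of radius \<open>r'\<close> the height deviates
      from its value at the centre by at most \<open>\<delta> / 4\<close>.\<close>
    define r' where "r' = \<delta> / (4 * (1 + R))"
    have r': "0 < r'" "(1 + R) * r' = \<delta> / 4" "r' \<le> \<delta> / 4"
      using \<delta> R by (simp_all add: r'_def field_simps)
    define \<gamma> where "\<gamma> = (real DIM('a) - 1) / (2 * real DIM('a) - t - 1)"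
    have \<gamma>: "0 \<le> \<gamma>" using d t by (simp add: \<gamma>_def)
    obtain Z m where Z: "Z \<subseteq> W" and fr: "frostman_weight (1 / 2 ^ k) t (4 powr t) Z m"
      and mZ: "cw \<le> 12 powr t * (\<Sum>q\<in>Z. m q)"
      using frostman_weight_exists[OF W _ cw] t by auto
    \<comment> \<open>Only pieces meeting the ball are thickened: their centres can then be taken in
      it, and \<open>E\<close> stays within radius \<open>R + 2\<close>.\<close>
    define J where "J = {i \<in> I. U i \<inter> cball 0 R \<noteq> {}}"
    have J: "finite J" "card J \<le> card I" using I by (auto simp: J_def intro: card_mono)
    have "\<forall>i\<in>J. \<exists>x. x \<in> U i \<inter> cball 0 R" by (auto simp: J_def)
    then obtain c where c: "\<And>i. i \<in> J \<Longrightarrow> c i \<in> U i \<inter> cball 0 R" by metis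
    define E where "E = (\<Union>i\<in>J. cball (c i) (2 * \<delta>))"
    have E: "E \<in> sets borel" using J unfolding E_def by (intro borel_closed closed_UN) auto
    have ER: "E \<subseteq> cball 0 (R + 2)"
    proof
      fix x assume "x \<in> E"
      then obtain i where i: "i \<in> J" "dist (c i) x \<le> 2 * \<delta>" by (auto simp: E_def)
      have "norm x \<le> norm (c i) + dist (c i) x" by (metis dist_norm norm_minus_commute norm_triangle_sub)
      then show "x \<in> cball 0 (R + 2)" using i c[OF i(1)] \<delta> by auto
    qed
    have "measure lborel E \<le> (\<Sum>i\<in>J. measure lborel (cball (c i) (2 * \<delta>)))"
      unfolding E_def by (rule measure_UNION_le) (use J in auto)
    also have "\<dots> = real (card J) * (V * (2 * \<delta>) ^ DIM('a))" using \<delta> by (simp add: content_cball V_def)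
    also have "\<dots> \<le> real (card I) * (V * (2 * \<delta>) ^ DIM('a))"
      using J V \<delta> by (intro mult_right_mono) auto
    finally have mE: "measure lborel E \<le> real (card I) * (V * (2 * \<delta>) ^ DIM('a))" .
    define b where "b = cs / (12 * \<delta>) powr s * (V * r' ^ DIM('a))"
    have b: "0 \<le> b" using cs V r' by (simp add: b_def)
    have low: "b \<le> measure lborel {x \<in> E. 0 \<le> plane_height u q x \<and> plane_height u q x < \<delta>}" if q: "q \<in> Z" for q
    proof -
      define Y where "Y = K \<inter> {x. plane_height u q x = 0} \<inter> cball 0 R \<inter> (\<Union>i\<in>I. U i)"
      have "bounded Y" unfolding Y_def by (rule bounded_subset[OF bounded_cball[of 0 R]]) auto
      moreover have "ennreal cs \<le> hausdorff_content s Y" unfolding Y_def using cov q Z by blast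
      ultimately obtain F where F: "finite F" "F \<subseteq> Y" "disjoint_family_on (\<lambda>y. cball y \<delta>) F"
        "cs \<le> real (card F) * (12 * \<delta>) powr s"
        using hausdorff_content_separated_subset[of Y \<delta> s cs] \<delta> s by blast
      \<comment> \<open>The slab in the incidence estimate is one-sided, hence the shift by
        \<open>\<delta> / 2\<close> along \<open>u\<close>: on \<open>D y\<close> the heights lie
        between \<open>\<delta> / 4\<close> and \<open>3 * \<delta> / 4\<close>.\<close>
      define D where "D y = cball (y + (\<delta> / 2) *\<^sub>R u) r'" for y
      have Dsub: "D y \<subseteq> cball y \<delta>" for y
      proof
        fix x assume "x \<in> D y"
        then have "dist (y + (\<delta> / 2) *\<^sub>R u) x \<le> r'" by (simp add: D_def)
        moreover have "dist y (y + (\<delta> / 2) *\<^sub>R u) = \<delta> / 2" using u \<delta> by (simp add: dist_norm)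
        ultimately show "x \<in> cball y \<delta>" using dist_triangle[of y x "y + (\<delta> / 2) *\<^sub>R u"] r' \<delta> by simp
      qed
      have "(\<Union>y\<in>F. D y) \<subseteq> {x \<in> E. 0 \<le> plane_height u q x \<and> plane_height u q x < \<delta>}"
      proof
        fix x assume "x \<in> (\<Union>y\<in>F. D y)"
        then obtain y where y: "y \<in> F" "x \<in> D y" by blast
        then have yY: "y \<in> Y" using F(2) by blast
        then obtain i where i: "i \<in> I" "y \<in> U i" by (auto simp: Y_def)
        have iJ: "i \<in> J" using i yY by (auto simp: J_def Y_def)
        have "dist (c i) y \<le> \<delta>" using U[OF i(1)] c[OF iJ] i(2) by (auto simp: \<delta>_def)
        moreover have "dist y x \<le> \<delta>" using subsetD[OF Dsub y(2)] by simp
        ultimately have "dist (c i) x \<le> 2 * \<delta>" using dist_triangle[of "c i" x y] by simp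
        then have xE: "x \<in> E" using iJ by (auto simp: E_def)
        define z where "z = x - (y + (\<delta> / 2) *\<^sub>R u)"
        have x_eq: "x = y + ((\<delta> / 2) *\<^sub>R u + z)" by (simp add: z_def)
        have "norm z \<le> r'" using y(2) by (simp add: D_def z_def dist_norm norm_minus_commute)
        moreover have "norm (plane_normal u q) \<le> 1 + R"
          using norm_plane_normal_le[OF u, of q] q Z W by force
        ultimately have "\<bar>plane_normal u q \<bullet> z\<bar> \<le> (1 + R) * r'"
          using Cauchy_Schwarz_ineq2[of "plane_normal u q" z] mult_mono[of "norm (plane_normal u q)" "1 + R" "norm z" r'] R
          by simp
        then have "\<bar>plane_normal u q \<bullet> z\<bar> \<le> \<delta> / 4" by (simp only: r'(2))
        then have "- (\<delta> / 4) \<le> plane_normal u q \<bullet> z" "plane_normal u q \<bullet> z \<le> \<delta> / 4" by linarith+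
        moreover have "plane_height u q x = \<delta> / 2 + plane_normal u q \<bullet> z"
        proof -
          have "plane_height u q y = 0" using yY by (simp add: Y_def)
          then show ?thesis
            unfolding x_eq plane_height_add using plane_normal_inner_self[OF u, of q] by (simp add: inner_add_right)
        qed
        ultimately show "x \<in> {x \<in> E. 0 \<le> plane_height u q x \<and> plane_height u q x < \<delta>}"
          using xE \<delta> by simp
      qed
      then have "measure lborel (\<Union>y\<in>F. D y) \<le> measure lborel {x \<in> E. 0 \<le> plane_height u q x \<and> plane_height u q x < \<delta>}"
      proof (rule measure_mono_bounded[rotated 2])
        show "(\<Union>y\<in>F. D y) \<in> sets borel" using F(1) by (intro borel_closed closed_UN) (auto simp: D_def)
        note E[measurable]
        show "{x \<in> E. 0 \<le> plane_height u q x \<and> plane_height u q x < \<delta>} \<in> sets borel" by measurable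
        show "{x \<in> E. 0 \<le> plane_height u q x \<and> plane_height u q x < \<delta>} \<subseteq> cball 0 (R + 2)" using ER by auto
      qed
      moreover have "measure lborel (\<Union>y\<in>F. D y) = (\<Sum>y\<in>F. measure lborel (D y))"
      proof (rule measure_finite_Union)
        show "disjoint_family_on D F" using F(3) Dsub by (fastforce simp: disjoint_family_on_def)
        show "emeasure lborel (D y) \<noteq> \<infinity>" for y using emeasure_cball_finite by (simp add: D_def less_top)
      qed (use F in \<open>auto simp: D_def\<close>)
      moreover have "(\<Sum>y\<in>F. measure lborel (D y)) = real (card F) * (V * r' ^ DIM('a))"
        using r' by (simp add: D_def content_cball V_def)
      moreover have "b \<le> real (card F) * (V * r' ^ DIM('a))"
        unfolding b_def using F(4) V r' \<delta> by (intro mult_right_mono) (auto simp: pos_divide_le_eq)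
      ultimately show ?thesis by simp
    qed
    have nn: "0 \<le> m q" if "q \<in> Z" for q using frostman_weightD(2)[OF fr that] .
    have "cw / 12 powr t * b \<le> (\<Sum>q\<in>Z. m q) * b"
      using mZ b by (intro mult_right_mono) (auto simp: pos_divide_le_eq mult.commute)
    also have "\<dots> \<le> (\<Sum>q\<in>Z. m q * measure lborel {x \<in> E. 0 \<le> plane_height u q x \<and> plane_height u q x < \<delta>})"
      unfolding sum_distrib_right by (intro sum_mono mult_left_mono low nn)
    also have "\<dots> \<le> C * real (Suc k) * (1 / 2 ^ k) * measure lborel E powr \<gamma>"
      unfolding \<delta>_def \<gamma>_def by (rule C(2)[OF fr _ E ER]) (use Z W in auto)
    also have "\<dots> \<le> C * real (Suc k) * (1 / 2 ^ k) * (real (card I) * (V * (2 * \<delta>) ^ DIM('a))) powr \<gamma>"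
      using C(1) \<gamma> by (intro mult_left_mono powr_mono2 mE) auto
    finally show "cw / 12 powr t * (cs / (12 / 2 ^ k) powr s * (unit_ball_vol (real DIM('a)) * (1 / 2 ^ k / (4 * (1 + R))) ^ DIM('a)))
      \<le> C * real (Suc k) * (1 / 2 ^ k)
        * (real (card I) * (unit_ball_vol (real DIM('a)) * (2 / 2 ^ k) ^ DIM('a))) powr ((real DIM('a) - 1) / (2 * real DIM('a) - t - 1))"
      by (simp add: b_def r'_def V_def \<gamma>_def \<delta>_def)
  qed
qed

lemma linear_times_geometric_eventually_less:
  fixes q :: real
  assumes "0 \<le> q" "q < 1" "0 < c"
  obtains k0 where "\<And>k. k0 \<le> k \<Longrightarrow> B * (real (Suc k) * q ^ k) < c"
proof -
  have l1: "(\<lambda>k. real k * q ^ k) \<longlonglongrightarrow> 0" using assms by (intro powser_times_n_limit_0) auto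
  have l2: "(\<lambda>k. q ^ k) \<longlonglongrightarrow> 0" using assms by (intro LIMSEQ_realpow_zero) auto
  have "(\<lambda>k. B * (real k * q ^ k + q ^ k)) \<longlonglongrightarrow> B * (0 + 0)"
    by (rule tendsto_mult[OF tendsto_const tendsto_add[OF l1 l2]])
  then have "\<forall>\<^sub>F k in sequentially. B * (real k * q ^ k + q ^ k) < c"
    by (rule order_tendstoD) (use assms in simp)
  then obtain k0 where k0: "\<And>k. k0 \<le> k \<Longrightarrow> B * (real k * q ^ k + q ^ k) < c"
    by (auto simp: eventually_sequentially)
  have "real (Suc k) * q ^ k = real k * q ^ k + q ^ k" for k by (simp add: algebra_simps)
  then show thesis using k0 by (intro that[of k0]) (simp only:)
qed

text \<open>If the sum were small, there would be at most about \<open>2 powr (k * a)\<close> pieces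
  of size \<open>1 / 2 ^ k\<close> for each \<open>k\<close>. Pigeonholing over the scales within
  every slice, and then over the planes, singles out one \<open>k\<close> for
  \<open>scale_inequality\<close>. Its two sides are then of the orders
  \<open>\<delta> powr (2 * \<eta> - s + D)\<close> and
  \<open>Suc k * \<delta> powr (1 + (D - a) * \<gamma>)\<close>, which is contradictory for large
  \<open>k\<close>.\<close>

lemma furstenberg_hyperplanes_cover_bound:
  fixes u :: "'a::euclidean_space"
  assumes u: "norm u = 1" and d: "2 \<le> DIM('a)" and R: "1 \<le> R" and t: "1 \<le> t" "t \<le> real DIM('a)"
    and s: "0 < s" and W: "W \<subseteq> cball 0 R" and c: "0 < c" "ennreal c \<le> hausdorff_content t W"
    and c1: "0 < c1" "\<And>w. w \<in> W \<Longrightarrow> ennreal c1 \<le> hausdorff_content s (K \<inter> {x. plane_height u w x = 0} \<inter> cball 0 R)"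
    and a: "0 < a" "a < real DIM('a) - (real DIM('a) - 1 - s) * (2 * real DIM('a) - t - 1) / (real DIM('a) - 1)"
  obtains \<epsilon> where "0 < \<epsilon>"
    "\<And>U \<rho>. diameter_cover K U \<rho> \<Longrightarrow> (\<And>i. 0 < \<rho> i) \<Longrightarrow> ennreal \<epsilon> < (\<Sum>i. ennreal (\<rho> i powr a))"
proof -
  define D where "D = real DIM('a)"
  have D: "2 \<le> D" "t \<le> D" using d t by (auto simp: D_def)
  define \<gamma> where "\<gamma> = (D - 1) / (2 * D - t - 1)"
  have \<gamma>: "0 < \<gamma>" using D by (simp add: \<gamma>_def)
  \<comment> \<open>The gain in the exponent of the scale; it is positive exactly because
    \<open>a\<close> lies below the threshold.\<close>
  define e where "e = \<gamma> * (D - a) - (D - 1 - s)"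
  have e: "0 < e"
  proof -
    have "(D - 1 - s) * (2 * D - t - 1) / (D - 1) < D - a" using a(2) by (simp add: D_def)
    then have "\<gamma> * ((D - 1 - s) * (2 * D - t - 1) / (D - 1)) < \<gamma> * (D - a)"
      using \<gamma> by (rule mult_strict_left_mono)
    moreover have "\<gamma> * ((D - 1 - s) * (2 * D - t - 1) / (D - 1)) = D - 1 - s"
      using D by (simp add: \<gamma>_def)
    ultimately show ?thesis by (simp add: e_def)
  qed
  \<comment> \<open>The two uses of the pigeonhole cost \<open>\<delta> powr (2 * \<eta>)\<close>,
    half of the gain. The other half absorbs the factor \<open>Suc k\<close>.\<close>
  define \<eta> where "\<eta> = e / 4"
  have \<eta>: "0 < \<eta>" using e by (simp add: \<eta>_def)
  define q :: real where "q = 2 powr (- \<eta>)"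
  have q: "0 < q" "q < 1" using \<eta> by (auto simp: q_def intro: powr_less_one)
  obtain C where C: "0 \<le> C"
    "\<And>k W K (I :: nat set) U cw cs. finite I \<Longrightarrow> W \<subseteq> cball 0 R \<Longrightarrow> 0 \<le> cs \<Longrightarrow>
      (\<And>i x y. i \<in> I \<Longrightarrow> x \<in> U i \<Longrightarrow> y \<in> U i \<Longrightarrow> dist x y \<le> 1 / 2 ^ k) \<Longrightarrow>
      ennreal cw \<le> hausdorff_content t W \<Longrightarrow>
      (\<And>w. w \<in> W \<Longrightarrow> ennreal cs \<le> hausdorff_content s (K \<inter> {x. plane_height u w x = 0} \<inter> cball 0 R \<inter> (\<Union>i\<in>I. U i))) \<Longrightarrow>
      cw / 12 powr t * (cs / (12 / 2 ^ k) powr s * (unit_ball_vol D * (1 / 2 ^ k / (4 * (1 + R))) ^ DIM('a)))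
      \<le> C * real (Suc k) * (1 / 2 ^ k) * (real (card I) * (unit_ball_vol D * (2 / 2 ^ k) ^ DIM('a))) powr \<gamma>"
    using scale_inequality[OF u d R t s, where 'i = nat] unfolding D_def \<gamma>_def by blast
  define V where "V = unit_ball_vol D"
  have V: "0 < V" by (simp add: V_def D_def)
  define B1 where "B1 = c * (1 - q) / 2 / 12 powr t * (c1 * (1 - q) / 2 / 12 powr s * (V / (4 * (1 + R)) powr D))"
  have B1: "0 < B1" using c c1 q V R by (simp add: B1_def)
  define B2 where "B2 = C * (2 powr a * (V * 2 powr D)) powr \<gamma>"
  define p :: real where "p = 2 powr (- (e / 2))"
  have p: "0 < p" "p < 1" using e by (auto simp: p_def intro: powr_less_one)
  obtain k0 where k0: "\<And>k. k0 \<le> k \<Longrightarrow> B2 * (real (Suc k) * p ^ k) < B1"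
    using linear_times_geometric_eventually_less[of p B1 B2] p B1 by auto
  \<comment> \<open>A single piece larger than \<open>1 / 2 ^ k0\<close> would already contribute
    more than this to the sum.\<close>
  define \<epsilon> :: real where "\<epsilon> = (1 / 2 ^ k0) powr a"
  have \<epsilon>: "0 < \<epsilon>" "\<epsilon> \<le> 1" using a(1) by (auto simp: \<epsilon>_def intro: powr_le1)
  show thesis
  proof
    show "0 < \<epsilon>" by fact
    fix U \<rho> assume cov: "diameter_cover K U \<rho>" and \<rho>: "\<And>i. 0 < \<rho> i"
    show "ennreal \<epsilon> < (\<Sum>i. ennreal (\<rho> i powr a))"
    proof (rule ccontr)
      assume "\<not> ?thesis"
      then have le: "(\<Sum>i. ennreal (\<rho> i powr a)) \<le> ennreal \<epsilon>" by simp
      have fin_le: "(\<Sum>i\<in>I. \<rho> i powr a) \<le> \<epsilon>" if "finite I" for I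
      proof -
        have "ennreal (\<Sum>i\<in>I. \<rho> i powr a) = (\<Sum>i\<in>I. ennreal (\<rho> i powr a))" by (simp add: sum_ennreal)
        also have "\<dots> \<le> (\<Sum>i. ennreal (\<rho> i powr a))" by (rule sum_le_suminf) (use that in auto)
        also note le
        finally show ?thesis using \<epsilon> by (subst (asm) ennreal_le_iff) auto
      qed
      have \<rho>_le: "\<rho> i \<le> 1 / 2 ^ k0" for i
      proof (rule ccontr)
        assume "\<not> \<rho> i \<le> 1 / 2 ^ k0"
        then have "\<epsilon> < \<rho> i powr a" unfolding \<epsilon>_def using a(1) by (intro powr_less_mono2) auto
        then show False using fin_le[of "{i}"] by simp
      qed
      \<comment> \<open>Dyadic classes of the pieces; positivity of \<open>\<rho> i\<close> ensures
        that every piece belongs to a class.\<close>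
      define I where "I k = {i. 1 / 2 ^ Suc k < \<rho> i \<and> \<rho> i \<le> 1 / 2 ^ k}" for k
      have I_ex: "\<exists>k. i \<in> I k" for i
      proof -
        obtain n where "(1 / 2 :: real) ^ n < \<rho> i" using real_arch_pow_inv[OF \<rho>, of "1 / 2"] by auto
        then have ex: "1 / 2 ^ n < \<rho> i" by (simp add: power_divide)
        define j where "j = (LEAST n. 1 / 2 ^ n < \<rho> i)"
        have j: "1 / 2 ^ j < \<rho> i" unfolding j_def using ex by (rule LeastI)
        have "(1::real) / 2 ^ k0 \<le> 1" by simp
        then have "\<rho> i \<le> 1" using \<rho>_le[of i] by linarith
        then have "j \<noteq> 0" using j by (intro notI) simp
        then obtain k where k: "j = Suc k" by (cases j) auto
        then have "\<not> 1 / 2 ^ k < \<rho> i" using not_less_Least[of k "\<lambda>n. 1 / 2 ^ n < \<rho> i"] by (simp add: j_def)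
        then show ?thesis using j k by (auto simp: I_def)
      qed
      have card_le: "finite (I k) \<and> real (card (I k)) \<le> 2 powr a * 2 powr (real k * a)" for k
      proof -
        define N where "N = 2 powr a * 2 powr (real k * a)"
        have cl: "real (card F) \<le> N" if F: "finite F" "F \<subseteq> I k" for F
        proof -
          have "real (card F) * (1 / 2 ^ Suc k) powr a = (\<Sum>i\<in>F. (1 / 2 ^ Suc k) powr a)" by simp
          also have "\<dots> \<le> (\<Sum>i\<in>F. \<rho> i powr a)"
            using F(2) a(1) by (intro sum_mono powr_mono2) (auto simp: I_def)
          also have "\<dots> \<le> 1" using fin_le[OF F(1)] \<epsilon> by simp
          finally have "real (card F) * (1 / 2 ^ Suc k) powr a \<le> 1" .
          moreover have "(1 / 2 ^ Suc k) powr a = 1 / N"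
          proof -
            have "(1 / 2 ^ Suc k :: real) = 2 powr (- real (Suc k))" by (simp add: powr_minus_divide powr_realpow del: power_Suc of_nat_Suc)
            then have "(1 / 2 ^ Suc k :: real) powr a = 2 powr (- (a + real k * a))" by (simp add: powr_powr algebra_simps)
            then show ?thesis unfolding N_def by (simp only: powr_add powr_minus_divide)
          qed
          ultimately show ?thesis by (simp add: N_def pos_divide_le_eq)
        qed
        have "finite (I k)"
        proof (rule ccontr)
          assume "infinite (I k)"
          then obtain F where "F \<subseteq> I k" "finite F" "card F = nat \<lceil>N\<rceil> + 1" using infinite_arbitrarily_large by metis
          then show False using cl[of F] by linarith
        qed
        then show ?thesis using cl[of "I k"] by (simp add: N_def)
      qed
      define S where "S k = (\<Union>i\<in>I k. U i)" for k
      define cs where "cs k = c1 * (1 - q) / 2 * q ^ k" for k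
      \<comment> \<open>The rich scale depends on the plane. The sets \<open>Wk k\<close> may
        overlap and be arbitrary; subadditivity of content is enough to find one of them that is
        still large.\<close>
      define Wk where "Wk k = {w \<in> W. ennreal (cs k) \<le> hausdorff_content s (K \<inter> {x. plane_height u w x = 0} \<inter> cball 0 R \<inter> S k)}" for k
      have "W \<subseteq> (\<Union>k. Wk k)"
      proof
        fix w assume w: "w \<in> W"
        define Y where "Y = K \<inter> {x. plane_height u w x = 0} \<inter> cball 0 R"
        have "Y \<subseteq> (\<Union>k. Y \<inter> S k)"
        proof
          fix x assume x: "x \<in> Y"
          then obtain i where i: "x \<in> U i" using cov by (auto simp: diameter_cover_def Y_def)
          obtain k where "i \<in> I k" using I_ex by blast
          then have "x \<in> S k" using i unfolding S_def by blast
          then show "x \<in> (\<Union>k. Y \<inter> S k)" using x by blast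
        qed
        then have "hausdorff_content s Y \<le> hausdorff_content s (\<Union>k. Y \<inter> S k)" by (rule hausdorff_content_mono)
        then have "ennreal c1 \<le> hausdorff_content s (\<Union>k. Y \<inter> S k)"
          using c1(2)[OF w] by (simp add: Y_def)
        then obtain k where "ennreal (cs k) \<le> hausdorff_content s (Y \<inter> S k)"
          unfolding cs_def by (rule hausdorff_content_pigeonhole[OF _ c1(1) q])
        then show "w \<in> (\<Union>k. Wk k)" using w by (auto simp: Wk_def Y_def)
      qed
      then have "hausdorff_content t W \<le> hausdorff_content t (\<Union>k. Wk k)" by (rule hausdorff_content_mono)
      with c(2) have "ennreal c \<le> hausdorff_content t (\<Union>k. Wk k)" by (rule order_trans)
      then obtain k where k: "ennreal (c * (1 - q) / 2 * q ^ k) \<le> hausdorff_content t (Wk k)"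
        by (rule hausdorff_content_pigeonhole[OF _ c(1) q])
      have cs0: "0 < cs k" using c1 q by (simp add: cs_def)
      have cw0: "0 < c * (1 - q) / 2 * q ^ k" using c q by simp
      have content_empty: "hausdorff_content r ({} :: 'a set) = 0" for r
      proof -
        have "hausdorff_content r ({} :: 'a set) \<le> (\<Sum>i. ennreal (0 powr r))"
          by (rule hausdorff_content_le[of _ "\<lambda>_. {}"]) (simp add: diameter_cover_def)
        then show ?thesis by simp
      qed
      \<comment> \<open>The pigeonhole gives no control over \<open>k\<close>. But positive content
        makes the class \<open>I k\<close> nonempty, and since all pieces have size at most
        \<open>1 / 2 ^ k0\<close>, this forces \<open>k0 \<le> k\<close>.\<close>
      have "Wk k \<noteq> {}"
      proof
        assume "Wk k = {}"
        then show False using k c(1) q by (auto simp: content_empty)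
      qed
      then obtain w where "w \<in> Wk k" by blast
      then have "S k \<noteq> {}" using cs0 content_empty by (auto simp: Wk_def)
      then obtain i where "i \<in> I k" by (auto simp: S_def)
      then have "(1::real) / 2 ^ Suc k < 1 / 2 ^ k0" using \<rho>_le[of i] by (simp add: I_def)
      then have "(2::real) ^ k0 < 2 ^ Suc k" by (simp add: field_simps)
      then have k0k: "k0 \<le> k" using power_less_imp_less_exp[of "2::real" k0 "Suc k"] by simp
      define \<delta> :: real where "\<delta> = 1 / 2 ^ k"
      have \<delta>: "0 < \<delta>" by (simp add: \<delta>_def)
      have \<delta>_powr: "2 powr (real k * x) = \<delta> powr (- x)" for x
      proof -
        have "\<delta> = 2 powr (- real k)" by (simp add: \<delta>_def powr_minus_divide powr_realpow)
        then show ?thesis by (simp add: powr_powr)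
      qed
      have qk: "q ^ k = \<delta> powr \<eta>"
        using \<delta>_powr[of "- \<eta>"] by (simp add: q_def powr_power mult.commute)
      have pk: "p ^ k = \<delta> powr (e / 2)"
        using \<delta>_powr[of "- (e / 2)"] by (simp add: p_def powr_power mult.commute)
      have "c * (1 - q) / 2 * q ^ k / 12 powr t * (cs k / (12 / 2 ^ k) powr s * (unit_ball_vol D * (1 / 2 ^ k / (4 * (1 + R))) ^ DIM('a)))
        \<le> C * real (Suc k) * (1 / 2 ^ k) * (real (card (I k)) * (unit_ball_vol D * (2 / 2 ^ k) ^ DIM('a))) powr \<gamma>"
      proof (rule C(2)[where U = U and K = K and W = "Wk k"])
        show "dist x y \<le> 1 / 2 ^ k" if "i \<in> I k" "x \<in> U i" "y \<in> U i" for i x y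
          using cov that unfolding diameter_cover_def I_def by (blast intro: order_trans)
      qed (use card_le W k cs0 in \<open>auto simp: Wk_def S_def\<close>)
      moreover have "c * (1 - q) / 2 * q ^ k / 12 powr t * (cs k / (12 / 2 ^ k) powr s * (unit_ball_vol D * (1 / 2 ^ k / (4 * (1 + R))) ^ DIM('a)))
        = B1 * \<delta> powr (2 * \<eta> - s + D)"
      proof -
        have h1: "(12 / 2 ^ k) powr s = 12 powr s * \<delta> powr s"
          by (simp add: \<delta>_def flip: powr_mult)
        have h2: "(1 / 2 ^ k / (4 * (1 + R))) ^ DIM('a) = \<delta> powr D / (4 * (1 + R)) powr D"
          using R \<delta> by (simp add: D_def powr_realpow power_divide flip: \<delta>_def)
        have h3: "\<delta> powr (2 * \<eta> - s + D) = \<delta> powr \<eta> * \<delta> powr \<eta> / \<delta> powr s * \<delta> powr D"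
          by (simp only: mult_2 powr_add powr_diff)
        show ?thesis unfolding cs_def h1 h2 h3 qk B1_def V_def by (simp add: mult_ac)
      qed
      moreover have "C * real (Suc k) * (1 / 2 ^ k) * (real (card (I k)) * (unit_ball_vol D * (2 / 2 ^ k) ^ DIM('a))) powr \<gamma>
        \<le> B2 * real (Suc k) * \<delta> powr (1 + (D - a) * \<gamma>)"
      proof -
        have h5: "(2 / 2 ^ k) ^ DIM('a) = 2 powr D * \<delta> powr D"
          using \<delta> by (simp add: D_def powr_realpow \<delta>_def power_divide)
        have "real (card (I k)) * (unit_ball_vol D * (2 / 2 ^ k) ^ DIM('a))
            \<le> (2 powr a * \<delta> powr (- a)) * (V * (2 / 2 ^ k) ^ DIM('a))"
          unfolding V_def using card_le[of k] \<delta>_powr[of a] by (intro mult_right_mono) (auto simp: D_def)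
        also have "\<dots> = (2 powr a * (V * 2 powr D)) * \<delta> powr (D - a)"
          unfolding h5 by (simp add: powr_diff powr_minus divide_inverse mult_ac)
        finally have "(real (card (I k)) * (unit_ball_vol D * (2 / 2 ^ k) ^ DIM('a))) powr \<gamma>
            \<le> ((2 powr a * (V * 2 powr D)) * \<delta> powr (D - a)) powr \<gamma>"
          by (rule powr_mono2[rotated 2]) (use \<gamma> in \<open>auto simp: D_def\<close>)
        also have "\<dots> = (2 powr a * (V * 2 powr D)) powr \<gamma> * \<delta> powr ((D - a) * \<gamma>)"
          using V by (simp add: powr_mult powr_powr)
        finally have "C * real (Suc k) * (1 / 2 ^ k) * (real (card (I k)) * (unit_ball_vol D * (2 / 2 ^ k) ^ DIM('a))) powr \<gamma>
            \<le> C * real (Suc k) * \<delta> * ((2 powr a * (V * 2 powr D)) powr \<gamma> * \<delta> powr ((D - a) * \<gamma>))"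
          unfolding \<delta>_def[symmetric] using C(1) \<delta> by (intro mult_left_mono) auto
        also have "\<dots> = B2 * real (Suc k) * (\<delta> powr 1 * \<delta> powr ((D - a) * \<gamma>))"
          using \<delta> by (simp add: B2_def)
        finally show ?thesis by (simp only: powr_add)
      qed
      ultimately have main: "B1 * \<delta> powr (2 * \<eta> - s + D) \<le> B2 * real (Suc k) * \<delta> powr (1 + (D - a) * \<gamma>)" by linarith
      have "1 + (D - a) * \<gamma> = (2 * \<eta> - s + D) + e / 2"
      proof -
        have "2 * \<eta> = e / 2" "e = (D - a) * \<gamma> - (D - 1 - s)" by (simp_all add: \<eta>_def e_def mult.commute)
        then show ?thesis by linarith
      qed
      then have split: "\<delta> powr (1 + (D - a) * \<gamma>) = \<delta> powr (2 * \<eta> - s + D) * \<delta> powr (e / 2)"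
        by (simp only: powr_add[of _ _ "e / 2"])
      have "B1 * \<delta> powr (2 * \<eta> - s + D) \<le> (B2 * (real (Suc k) * \<delta> powr (e / 2))) * \<delta> powr (2 * \<eta> - s + D)"
        using main unfolding split by (simp only: mult_ac)
      then have "B1 \<le> B2 * (real (Suc k) * p ^ k)"
        using \<delta> unfolding pk by (subst (asm) mult_le_cancel_right_pos) auto
      then show False using k0[OF k0k] by simp
    qed
  qed
qed


section \<open>Hausdorff measure and the graph parametrisation of hyperplanes\<close>

context Metric_space
begin

lemma mdiameter_le:
  assumes "\<And>x y. x \<in> V \<Longrightarrow> y \<in> V \<Longrightarrow> d x y \<le> B" "0 \<le> B"
  shows "mdiameter V \<le> B"
proof (cases "V = {}")
  case False
  then show ?thesis unfolding mdiameter_def using assms by (auto intro!: cSUP_least)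
qed (use assms in \<open>simp add: mdiameter_def\<close>)

lemma le_mdiameter:
  assumes "mbounded V" "x \<in> V" "y \<in> V"
  shows "d x y \<le> mdiameter V"
proof -
  obtain B where "\<forall>x\<in>V. \<forall>y\<in>V. d x y \<le> B" using assms(1) by (auto simp: mbounded_alt)
  then have "bdd_above ((\<lambda>(x, y). d x y) ` (V \<times> V))" by (intro bdd_aboveI[of _ B]) auto
  then have "(case (x, y) of (x, y) \<Rightarrow> d x y) \<le> (SUP (x, y)\<in>V \<times> V. d x y)"
    using assms by (intro cSUP_upper) auto
  then show ?thesis using assms by (auto simp: mdiameter_def)
qed

lemma mdiameter_nonneg:
  assumes "mbounded V"
  shows "0 \<le> mdiameter V"
proof (cases "V = {}")
  case False
  then obtain x where "x \<in> V" by blast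
  then show ?thesis using order_trans[OF nonneg le_mdiameter[OF assms]] by blast
qed (simp add: mdiameter_def)

lemma hausdorff_premeasure_le:
  assumes "E \<subseteq> (\<Union>i. U i)" "\<And>i. mbounded (U i)" "\<And>i. mdiameter (U i) \<le> \<delta>"
  shows "hausdorff_premeasure s \<delta> E \<le> (\<Sum>i::nat. ennreal (mdiameter (U i) powr s))"
  unfolding hausdorff_premeasure_def by (rule INF_lower) (use assms in auto)

lemma hausdorff_premeasure_lessE:
  assumes "hausdorff_premeasure s \<delta> E < c"
  obtains U :: "nat \<Rightarrow> 'a set" where "E \<subseteq> (\<Union>i. U i)" "\<And>i. mbounded (U i)" "\<And>i. mdiameter (U i) \<le> \<delta>"
    "(\<Sum>i. ennreal (mdiameter (U i) powr s)) < c"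
  using assms unfolding hausdorff_premeasure_def by (auto simp: INF_less_iff)

lemma hausdorff_measure_eq_0_iff:
  "hausdorff_measure s E = 0 \<longleftrightarrow> (\<forall>\<delta>>0. hausdorff_premeasure s \<delta> E = 0)"
  unfolding hausdorff_measure_def by (auto simp: SUP_eq_iff bot_ennreal[symmetric] SUP_bot_conv simp del: bot_ennreal)

lemma hausdorff_measure_UN_eq_0:
  assumes "\<And>k::nat. hausdorff_measure s (E k) = 0"
  shows "hausdorff_measure s (\<Union>k. E k) = 0"
  unfolding hausdorff_measure_eq_0_iff
proof (intro allI impI)
  fix \<delta> :: real assume \<delta>: "0 < \<delta>"
  have "hausdorff_premeasure s \<delta> (\<Union>k. E k) \<le> 0 + ennreal \<epsilon>" if \<epsilon>: "0 < \<epsilon>" for \<epsilon> :: real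
  proof -
    define b where "b k = \<epsilon> / 2 * (1 / 2) ^ k" for k :: nat
    have "\<exists>U. E k \<subseteq> (\<Union>i. U i) \<and> (\<forall>i. mbounded (U i) \<and> mdiameter (U i) \<le> \<delta>) \<and>
        (\<Sum>i::nat. ennreal (mdiameter (U i) powr s)) < ennreal (b k)" for k
    proof -
      have "hausdorff_premeasure s \<delta> (E k) = 0"
        using assms[of k] \<delta> unfolding hausdorff_measure_eq_0_iff by blast
      also have "0 < ennreal (b k)" using \<epsilon> by (simp add: b_def)
      finally show ?thesis by (rule hausdorff_premeasure_lessE) blast
    qed
    then obtain U where U: "\<And>k. E k \<subseteq> (\<Union>i. U k i)" "\<And>k i. mbounded (U k i) \<and> mdiameter (U k i) \<le> \<delta>"
      "\<And>k. (\<Sum>i::nat. ennreal (mdiameter (U k i) powr s)) < ennreal (b k)" by metis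
    define V where "V i = (case prod_decode i of (k, j) \<Rightarrow> U k j)" for i
    have "(\<Union>k. E k) \<subseteq> (\<Union>i. V i)"
    proof
      fix x assume "x \<in> (\<Union>k. E k)"
      then obtain k j where "x \<in> U k j" using U(1) by blast
      then have "x \<in> V (prod_encode (k, j))" by (simp add: V_def)
      then show "x \<in> (\<Union>i. V i)" by blast
    qed
    then have "hausdorff_premeasure s \<delta> (\<Union>k. E k) \<le> (\<Sum>i. ennreal (mdiameter (V i) powr s))"
      using U(2) by (intro hausdorff_premeasure_le) (auto simp: V_def split: prod.split)
    also have "\<dots> = (\<Sum>i. (\<lambda>(k, j). ennreal (mdiameter (U k j) powr s)) (prod_decode i))"
      by (simp add: V_def case_prod_unfold)
    also have "\<dots> = (\<Sum>k. \<Sum>j. ennreal (mdiameter (U k j) powr s))" by (rule suminf_ennreal_2dimen) simp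
    also have "\<dots> \<le> (\<Sum>k. ennreal (b k))" using U(3) by (intro suminf_le less_imp_le) auto
    also have "\<dots> = ennreal (\<epsilon> / 2 / (1 - 1 / 2))"
      unfolding b_def by (rule suminf_geometric_ennreal) (use \<epsilon> in auto)
    finally show ?thesis by simp
  qed
  then have "hausdorff_premeasure s \<delta> (\<Union>k. E k) \<le> 0" by (rule ennreal_le_epsilon)
  then show "hausdorff_premeasure s \<delta> (\<Union>k. E k) = 0" by simp
qed

lemma hausdorff_measure_mono_eq_0:
  assumes "E \<subseteq> F" "hausdorff_measure s F = 0"
  shows "hausdorff_measure s E = 0"
proof -
  have "hausdorff_premeasure s \<delta> E \<le> hausdorff_premeasure s \<delta> F" for \<delta>
    unfolding hausdorff_premeasure_def using assms(1) by (intro INF_superset_mono) auto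
  then show ?thesis using assms(2) unfolding hausdorff_measure_eq_0_iff by (metis le_zero_eq)
qed

text \<open>A cover whose \<open>t\<close>-sum is tiny has only tiny pieces, so zero content, which
  does not restrict diameters, controls the premeasure at every \<delta>. Applied to the identity,
  and to the parametrisation of hyperplanes.\<close>

lemma hausdorff_measure_lipschitz_image_eq_0:
  fixes \<Phi> :: "'b::metric_space \<Rightarrow> 'a"
  assumes M: "\<Phi> ` W \<subseteq> M" and L: "0 < L" "\<And>x y. x \<in> W \<Longrightarrow> y \<in> W \<Longrightarrow> d (\<Phi> x) (\<Phi> y) \<le> L * dist x y"
    and t: "0 < t" and W: "hausdorff_content t W = 0"
  shows "hausdorff_measure t (\<Phi> ` W) = 0"
  unfolding hausdorff_measure_eq_0_iff
proof (intro allI impI)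
  fix \<delta> :: real assume \<delta>: "0 < \<delta>"
  have "hausdorff_premeasure t \<delta> (\<Phi> ` W) \<le> 0 + ennreal \<epsilon>" if \<epsilon>: "0 < \<epsilon>" for \<epsilon> :: real
  proof -
    \<comment> \<open>The first term forces \<open>L * \<rho> i \<le> \<delta>\<close> for every
      piece, the second makes the sum for the image at most \<epsilon>.\<close>
    define \<eta> where "\<eta> = min ((\<delta> / L) powr t) (\<epsilon> / L powr t)"
    have "0 < \<eta>" using \<delta> L \<epsilon> by (simp add: \<eta>_def)
    then have "hausdorff_content t W < ennreal \<eta>" using W by simp
    then obtain U \<rho> where U: "diameter_cover W U \<rho>" and sum: "(\<Sum>i. ennreal (\<rho> i powr t)) < ennreal \<eta>"
      by (rule hausdorff_content_lessE)
    have \<rho>: "0 \<le> \<rho> i" "\<And>x y. x \<in> U i \<Longrightarrow> y \<in> U i \<Longrightarrow> dist x y \<le> \<rho> i" for i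
      using U by (auto simp: diameter_cover_def)
    have \<rho>_le: "L * \<rho> i \<le> \<delta>" for i
    proof -
      have "(\<Sum>j\<in>{i}. ennreal (\<rho> j powr t)) \<le> (\<Sum>j. ennreal (\<rho> j powr t))" by (rule sum_le_suminf) auto
      then have "ennreal (\<rho> i powr t) < ennreal \<eta>" using sum by simp
      then have "\<rho> i powr t < (\<delta> / L) powr t" by (simp add: ennreal_less_iff \<eta>_def)
      then have "\<rho> i \<le> \<delta> / L" using powr_mono2[of t "\<delta> / L" "\<rho> i"] t \<delta> L by fastforce
      then show ?thesis using L by (simp add: pos_le_divide_eq mult.commute)
    qed
    define V where "V i = \<Phi> ` (U i \<inter> W)" for i
    have dV: "d x y \<le> L * \<rho> i" if xy: "x \<in> V i" "y \<in> V i" for i x y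
    proof -
      obtain a b where ab: "a \<in> U i \<inter> W" "b \<in> U i \<inter> W" "x = \<Phi> a" "y = \<Phi> b"
        using xy by (auto simp: V_def)
      then have "d x y \<le> L * dist a b" using L(2) by auto
      also have "\<dots> \<le> L * \<rho> i" using \<rho>(2) ab L(1) by (intro mult_left_mono) auto
      finally show ?thesis .
    qed
    have bV: "mbounded (V i)" for i
      unfolding mbounded_alt
    proof
      show "V i \<subseteq> M" using M by (auto simp: V_def)
      show "\<exists>B. \<forall>x\<in>V i. \<forall>y\<in>V i. d x y \<le> B" using dV by blast
    qed
    have mV: "mdiameter (V i) \<le> L * \<rho> i" for i using dV \<rho>(1) L by (intro mdiameter_le) auto
    have "hausdorff_premeasure t \<delta> (\<Phi> ` W) \<le> (\<Sum>i. ennreal (mdiameter (V i) powr t))"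
    proof (rule hausdorff_premeasure_le[OF _ bV])
      show "\<Phi> ` W \<subseteq> (\<Union>i. V i)" using U unfolding V_def diameter_cover_def by blast
      show "mdiameter (V i) \<le> \<delta>" for i using mV \<rho>_le by (rule order_trans)
    qed
    also have "\<dots> \<le> (\<Sum>i. ennreal (L powr t) * ennreal (\<rho> i powr t))"
    proof (rule suminf_le)
      fix i
      have "mdiameter (V i) powr t \<le> (L * \<rho> i) powr t"
        using mV mdiameter_nonneg[OF bV] t by (intro powr_mono2) auto
      then show "ennreal (mdiameter (V i) powr t) \<le> ennreal (L powr t) * ennreal (\<rho> i powr t)"
        using L(1) \<rho>(1) by (simp add: powr_mult flip: ennreal_mult)
    qed auto
    also have "\<dots> = ennreal (L powr t) * (\<Sum>i. ennreal (\<rho> i powr t))" by simp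
    also have "\<dots> \<le> ennreal (L powr t) * ennreal \<eta>" using sum by (intro mult_left_mono) auto
    also have "\<dots> = ennreal (L powr t * \<eta>)" using \<open>0 < \<eta>\<close> by (simp add: ennreal_mult)
    also have "\<dots> \<le> ennreal \<epsilon>"
    proof (rule ennreal_leI)
      have "L powr t * \<eta> \<le> L powr t * (\<epsilon> / L powr t)" by (intro mult_left_mono) (auto simp: \<eta>_def)
      then show "L powr t * \<eta> \<le> \<epsilon>" using L by simp
    qed
    finally show ?thesis by simp
  qed
  then have "hausdorff_premeasure t \<delta> (\<Phi> ` W) \<le> 0" by (rule ennreal_le_epsilon)
  then show "hausdorff_premeasure t \<delta> (\<Phi> ` W) = 0" by simp
qed

lemma hausdorff_measure_ne_0:
  assumes "ereal s \<le> hausdorff_dim E" "0 < r" "r < s"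
  shows "hausdorff_measure r E \<noteq> 0"
proof
  assume "hausdorff_measure r E = 0"
  then have "hausdorff_dim E \<le> ereal r" unfolding hausdorff_dim_def using assms(2) by (intro Inf_lower) auto
  with assms(1) have "ereal s \<le> ereal r" by (rule order_trans)
  then show False using assms(3) by simp
qed

lemma hausdorff_dim_lessE:
  assumes "hausdorff_dim E < ereal s"
  obtains r where "0 < r" "r < s" "hausdorff_measure r E = 0"
  using assms unfolding hausdorff_dim_def Inf_less_iff by auto

end

text \<open>Sorting pieces into dyadic classes requires positive sizes, but diameters may be zero.
  Each is raised so that its \<open>a\<close>-th power grows by \<open>b i\<close>, and the
  \<open>b i\<close> sum to \<open>\<epsilon> / 2\<close>.\<close>

lemma hausdorff_measure_eq_0_cover:
  fixes K :: "'a::metric_space set"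
  assumes K: "Met_TC.hausdorff_measure a K = 0" and a: "0 < a" and \<epsilon>: "0 < \<epsilon>"
  obtains U \<rho> where "diameter_cover K U \<rho>" "\<forall>i. 0 < \<rho> i" "(\<Sum>i. ennreal (\<rho> i powr a)) \<le> ennreal \<epsilon>"
proof -
  have "Met_TC.hausdorff_premeasure a 1 K = 0" using K unfolding Met_TC.hausdorff_measure_eq_0_iff by simp
  also have "0 < ennreal (\<epsilon> / 2)" using \<epsilon> by simp
  finally obtain U :: "nat \<Rightarrow> 'a set" where U: "K \<subseteq> (\<Union>i. U i)" "\<And>i. Met_TC.mbounded (U i)"
    "(\<Sum>i. ennreal (Met_TC.mdiameter (U i) powr a)) < ennreal (\<epsilon> / 2)"
    by (rule Met_TC.hausdorff_premeasure_lessE) blast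
  define D where "D i = Met_TC.mdiameter (U i)" for i
  have D: "0 \<le> D i" for i unfolding D_def by (rule Met_TC.mdiameter_nonneg[OF U(2)])
  define b where "b i = \<epsilon> / 4 * (1 / 2) ^ i" for i :: nat
  have b: "0 < b i" for i using \<epsilon> by (simp add: b_def)
  define \<rho> where "\<rho> i = (D i powr a + b i) powr (1 / a)" for i
  have pos: "0 < D i powr a + b i" for i using b[of i] by (intro add_nonneg_pos) auto
  have \<rho>a: "\<rho> i powr a = D i powr a + b i" for i
    using pos[of i] a by (simp add: \<rho>_def powr_powr)
  have D\<rho>: "D i \<le> \<rho> i" for i
  proof -
    have "D i = (D i powr a) powr (1 / a)" using D[of i] a by (simp add: powr_powr)
    also have "\<dots> \<le> \<rho> i" unfolding \<rho>_def using a b[of i] by (intro powr_mono2) auto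
    finally show ?thesis .
  qed
  have \<rho>0: "0 < \<rho> i" for i using pos[of i] by (simp add: \<rho>_def)
  show thesis
  proof
    show "\<forall>i. 0 < \<rho> i" using \<rho>0 by blast
    show "diameter_cover K U \<rho>"
      unfolding diameter_cover_def
    proof (intro conjI allI ballI)
      fix i x y assume "x \<in> U i" "y \<in> U i"
      then have "dist x y \<le> D i" unfolding D_def by (rule Met_TC.le_mdiameter[OF U(2)])
      then show "dist x y \<le> \<rho> i" using D\<rho> by (rule order_trans)
    qed (use U(1) \<rho>0 in \<open>auto intro: less_imp_le\<close>)
    have "(\<Sum>i. ennreal (\<rho> i powr a)) = (\<Sum>i. ennreal (D i powr a) + ennreal (b i))"
      using b by (simp add: \<rho>a ennreal_plus less_imp_le)
    also have "\<dots> = (\<Sum>i. ennreal (D i powr a)) + (\<Sum>i. ennreal (b i))"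
      by (rule suminf_add[symmetric]) auto
    also have "(\<Sum>i. ennreal (b i)) = ennreal (\<epsilon> / 4 / (1 - 1 / 2))"
      unfolding b_def by (rule suminf_geometric_ennreal) (use \<epsilon> in auto)
    also have "\<epsilon> / 4 / (1 - 1 / 2) = \<epsilon> / 2" by simp
    also have "(\<Sum>i. ennreal (D i powr a)) + ennreal (\<epsilon> / 2) \<le> ennreal (\<epsilon> / 2) + ennreal (\<epsilon> / 2)"
      using U(3) by (intro add_right_mono) (simp add: D_def)
    also have "\<dots> = ennreal \<epsilon>" using \<epsilon> by (simp flip: ennreal_plus)
    finally show "(\<Sum>i. ennreal (\<rho> i powr a)) \<le> ennreal \<epsilon>" .
  qed
qed

section \<open>Finitely many Lipschitz charts for the space of hyperplanes\<close>

definition graph_plane :: "'a::euclidean_space \<Rightarrow> 'a \<Rightarrow> 'a set" where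
  "graph_plane u w = {x. plane_height u w x = 0}"

lemma graph_plane_hyperplane: "graph_plane u w = {x. plane_normal u w \<bullet> x = w \<bullet> u}"
  by (simp add: graph_plane_def plane_height_def)

lemma norm_plane_normal_ge_1:
  assumes "norm u = 1"
  shows "1 \<le> norm (plane_normal u w)"
  using Cauchy_Schwarz_ineq2[of "plane_normal u w" u] plane_normal_inner_self[OF assms, of w] assms by simp

lemma graph_plane_affine_plane:
  fixes u :: "'a::euclidean_space"
  assumes "norm u = 1"
  shows "graph_plane u w \<in> affine_planes (DIM('a) - 1)"
proof -
  have "plane_normal u w \<noteq> 0" using norm_plane_normal_ge_1[OF assms, of w] by auto
  then show ?thesis
    unfolding affine_planes_def graph_plane_hyperplane
    by (simp add: affine_hyperplane aff_dim_hyperplane of_nat_diff)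
qed

text \<open>Some coordinate of a normal vector is nonzero and can be scaled to 1. Hence the charts
  belonging to the basis vectors cover all hyperplanes.\<close>

lemma affine_plane_is_graph_plane:
  fixes V :: "'a::euclidean_space set"
  assumes "V \<in> affine_planes (DIM('a) - 1)"
  obtains u w where "u \<in> Basis" "V = graph_plane u w"
proof -
  have V: "affine V" "aff_dim V = int DIM('a) - 1"
    using assms DIM_positive[where 'a = 'a] by (auto simp: affine_planes_def)
  obtain a b where a: "a \<noteq> 0" "affine hull V = {x. a \<bullet> x = b}"
    using V(2) aff_dim_eq_hyperplane[of V] by auto
  have V_eq: "V = {x. a \<bullet> x = b}" using V(1) a(2) affine_hull_eq[of V] by metis
  obtain u where u: "u \<in> Basis" "a \<bullet> u \<noteq> 0" using a(1) euclidean_all_zero_iff[of a] by blast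
  \<comment> \<open>The part \<open>u - a'\<close> of \<open>w\<close> is orthogonal to
    \<open>u\<close> and gives the slope; the component along \<open>u\<close> is the
    intercept.\<close>
  define a' w where "a' = a /\<^sub>R (a \<bullet> u)" and "w = u - a' + (b / (a \<bullet> u)) *\<^sub>R u"
  have uu: "u \<bullet> u = 1" using u(1) by simp
  have a'u: "a' \<bullet> u = 1" using u(2) by (simp add: a'_def)
  have wu: "w \<bullet> u = b / (a \<bullet> u)" by (simp add: w_def inner_add_left inner_diff_left uu a'u)
  have "plane_normal u w = a'" unfolding plane_normal_def wu by (simp add: w_def)
  then have "graph_plane u w = {x. a' \<bullet> x = b / (a \<bullet> u)}" by (simp add: graph_plane_hyperplane wu)
  also have "\<dots> = V" unfolding V_eq using u(2) by (auto simp: a'_def field_simps)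
  finally show thesis using that u(1) by blast
qed

text \<open>Makes the ingredients of \<open>plane_dist\<close> explicit: the projection removes the
  component along the unit normal \<open>e\<close>, and the offset is the foot of the perpendicular
  from the origin.\<close>

lemma graph_plane_direction_offset:
  fixes u w :: "'a::euclidean_space"
  assumes u: "norm u = 1"
  defines "e \<equiv> plane_normal u w /\<^sub>R norm (plane_normal u w)"
  shows "orth_proj (plane_direction (graph_plane u w)) x = x - (e \<bullet> x) *\<^sub>R e"
    and "plane_offset (graph_plane u w) = (w \<bullet> u / norm (plane_normal u w)) *\<^sub>R e"
proof -
  define n where "n = plane_normal u w"
  define H where "H = graph_plane u w"
  define D where "D = plane_direction H"
  define p where "p = plane_offset H"
  have n1: "1 \<le> norm n" unfolding n_def by (rule norm_plane_normal_ge_1[OF u])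
  have e_eq: "e = n /\<^sub>R norm n" by (simp add: e_def n_def)
  have n0: "n \<noteq> 0" using n1 by auto
  then have "norm e = 1" by (simp add: e_eq)
  then have ee: "e \<bullet> e = 1" by (simp add: dot_square_norm)
  have ne: "n = norm n *\<^sub>R e" using n0 by (simp add: e_eq)
  have Hp: "H \<in> affine_planes (DIM('a) - 1)" unfolding H_def by (rule graph_plane_affine_plane[OF u])
  have H: "x \<in> H \<longleftrightarrow> n \<bullet> x = w \<bullet> u" for x by (simp add: H_def n_def graph_plane_hyperplane)
  have sub: "subspace D" unfolding D_def by (rule plane_direction(1)[OF Hp])
  have p: "p \<in> D\<^sup>\<bottom>" "H = (\<lambda>x. p + x) ` D" using plane_offset[OF Hp] by (auto simp: p_def D_def)
  have pH: "n \<bullet> p = w \<bullet> u"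
  proof -
    have "p + 0 \<in> H" unfolding p(2) using subspace_0[OF sub] by blast
    then show ?thesis by (simp add: H)
  qed
  have D: "x \<in> D \<longleftrightarrow> n \<bullet> x = 0" for x
  proof -
    have "x \<in> D \<longleftrightarrow> p + x \<in> H" unfolding p(2) by auto
    also have "\<dots> \<longleftrightarrow> n \<bullet> x = 0" using pH by (auto simp: H inner_add_right)
    finally show ?thesis .
  qed
  have De: "x \<in> D \<longleftrightarrow> e \<bullet> x = 0" for x using n1 by (auto simp: D e_eq)
  have spD: "span D = D" using sub by (simp add: span_eq_iff)
  have "orth_proj D x = x - (e \<bullet> x) *\<^sub>R e"
  proof (rule orth_proj_unique; unfold spD)
    show "x - (e \<bullet> x) *\<^sub>R e \<in> D" by (simp add: De inner_diff_right ee)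
    show "x - (x - (e \<bullet> x) *\<^sub>R e) \<in> D\<^sup>\<bottom>"
      by (auto simp: orthogonal_comp_def orthogonal_def De inner_commute)
  qed
  then show "orth_proj (plane_direction (graph_plane u w)) x = x - (e \<bullet> x) *\<^sub>R e"
    by (simp only: D_def H_def)
  define y where "y = p - (w \<bullet> u / norm n) *\<^sub>R e"
  have "n \<bullet> y = 0"
    using n0 unfolding y_def inner_diff_right pH by (subst ne) (simp add: ee)
  then have yD: "y \<in> D" by (simp add: D)
  have "y \<bullet> p = 0" using p(1) yD by (auto simp: orthogonal_comp_def orthogonal_def inner_commute)
  moreover have "y \<bullet> e = 0" using yD by (simp add: De inner_commute)
  ultimately have "y \<bullet> y = 0" by (subst (2) y_def) (simp add: inner_diff_right)
  then show "plane_offset (graph_plane u w) = (w \<bullet> u / norm (plane_normal u w)) *\<^sub>R e"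
    by (simp add: y_def p_def H_def n_def)
qed

lemma norm_normalize_diff_le:
  fixes a b :: "'a::real_normed_vector"
  assumes "1 \<le> norm a" "1 \<le> norm b"
  shows "norm (a /\<^sub>R norm a - b /\<^sub>R norm b) \<le> 2 * norm (a - b)"
proof -
  have ab0: "a \<noteq> 0" "b \<noteq> 0" using assms by auto
  have "norm (a /\<^sub>R norm a - b /\<^sub>R norm b) = norm ((a - b) /\<^sub>R norm a + (1 / norm a - 1 / norm b) *\<^sub>R b)"
    by (simp add: algebra_simps divide_inverse)
  also have "\<dots> \<le> norm (a - b) / norm a + \<bar>1 / norm a - 1 / norm b\<bar> * norm b"
    by (rule order_trans[OF norm_triangle_ineq]) (simp add: divide_inverse mult.commute)
  also have "\<bar>1 / norm a - 1 / norm b\<bar> * norm b = \<bar>norm b - norm a\<bar> / norm a"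
  proof -
    have "\<bar>1 / norm a - 1 / norm b\<bar> * norm b = \<bar>(1 / norm a - 1 / norm b) * norm b\<bar>" by (simp add: abs_mult)
    also have "(1 / norm a - 1 / norm b) * norm b = (norm b - norm a) / norm a"
      using ab0 by (simp add: field_simps)
    also have "\<bar>(norm b - norm a) / norm a\<bar> = \<bar>norm b - norm a\<bar> / norm a" by simp
    finally show ?thesis .
  qed
  also have "norm (a - b) / norm a + \<bar>norm b - norm a\<bar> / norm a \<le> norm (a - b) / 1 + norm (a - b) / 1"
    using assms norm_triangle_ineq3[of b a]
    by (intro add_mono frac_le) (auto simp: norm_minus_commute)
  finally show ?thesis by simp
qed

text \<open>The direction that carries null sets of parameters to null families of planes. The
  factor 4 comes from the projections and \<open>1 + 3 * R\<close> from the offsets; normalising is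
  Lipschitz here because the normals have length at least 1.\<close>

lemma plane_dist_graph_plane_le:
  fixes u v w :: "'a::euclidean_space"
  assumes u: "norm u = 1" and vw: "norm v \<le> R" "norm w \<le> R"
  shows "plane_dist (graph_plane u v) (graph_plane u w) \<le> (5 + 3 * R) * dist v w"
proof -
  define a b where "a = plane_normal u v" and "b = plane_normal u w"
  define e f where "e = a /\<^sub>R norm a" and "f = b /\<^sub>R norm b"
  have a1: "1 \<le> norm a" and b1: "1 \<le> norm b"
    unfolding a_def b_def by (rule norm_plane_normal_ge_1[OF u])+
  have ab: "norm (a - b) \<le> norm (v - w)" unfolding a_def b_def by (rule norm_plane_normal_diff_le[OF u])
  have ef: "norm (e - f) \<le> 2 * norm (v - w)"
    using norm_normalize_diff_le[OF a1 b1] ab by (simp add: e_def f_def)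
  have e1: "norm e = 1" and f1: "norm f = 1"
  proof -
    have "norm a \<noteq> 0" "norm b \<noteq> 0" using a1 b1 by linarith+
    then show "norm e = 1" "norm f = 1" by (simp_all add: e_def f_def)
  qed
  have R: "0 \<le> R" using vw(1) norm_ge_zero[of v] by linarith
  have "onorm (\<lambda>x. orth_proj (plane_direction (graph_plane u v)) x - orth_proj (plane_direction (graph_plane u w)) x)
      \<le> 4 * norm (v - w)"
  proof (rule onorm_le)
    fix x
    have "orth_proj (plane_direction (graph_plane u v)) x - orth_proj (plane_direction (graph_plane u w)) x
        = (f \<bullet> x) *\<^sub>R f - (e \<bullet> x) *\<^sub>R e"
      by (simp add: graph_plane_direction_offset[OF u] e_def f_def a_def b_def)
    also have "\<dots> = ((f - e) \<bullet> x) *\<^sub>R f + (e \<bullet> x) *\<^sub>R (f - e)" by (simp add: algebra_simps inner_diff_left)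
    also have "norm \<dots> \<le> norm (f - e) * norm x * 1 + norm e * norm x * norm (f - e)"
      by (rule order_trans[OF norm_triangle_ineq]) (auto simp: f1 intro!: add_mono mult_right_mono Cauchy_Schwarz_ineq2)
    also have "\<dots> = 2 * norm (e - f) * norm x" by (simp add: e1 norm_minus_commute)
    also have "\<dots> \<le> 4 * norm (v - w) * norm x" using ef by (intro mult_right_mono) auto
    finally show "norm (orth_proj (plane_direction (graph_plane u v)) x - orth_proj (plane_direction (graph_plane u w)) x)
        \<le> 4 * norm (v - w) * norm x" .
  qed
  moreover have "norm (plane_offset (graph_plane u v) - plane_offset (graph_plane u w)) \<le> (1 + 3 * R) * norm (v - w)"
  proof -
    define \<alpha> \<beta> where "\<alpha> = v \<bullet> u / norm a" and "\<beta> = w \<bullet> u / norm b"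
    have wu: "\<bar>w \<bullet> u\<bar> \<le> R" using Cauchy_Schwarz_ineq2[of w u] u vw by simp
    have \<beta>: "\<bar>\<beta>\<bar> \<le> R"
    proof -
      have "\<bar>\<beta>\<bar> \<le> \<bar>w \<bullet> u\<bar> / 1" unfolding \<beta>_def abs_divide using b1 by (intro frac_le) auto
      then show ?thesis using wu by simp
    qed
    have \<alpha>\<beta>: "\<bar>\<alpha> - \<beta>\<bar> \<le> (1 + R) * norm (v - w)"
    proof -
      have "\<alpha> - \<beta> = ((v - w) \<bullet> u) / norm a + \<beta> * (norm b - norm a) / norm a"
      proof -
        have "a \<noteq> 0" "b \<noteq> 0" using a1 b1 by auto
        then show ?thesis by (simp add: \<alpha>_def \<beta>_def inner_diff_left field_simps)
      qed
      then have "\<bar>\<alpha> - \<beta>\<bar> \<le> \<bar>(v - w) \<bullet> u\<bar> / norm a + \<bar>\<beta>\<bar> * \<bar>norm b - norm a\<bar> / norm a"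
        using abs_triangle_ineq[of "((v - w) \<bullet> u) / norm a" "\<beta> * (norm b - norm a) / norm a"]
        by (simp add: abs_mult)
      also have "\<dots> \<le> norm (v - w) / 1 + R * norm (v - w) / 1"
      proof (intro add_mono frac_le mult_mono)
        show "\<bar>(v - w) \<bullet> u\<bar> \<le> norm (v - w)" using Cauchy_Schwarz_ineq2[of "v - w" u] u by simp
        show "\<bar>norm b - norm a\<bar> \<le> norm (v - w)"
          using norm_triangle_ineq3[of b a] ab by (simp add: norm_minus_commute)
      qed (use a1 \<beta> R in auto)
      finally show ?thesis by (simp add: algebra_simps)
    qed
    have "plane_offset (graph_plane u v) - plane_offset (graph_plane u w) = (\<alpha> - \<beta>) *\<^sub>R e + \<beta> *\<^sub>R (e - f)"
      by (simp add: graph_plane_direction_offset[OF u] e_def f_def a_def b_def \<alpha>_def \<beta>_def algebra_simps)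
    then have "norm (plane_offset (graph_plane u v) - plane_offset (graph_plane u w)) \<le> \<bar>\<alpha> - \<beta>\<bar> * 1 + \<bar>\<beta>\<bar> * norm (e - f)"
      using norm_triangle_ineq[of "(\<alpha> - \<beta>) *\<^sub>R e" "\<beta> *\<^sub>R (e - f)"] e1 by simp
    also have "\<dots> \<le> (1 + R) * norm (v - w) * 1 + R * (2 * norm (v - w))"
      using \<alpha>\<beta> \<beta> ef R by (intro add_mono mult_mono) auto
    finally show ?thesis by (simp add: algebra_simps)
  qed
  ultimately have "plane_dist (graph_plane u v) (graph_plane u w) \<le> 4 * norm (v - w) + (1 + 3 * R) * norm (v - w)"
    unfolding plane_dist_def by (rule add_mono)
  also have "\<dots> = (5 + 3 * R) * dist v w" by (simp add: dist_norm algebra_simps)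
  finally show ?thesis .
qed

section \<open>Uniform subfamilies and the dimension bound\<close>

lemma hausdorff_content_pos_real:
  assumes "hausdorff_content t E \<noteq> 0"
  obtains c where "0 < c" "ennreal c \<le> hausdorff_content t E"
proof (cases "hausdorff_content t E")
  case (real r)
  with assms show ?thesis using that[of r] by (cases "r = 0") auto
next
  case top
  then show ?thesis using that[of 1] by simp
qed

lemma hausdorff_measure_eq_0_if_content_eq_0:
  fixes E :: "'a::metric_space set"
  assumes "0 < t" "hausdorff_content t E = 0"
  shows "Met_TC.hausdorff_measure t E = 0"
  using Met_TC.hausdorff_measure_lipschitz_image_eq_0[of "\<lambda>x. x" E 1 t] assms by simp

text \<open>The dimension hypotheses give positive measure only below \<open>s\<close> and
  \<open>t\<close>, and nothing uniform in the plane. The exponents are therefore lowered slightly,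
  and the family is split into countably many subfamilies with uniform bounds, one of which is not
  null.\<close>

lemma hyperplane_furstenberg_dim:
  fixes K :: "'a::euclidean_space set"
  assumes d: "2 \<le> DIM('a)" and t: "1 < t" "t \<le> real DIM('a)" and s: "0 < s"
    and F: "furstenberg_set (DIM('a) - 1) s t K"
  shows "ereal (real DIM('a) - (real DIM('a) - 1 - s) * (2 * real DIM('a) - t - 1) / (real DIM('a) - 1))
    \<le> Met_TC.hausdorff_dim K"
proof (rule ccontr)
  define D where "D = real DIM('a)"
  define f where "f s t = D - (D - 1 - s) * (2 * D - t - 1) / (D - 1)" for s t
  assume "\<not> ?thesis"
  then have "Met_TC.hausdorff_dim K < ereal (f s t)" by (simp add: f_def D_def)
  then obtain a where a: "0 < a" "a < f s t" "Met_TC.hausdorff_measure a K = 0"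
    by (rule Met_TC.hausdorff_dim_lessE)
  \<comment> \<open>The threshold is continuous in both exponents, so the strict inequality for
    \<open>a\<close> survives lowering them.\<close>
  have "((\<lambda>h. f (s - h) (t - h)) \<longlongrightarrow> f (s - 0) (t - 0)) (at_right 0)"
    unfolding f_def by (intro tendsto_intros) (use d in \<open>auto simp: D_def\<close>)
  then have "\<forall>\<^sub>F h in at_right 0. a < f (s - h) (t - h)" by (rule order_tendstoD) (use a in simp)
  moreover have "\<forall>\<^sub>F h in at_right 0. 0 < h \<and> h < min s (t - 1)"
    unfolding eventually_at_right_field using s t by (intro exI[of _ "min s (t - 1)"]) auto
  ultimately have "\<forall>\<^sub>F h in at_right 0. a < f (s - h) (t - h) \<and> 0 < h \<and> h < min s (t - 1)"
    by eventually_elim simp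
  then obtain h where h: "a < f (s - h) (t - h)" "0 < h" "h < s" "h < t - 1"
    using eventually_happens'[OF trivial_limit_at_right_real] by auto
  define s' t' where "s' = s - h" and "t' = t - h"
  have s': "0 < s'" "s' < s" and t': "1 \<le> t'" "t' < t" "t' \<le> real DIM('a)"
    using h t by (auto simp: s'_def t'_def)
  obtain \<V> where \<V>: "\<V> \<subseteq> affine_planes (DIM('a) - 1)"
    "Metric_space.hausdorff_dim (affine_planes (DIM('a) - 1)) plane_dist \<V> = ereal t"
    "\<And>V. V \<in> \<V> \<Longrightarrow> ereal s \<le> Met_TC.hausdorff_dim (K \<inter> V)"
    using F unfolding furstenberg_set_def by blast
  interpret A: Metric_space "affine_planes (DIM('a) - 1) :: 'a set set" plane_dist
    by (rule Metric_space_affine_planes)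
  have \<V>_pos: "A.hausdorff_measure t' \<V> \<noteq> 0"
    using \<V>(2) t' by (intro A.hausdorff_measure_ne_0[of t]) auto
  \<comment> \<open>One integer bounds three quantities at once: the parameter, the radius of the
    ball in which the slice is taken, and the reciprocal of its content.\<close>
  define W where "W u N = {w \<in> cball 0 (real (Suc N)). graph_plane u w \<in> \<V> \<and>
      ennreal (1 / real (Suc N)) \<le> hausdorff_content s' (K \<inter> graph_plane u w \<inter> cball 0 (real (Suc N)))}" for u N
  have cover: "\<exists>u\<in>Basis. \<exists>N. V \<in> graph_plane u ` W u N" if V: "V \<in> \<V>" for V
  proof -
    obtain u w where u: "u \<in> Basis" "V = graph_plane u w"
      using affine_plane_is_graph_plane[of V] V \<V>(1) by blast
    have "Met_TC.hausdorff_measure s' (K \<inter> V) \<noteq> 0"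
      using \<V>(3)[OF V] s' by (rule Met_TC.hausdorff_measure_ne_0)
    then have "hausdorff_content s' (K \<inter> V) \<noteq> 0"
      using hausdorff_measure_eq_0_if_content_eq_0[OF s'(1)] by blast
    moreover have "K \<inter> V = (\<Union>N. K \<inter> V \<inter> cball 0 (real (Suc N)))"
    proof -
      have "\<exists>N. norm x \<le> real (Suc N)" for x :: 'a
        using real_arch_simple[of "norm x"] by (metis le_SucI of_nat_le_iff order_refl order_trans)
      then show ?thesis by auto
    qed
    ultimately obtain N0 where "hausdorff_content s' (K \<inter> V \<inter> cball 0 (real (Suc N0))) \<noteq> 0"
      using hausdorff_content_UN_eq_0[of s' "\<lambda>N. K \<inter> V \<inter> cball 0 (real (Suc N))"] by metis
    then obtain c where c: "0 < c" "ennreal c \<le> hausdorff_content s' (K \<inter> V \<inter> cball 0 (real (Suc N0)))"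
      by (rule hausdorff_content_pos_real)
    obtain N1 N2 :: nat where N12: "1 / c \<le> real N1" "norm w \<le> real N2" using real_arch_simple by metis
    define N where "N = N0 + N1 + N2"
    have "1 / c \<le> real (Suc N)" using N12(1) by (simp add: N_def)
    then have "1 / real (Suc N) \<le> c" using c(1) by (simp add: field_simps)
    then have "ennreal (1 / real (Suc N)) \<le> ennreal c" by (rule ennreal_leI)
    also note c(2)
    also have "hausdorff_content s' (K \<inter> V \<inter> cball 0 (real (Suc N0))) \<le> hausdorff_content s' (K \<inter> V \<inter> cball 0 (real (Suc N)))"
      by (intro hausdorff_content_mono) (auto simp: N_def)
    finally have "w \<in> W u N" using V u N12(2) by (simp add: W_def N_def)
    then show ?thesis using u by blast
  qed
  have "\<exists>u\<in>Basis. \<exists>N. hausdorff_content t' (W u N) \<noteq> 0"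
  proof (rule ccontr)
    assume "\<not> ?thesis"
    then have null: "hausdorff_content t' (W u N) = 0" if "u \<in> Basis" for u N using that by blast
    have "A.hausdorff_measure t' (graph_plane u ` W u N) = 0" if u: "u \<in> Basis" for u N
    proof (rule A.hausdorff_measure_lipschitz_image_eq_0[where L = "5 + 3 * real (Suc N)"])
      show "graph_plane u ` W u N \<subseteq> affine_planes (DIM('a) - 1)" using \<V>(1) by (auto simp: W_def)
      show "plane_dist (graph_plane u x) (graph_plane u y) \<le> (5 + 3 * real (Suc N)) * dist x y"
        if "x \<in> W u N" "y \<in> W u N" for x y
        using that u by (intro plane_dist_graph_plane_le) (auto simp: W_def)
    qed (use null u t' in auto)
    then have Nnull: "A.hausdorff_measure t' (\<Union>N. graph_plane u ` W u N) = 0" if "u \<in> Basis" for u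
      using that by (intro A.hausdorff_measure_UN_eq_0) auto
    \<comment> \<open>Enumerates the finite basis with repetitions, since countable unions are
      indexed by natural numbers.\<close>
    define g where "g = from_nat_into (Basis :: 'a set)"
    have gB: "g k \<in> Basis" for k unfolding g_def by (rule from_nat_into) simp
    have "A.hausdorff_measure t' (\<Union>k. \<Union>N. graph_plane (g k) ` W (g k) N) = 0"
      by (rule A.hausdorff_measure_UN_eq_0) (rule Nnull[OF gB])
    moreover have "\<V> \<subseteq> (\<Union>k. \<Union>N. graph_plane (g k) ` W (g k) N)"
    proof
      fix V assume "V \<in> \<V>"
      then obtain u N where u: "u \<in> Basis" "V \<in> graph_plane u ` W u N" using cover by blast
      obtain k where "u = g k"
        unfolding g_def using from_nat_into_surj[of Basis u] u(1) countable_finite[OF finite_Basis] by metis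
      then show "V \<in> (\<Union>k. \<Union>N. graph_plane (g k) ` W (g k) N)" using u(2) by blast
    qed
    ultimately have "A.hausdorff_measure t' \<V> = 0" using A.hausdorff_measure_mono_eq_0 by blast
    then show False using \<V>_pos by simp
  qed
  then obtain u N where u: "u \<in> Basis" and WN: "hausdorff_content t' (W u N) \<noteq> 0" by blast
  obtain c where c: "0 < c" "ennreal c \<le> hausdorff_content t' (W u N)"
    using WN by (rule hausdorff_content_pos_real)
  have u1: "norm u = 1" using u by simp
  have N1: "1 \<le> real (Suc N)" "0 < 1 / real (Suc N)" by simp_all
  have WR: "W u N \<subseteq> cball 0 (real (Suc N))" by (auto simp: W_def)
  have content: "ennreal (1 / real (Suc N))
      \<le> hausdorff_content s' (K \<inter> {x. plane_height u w x = 0} \<inter> cball 0 (real (Suc N)))"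
    if "w \<in> W u N" for w using that by (simp add: W_def graph_plane_def)
  have a': "a < real DIM('a) - (real DIM('a) - 1 - s') * (2 * real DIM('a) - t' - 1) / (real DIM('a) - 1)"
    using h(1) by (simp add: f_def D_def s'_def t'_def)
  obtain \<epsilon> where \<epsilon>: "0 < \<epsilon>"
    "\<And>U \<rho>. diameter_cover K U \<rho> \<Longrightarrow> (\<And>i. 0 < \<rho> i) \<Longrightarrow> ennreal \<epsilon> < (\<Sum>i. ennreal (\<rho> i powr a))"
    using furstenberg_hyperplanes_cover_bound[OF u1 d N1(1) t'(1,3) s'(1) WR c N1(2) content a(1) a'] by blast
  obtain U \<rho> where cov: "diameter_cover K U \<rho>" and pos: "\<forall>i. 0 < \<rho> i"
    and le: "(\<Sum>i. ennreal (\<rho> i powr a)) \<le> ennreal \<epsilon>"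
    by (rule hausdorff_measure_eq_0_cover[OF a(3,1) \<epsilon>(1)])
  have "ennreal \<epsilon> < (\<Sum>i. ennreal (\<rho> i powr a))" by (rule \<epsilon>(2)[OF cov]) (rule spec[OF pos])
  with le show False by (meson leD)
qed

theorem theorem1p8:
  shows "(\<forall>(s::real) (t::real) (K :: (real^2) set).
            0 < s \<and> s \<le> 1 \<and> 1 < t \<and> t \<le> 2 \<and> furstenberg_set 1 s t K \<longrightarrow>
            Met_TC.hausdorff_dim K \<ge> ereal (2 * s + (1 - s) * (t - 1))) \<and>
         (CARD('d::finite) \<ge> 2 \<longrightarrow>
          (\<forall>(s::real) (t::real) (K :: (real^'d) set).
            1 < t \<and> t \<le> real CARD('d) \<and> 0 < s \<and> s \<le> real CARD('d) - 1 \<and>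
            furstenberg_set (CARD('d) - 1) s t K \<longrightarrow>
            Met_TC.hausdorff_dim K \<ge>
              ereal ((2 * s + 2 - real CARD('d)) +
                     (t - 1) * (real CARD('d) - 1 - s) / (real CARD('d) - 1))))"
proof (intro conjI allI impI; elim conjE)
  fix s t :: real and K :: "(real^2) set"
  assume "0 < s" "s \<le> 1" "1 < t" "t \<le> 2" "furstenberg_set 1 s t K"
  then have "ereal (2 - (1 - s) * (3 - t)) \<le> Met_TC.hausdorff_dim K"
    using hyperplane_furstenberg_dim[of t s K] by simp
  moreover have "2 - (1 - s) * (3 - t) = 2 * s + (1 - s) * (t - 1)" by (simp add: algebra_simps)
  ultimately show "Met_TC.hausdorff_dim K \<ge> ereal (2 * s + (1 - s) * (t - 1))" by simp
next
  fix s t :: real and K :: "(real^'d) set"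
  assume d: "CARD('d) \<ge> 2" and "1 < t" "t \<le> real CARD('d)" "0 < s" "furstenberg_set (CARD('d) - 1) s t K"
  define D where "D = real CARD('d)"
  have "ereal (D - (D - 1 - s) * (2 * D - t - 1) / (D - 1)) \<le> Met_TC.hausdorff_dim K"
    using hyperplane_furstenberg_dim[of t s K] \<open>1 < t\<close> \<open>t \<le> _\<close> \<open>0 < s\<close> \<open>furstenberg_set _ s t K\<close> d
    by (simp add: D_def)
  \<comment> \<open>Write \<open>2 * D - t - 1\<close> as
    \<open>2 * (D - 1) - (t - 1)\<close>.\<close>
  moreover have "D - (D - 1 - s) * (2 * D - t - 1) / (D - 1) = (2 * s + 2 - D) + (t - 1) * (D - 1 - s) / (D - 1)"
  proof -
    have "D - 1 \<noteq> 0" using d by (simp add: D_def)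
    then show ?thesis by (simp add: field_simps)
  qed
  ultimately show "Met_TC.hausdorff_dim K \<ge> ereal ((2 * s + 2 - real CARD('d)) +
      (t - 1) * (real CARD('d) - 1 - s) / (real CARD('d) - 1))"
    unfolding D_def[symmetric] by (simp only:)
qed

end
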